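(* Let $(X,0)$ and $(Y,0)$ be two germs of analytic spaces and let $\phi:(X,0)\to(Y,0)$ be a smooth morphism. Then $(X,0)$ has quadratic algebraic singularities if and only if $(Y,0)$ has quadratic algebraic singularities.
   Context: An analytic algebra is a $\mathbb C$-algebra of the form $\mathbb C\{x_1,\ldots,x_n\}/I$ (a nonzero quotient of a convergent power series ring); morphisms are local homomorphisms of $\mathbb C$-algebras. The category of germs of analytic spaces is the opposite of the category of analytic algebras: the germ $(X,x)$ corresponds to $\mathcal O_{X,x}$. A local homomorphism $\psi:R\to S$ is formally smooth if for every exact sequence $0\to I\to B\to A\to 0$ with $B\to A$ a surjection of local artinian $R$-algebras (with residue field $\mathbb C$) and $I$ annihilated by the maximal ideal of $B$, the induced map $\mathrm{Hom}_R(S,B)\to\mathrm{Hom}_R(S,A)$ (local homomorphisms of $R$-algebras) is surjective. A morphism of germs $(X,x)\to(Y,y)$ is smooth if the corresponding morphism of analytic algebras $\mathcal O_{Y,y}\to\mathcal O_{X,x}$ is formally smooth. A germ of analytic space has quadratic algebraic singularities if it is isomorphic to the germ at $0$ of an affine scheme in some $\mathbb C^N$ defined by finitely many homogeneous quadratic polynomials; equivalently, its analytic algebra is isomorphic to $\mathbb C\{x_1,\ldots,x_N\}/I$ with $I$ generated by finitely many homogeneous quadratic polynomials. *)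

theory Defs
  imports
    "HOL-Algebra.QuotRing"
    "HOL-Algebra.Module"
    "HOL-Algebra.Algebraic_Closure_Type"
    "HOL-Analysis.Infinite_Sum"
    "HOL-Library.Poly_Mapping"
begin

section \<open>Complex algebras\<close>

abbreviation complex_ring :: "complex ring"
  where "complex_ring \<equiv> ring_of_type_algebra"

definition complex_algebra :: "(complex, 'a) module \<Rightarrow> bool"
  where "complex_algebra A \<longleftrightarrow> algebra complex_ring A"

definition algebra_hom :: "(complex, 'a) module \<Rightarrow> (complex, 'b) module \<Rightarrow> ('a \<Rightarrow> 'b) set"
  where "algebra_hom A B =
    {f \<in> ring_hom A B. \<forall>c. \<forall>a \<in> carrier A. f (c \<odot>\<^bsub>A\<^esub> a) = c \<odot>\<^bsub>B\<^esub> f a}"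

definition algebra_iso :: "(complex, 'a) module \<Rightarrow> (complex, 'b) module \<Rightarrow> ('a \<Rightarrow> 'b) set"
  where "algebra_iso A B = {f \<in> algebra_hom A B. bij_betw f (carrier A) (carrier B)}"

text \<open>The quotient ring \<open>A Quot I\<close>, with the induced scalar multiplication on cosets.\<close>

definition quot_algebra :: "(complex, 'a) module \<Rightarrow> 'a set \<Rightarrow> (complex, 'a set) module"
  where "quot_algebra A I =
    \<lparr>carrier = carrier (A Quot I), monoid.mult = monoid.mult (A Quot I),
     one = \<one>\<^bsub>A Quot I\<^esub>, zero = \<zero>\<^bsub>A Quot I\<^esub>, add = add (A Quot I),
     module.smult = (\<lambda>c K. \<Union>x\<in>K. I +>\<^bsub>A\<^esub> (c \<odot>\<^bsub>A\<^esub> x))\<rparr>"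


section \<open>Local algebras\<close>

definition local_ring :: "('a, 'm) ring_scheme \<Rightarrow> bool"
  where "local_ring A \<longleftrightarrow> cring A \<and> (\<exists>!M. maximalideal M A)"

definition max_ideal :: "('a, 'm) ring_scheme \<Rightarrow> 'a set"
  where "max_ideal A = (THE M. maximalideal M A)"

definition local_algebra_hom ::
    "(complex, 'a) module \<Rightarrow> (complex, 'b) module \<Rightarrow> ('a \<Rightarrow> 'b) set"
  where "local_algebra_hom A B = {f \<in> algebra_hom A B. f ` max_ideal A \<subseteq> max_ideal B}"

definition artinian_ring :: "('a, 'm) ring_scheme \<Rightarrow> bool"
  where "artinian_ring A \<longleftrightarrow>
    (\<forall>J :: nat \<Rightarrow> 'a set. (\<forall>k. ideal (J k) A) \<and> (\<forall>k. J (Suc k) \<subseteq> J k)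
       \<longrightarrow> (\<exists>k. \<forall>l\<ge>k. J l = J k))"

definition local_artinian_algebra :: "(complex, 'a) module \<Rightarrow> bool"
  where "local_artinian_algebra A \<longleftrightarrow>
    complex_algebra A \<and> local_ring A \<and> artinian_ring A \<and>
    (\<lambda>c. max_ideal A +>\<^bsub>A\<^esub> (c \<odot>\<^bsub>A\<^esub> \<one>\<^bsub>A\<^esub>)) \<in> ring_iso complex_ring (A Quot max_ideal A)"


section \<open>Convergent power series and analytic algebras\<close>

text \<open>A monomial in the variables \<open>x\<^sub>0, x\<^sub>1, \<dots>\<close> is its exponent vector, and a power series is its
  family of coefficients.\<close>

type_synonym power_series = "(nat \<Rightarrow>\<^sub>0 nat) \<Rightarrow> complex"

definition mdeg :: "(nat \<Rightarrow>\<^sub>0 nat) \<Rightarrow> nat"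
  where "mdeg \<alpha> = (\<Sum>i\<in>Poly_Mapping.keys \<alpha>. Poly_Mapping.lookup \<alpha> i)"

definition in_vars :: "nat \<Rightarrow> power_series \<Rightarrow> bool"
  where "in_vars n f \<longleftrightarrow> (\<forall>\<alpha>. f \<alpha> \<noteq> 0 \<longrightarrow> Poly_Mapping.keys \<alpha> \<subseteq> {..<n})"

text \<open>Convergence in a neighbourhood of 0 is absolute convergence at some \<open>(r, \<dots>, r)\<close>, \<open>r > 0\<close>.\<close>

definition convergent_series :: "power_series \<Rightarrow> bool"
  where "convergent_series f \<longleftrightarrow>
    (\<exists>r::real. r > 0 \<and> (\<lambda>\<alpha>. f \<alpha> * of_real r ^ mdeg \<alpha>) abs_summable_on UNIV)"

definition series_mult :: "power_series \<Rightarrow> power_series \<Rightarrow> power_series"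
  where "series_mult f g = (\<lambda>\<gamma>. \<Sum>(\<alpha>, \<beta>) | \<alpha> + \<beta> = \<gamma>. f \<alpha> * g \<beta>)"

definition conv_series :: "nat \<Rightarrow> (complex, power_series) module"
  where "conv_series n =
    \<lparr>carrier = {f. in_vars n f \<and> convergent_series f}, monoid.mult = series_mult,
     one = (\<lambda>\<alpha>. if \<alpha> = 0 then 1 else 0), zero = (\<lambda>_. 0), add = (\<lambda>f g \<alpha>. f \<alpha> + g \<alpha>),
     module.smult = (\<lambda>c f \<alpha>. c * f \<alpha>)\<rparr>"

definition analytic_algebra :: "(complex, 'a) module \<Rightarrow> bool"
  where "analytic_algebra A \<longleftrightarrow> complex_algebra A \<and>
    (\<exists>n I. ideal I (conv_series n) \<and> I \<noteq> carrier (conv_series n) \<and>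
       algebra_iso A (quot_algebra (conv_series n) I) \<noteq> {})"

definition homogeneous_quadratic :: "nat \<Rightarrow> power_series \<Rightarrow> bool"
  where "homogeneous_quadratic n f \<longleftrightarrow> in_vars n f \<and> (\<forall>\<alpha>. f \<alpha> \<noteq> 0 \<longrightarrow> mdeg \<alpha> = 2)"


section \<open>Formal smoothness\<close>

text \<open>An algebra over the complex algebra \<open>R\<close> is a complex algebra \<open>S\<close> with a structure
  homomorphism \<open>\<rho>\<close> from \<open>R\<close> to \<open>S\<close>.\<close>

definition hom_over ::
    "(complex, 'r) module \<Rightarrow> (complex, 'a) module \<Rightarrow> ('r \<Rightarrow> 'a) \<Rightarrow>
     (complex, 'b) module \<Rightarrow> ('r \<Rightarrow> 'b) \<Rightarrow> ('a \<Rightarrow> 'b) set"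
  where "hom_over R S \<rho> B \<beta> = {f \<in> local_algebra_hom S B. \<forall>r \<in> carrier R. f (\<rho> r) = \<beta> r}"

text \<open>A local artinian algebra with residue field \<open>\<complex>\<close> is finite-dimensional over \<open>\<complex>\<close>, hence a
  quotient of some \<open>conv_series n\<close>. The test algebras \<open>A\<close> and \<open>B\<close> below therefore range over all
  such algebras up to isomorphism, although their carriers lie in a fixed type.\<close>

definition formally_smooth ::
    "(complex, 'r) module \<Rightarrow> (complex, 's) module \<Rightarrow> ('r \<Rightarrow> 's) \<Rightarrow> bool"
  where "formally_smooth R S \<psi> \<longleftrightarrow> \<psi> \<in> local_algebra_hom R S \<and>
    (\<forall>(A :: (complex, power_series set) module) \<alpha> (B :: (complex, power_series set) module) \<beta> p.
       local_artinian_algebra A \<and> \<alpha> \<in> local_algebra_hom R A \<and>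
       local_artinian_algebra B \<and> \<beta> \<in> local_algebra_hom R B \<and>
       p \<in> hom_over R B \<beta> A \<alpha> \<and> p ` carrier B = carrier A \<and>
       (\<forall>x \<in> a_kernel B A p. \<forall>m \<in> max_ideal B. m \<otimes>\<^bsub>B\<^esub> x = \<zero>\<^bsub>B\<^esub>)
       \<longrightarrow> (\<forall>g \<in> hom_over R S \<psi> A \<alpha>. \<exists>h \<in> hom_over R S \<psi> B \<beta>. \<forall>s \<in> carrier S. p (h s) = g s))"


section \<open>Germs of analytic spaces\<close>

text \<open>A germ \<open>(X, 0)\<close> is given by its analytic algebra \<open>OX\<close>, and a morphism of germs from
  \<open>(X, 0)\<close> to \<open>(Y, 0)\<close> by the corresponding local homomorphism from \<open>OY\<close> to \<open>OX\<close>.\<close>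

definition germ_morphism ::
    "(complex, 'a) module \<Rightarrow> (complex, 'b) module \<Rightarrow> ('b \<Rightarrow> 'a) \<Rightarrow> bool"
  where "germ_morphism OX OY \<phi> \<longleftrightarrow> \<phi> \<in> local_algebra_hom OY OX"

definition smooth_morphism ::
    "(complex, 'a) module \<Rightarrow> (complex, 'b) module \<Rightarrow> ('b \<Rightarrow> 'a) \<Rightarrow> bool"
  where "smooth_morphism OX OY \<phi> \<longleftrightarrow> germ_morphism OX OY \<phi> \<and> formally_smooth OY OX \<phi>"

definition quadratic_algebraic_singularities :: "(complex, 'a) module \<Rightarrow> bool"
  where "quadratic_algebraic_singularities OX \<longleftrightarrow>
    (\<exists>N F. finite F \<and> (\<forall>f \<in> F. homogeneous_quadratic N f) \<and>
       algebra_iso OX (quot_algebra (conv_series N) (Idl\<^bsub>conv_series N\<^esub> F)) \<noteq> {})"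

end

theory Submission
  imports Defs "HOL-Computational_Algebra.Primes"
begin

text \<open>Write \<open>\<O>\<^sub>Y = C m / J\<close>. Choose as few elements \<open>t\<^sub>1, \<dots>, t\<^sub>d\<close> as possible that generate the maximal
  ideal of \<open>\<O>\<^sub>X\<close> together with the image of that of \<open>\<O>\<^sub>Y\<close>. Then \<open>C (m + d)\<close> maps onto \<open>\<O>\<^sub>X\<close>, by the
  inverse function theorem and Krull's intersection theorem, and by minimality no relation involves a
  \<open>t\<^sub>l\<close> linearly. Formal smoothness lifts the resulting map from \<open>\<O>\<^sub>X\<close> to a quotient of \<open>C (m + d)\<close> by
  terms of order 2 through all the thickenings \<open>C (m + d) / (J + M\<^sup>k)\<close>, where \<open>M\<close> is the maximal ideal,
  so that the relations lie in the ideal of \<open>J\<close>: \<open>\<O>\<^sub>X = \<O>\<^sub>Y{t\<^sub>1, \<dots>, t\<^sub>d}\<close>. Thus quadratic equations of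
  \<open>Y\<close> are also equations of \<open>X\<close>.

  Conversely, let \<open>J\<close> have order 2, and let \<open>\<Phi>\<close> and \<open>\<Psi>\<close> be the changes of coordinates between
  \<open>\<O>\<^sub>Y{t\<^sub>1, \<dots>, t\<^sub>d}\<close> and a quadratic presentation of \<open>\<O>\<^sub>X\<close>. The linear part of \<open>\<Phi>\<close> turns the quadrics
  into leading forms of elements of the ideal of \<open>J\<close>, hence into quadrics in the variables of \<open>Y\<close>.
  Up to linear changes, \<open>\<Phi>\<close> and \<open>\<Psi>\<close> at \<open>t = 0\<close> are automorphisms tangent to the identity that map
  the ideal of these quadrics into \<open>J\<close> and back, so both ideals are isomorphic.\<close>

section \<open>Exponent vectors\<close>

text \<open>Formal smoothness tests artinian algebras only: it gives one approximate lift for each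
  power of \<open>M\<close> and no limit of these lifts. None is needed, since each lift puts the
  relations into the ideal of \<open>J\<close> up to \<open>M\<^sup>k\<close>, and ideals of
  convergent series are closed. This closedness, \<open>krull\<close>, is the pivot. It also shows
  that algebra homomorphisms, which are not assumed continuous, are substitutions, that congruences
  of variables extend to power series, and that an ideal mapped into itself by a unipotent
  substitution equals its preimage. It rests on division by series with prescribed initial
  monomials, where the convergence of the quotients is the real issue. Minimality of
  \<open>d\<close> starts the lifting: all relations lie in the ideal of series vanishing at 0
  without linear terms in the \<open>t\<^sub>l\<close>, whose product with \<open>M\<close> lies in
  \<open>M\<^sup>2\<close>. In the converse, the two maps obtained at \<open>t = 0\<close> need not
  be inverse to each other. Each is an automorphism of \<open>C m\<close>, but equality of ideals
  has to come from their composite, which is tangent to the identity and preserves the ideal of the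
  quadrics.\<close>

type_synonym expo = "nat \<Rightarrow>\<^sub>0 nat"

abbreviation (input) keys where "keys \<equiv> Poly_Mapping.keys"
abbreviation (input) lookup where "lookup \<equiv> Poly_Mapping.lookup"
abbreviation single1 :: "nat \<Rightarrow> expo" where "single1 i \<equiv> Poly_Mapping.single i 1"

definition mpow :: "(nat \<Rightarrow> 'a::comm_monoid_mult) \<Rightarrow> expo \<Rightarrow> 'a"
  where "mpow g \<alpha> = (\<Prod>i\<in>keys \<alpha>. g i ^ lookup \<alpha> i)"

lemma keys_add_nat: "keys (\<alpha> + \<beta> :: expo) = keys \<alpha> \<union> keys \<beta>"
  by (auto simp: in_keys_iff lookup_add)

lemma mpow_superset: "finite A \<Longrightarrow> keys \<alpha> \<subseteq> A \<Longrightarrow> mpow g \<alpha> = (\<Prod>i\<in>A. g i ^ lookup \<alpha> i)"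
  unfolding mpow_def by (rule prod.mono_neutral_left) (auto simp: in_keys_iff)

lemma mpow_add: "mpow g (\<alpha> + \<beta>) = mpow g \<alpha> * mpow g \<beta>"
proof -
  let ?A = "keys \<alpha> \<union> keys \<beta>"
  have "mpow g (\<alpha> + \<beta>) = (\<Prod>i\<in>?A. g i ^ lookup (\<alpha> + \<beta>) i)"
    by (simp add: mpow_superset keys_add_nat)
  also have "\<dots> = mpow g \<alpha> * mpow g \<beta>"
    by (simp add: mpow_superset[of ?A] lookup_add power_add prod.distrib)
  finally show ?thesis .
qed

lemma mpow_0 [simp]: "mpow g 0 = 1"
  by (simp add: mpow_def)

lemma mpow_single [simp]: "mpow g (Poly_Mapping.single i k) = g i ^ k"
  by (cases "k = 0") (simp_all add: mpow_def)

lemma mpow_cong: "(\<And>i. i \<in> keys \<alpha> \<Longrightarrow> g i = h i) \<Longrightarrow> mpow g \<alpha> = mpow h \<alpha>"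
  by (simp add: mpow_def)

lemma mdeg_superset: "finite A \<Longrightarrow> keys \<alpha> \<subseteq> A \<Longrightarrow> mdeg \<alpha> = (\<Sum>i\<in>A. lookup \<alpha> i)"
  unfolding mdeg_def by (rule sum.mono_neutral_left) (auto simp: in_keys_iff)

lemma mdeg_add [simp]: "mdeg (\<alpha> + \<beta>) = mdeg \<alpha> + mdeg \<beta>"
proof -
  let ?A = "keys \<alpha> \<union> keys \<beta>"
  have "mdeg (\<alpha> + \<beta>) = (\<Sum>i\<in>?A. lookup (\<alpha> + \<beta>) i)"
    by (simp add: mdeg_superset keys_add_nat)
  also have "\<dots> = mdeg \<alpha> + mdeg \<beta>"
    by (simp add: mdeg_superset[of ?A] lookup_add sum.distrib)
  finally show ?thesis .
qed

lemma mdeg_0 [simp]: "mdeg 0 = 0"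
  by (simp add: mdeg_def)

lemma mdeg_single [simp]: "mdeg (Poly_Mapping.single i k) = k"
  by (cases "k = 0") (simp_all add: mdeg_def)

lemma lookup_le_mdeg: "lookup \<alpha> i \<le> mdeg \<alpha>"
proof (cases "i \<in> keys \<alpha>")
  case True
  then show ?thesis
    unfolding mdeg_def by (intro member_le_sum) auto
qed (simp add: in_keys_iff)

lemma mdeg_eq_0_iff: "mdeg \<alpha> = 0 \<longleftrightarrow> \<alpha> = 0"
proof
  assume "mdeg \<alpha> = 0"
  then have "lookup \<alpha> i = 0" for i
    using lookup_le_mdeg[of \<alpha> i] by simp
  then show "\<alpha> = 0" by (intro poly_mapping_eqI) simp
qed simp

lemma expo_split:
  assumes "i \<in> keys (\<alpha>::expo)"
  obtains \<beta> where "\<alpha> = single1 i + \<beta>"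
proof
  show "\<alpha> = single1 i + (\<alpha> - single1 i)"
    using assms by (intro poly_mapping_eqI) (auto simp: lookup_add lookup_minus lookup_single in_keys_iff when_def)
qed

lemma mdeg_eq_1:
  assumes "mdeg \<alpha> = 1"
  shows "\<exists>i. \<alpha> = single1 i"
proof -
  have "\<alpha> \<noteq> 0" using assms by auto
  then have "keys \<alpha> \<noteq> {}" by simp
  then obtain i where "i \<in> keys \<alpha>" by blast
  then obtain \<beta> where \<beta>: "\<alpha> = single1 i + \<beta>" by (rule expo_split)
  then have "mdeg \<beta> = 0" using assms by simp
  then show ?thesis using \<beta> by (auto simp: mdeg_eq_0_iff)
qed

lemma mpow_const: "mpow (\<lambda>_. c) \<alpha> = c ^ mdeg \<alpha>"
  by (simp add: mpow_def mdeg_def power_sum)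

lemma finite_bounded_expo:
  assumes "finite A"
  shows "finite {\<alpha>::expo. keys \<alpha> \<subseteq> A \<and> (\<forall>i. lookup \<alpha> i \<le> d)}" (is "finite ?S")
proof -
  let ?T = "{f :: nat \<Rightarrow> nat. \<forall>x. (x \<in> A \<longrightarrow> f x \<in> {..d}) \<and> (x \<notin> A \<longrightarrow> f x = 0)}"
  have "finite ?T"
    by (rule finite_set_of_finite_funs) (simp_all add: assms)
  moreover have "lookup ` ?S \<subseteq> ?T"
    by (auto simp: in_keys_iff)
  ultimately have "finite (lookup ` ?S)"
    by (rule finite_subset[rotated])
  moreover have "inj_on lookup ?S"
    by (rule inj_onI) (simp only: Poly_Mapping.lookup_inject)
  ultimately show ?thesis
    by (rule finite_imageD)
qed

definition lowdeg :: "nat \<Rightarrow> nat \<Rightarrow> expo set"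
  where "lowdeg n d = {\<alpha>. keys \<alpha> \<subseteq> {..<n} \<and> mdeg \<alpha> \<le> d}"

lemma finite_lowdeg [simp]: "finite (lowdeg n d)"
  by (rule finite_subset[OF _ finite_bounded_expo[of "{..<n}" d]])
     (auto simp: lowdeg_def intro: order_trans[OF lookup_le_mdeg])

lemma finite_splits [simp]: "finite {(\<alpha>, \<beta>). \<alpha> + \<beta> = (\<gamma>::expo)}"
proof -
  let ?S = "{\<alpha>::expo. keys \<alpha> \<subseteq> keys \<gamma> \<and> (\<forall>i. lookup \<alpha> i \<le> mdeg \<gamma>)}"
  have fin: "finite ?S" by (intro finite_bounded_expo) simp
  have "{(\<alpha>, \<beta>). \<alpha> + \<beta> = \<gamma>} \<subseteq> ?S \<times> ?S"
  proof (clarsimp simp: keys_add_nat, intro conjI allI)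
    fix \<alpha> \<beta> :: expo and i
    show "lookup \<alpha> i \<le> mdeg \<alpha> + mdeg \<beta>" using lookup_le_mdeg[of \<alpha> i] by simp
    show "lookup \<beta> i \<le> mdeg \<alpha> + mdeg \<beta>" using lookup_le_mdeg[of \<beta> i] by simp
  qed
  then show ?thesis by (rule finite_subset) (intro finite_cartesian_product fin)
qed

section \<open>The ring of formal power series\<close>

text \<open>A type of its own, so that the convolution product can be the class operation
  \<open>*\<close> and ring arithmetic, \<open>sum\<close> and \<open>prod\<close> apply. Bounds on
  the variables and convergence are imposed only later, by \<open>C n\<close>.\<close>

typedef pseries = "UNIV :: power_series set"
  morphisms cf Ser ..

setup_lifting type_definition_pseries

lemmas Ser_cf [simp] = cf_inverse
lemma cf_Ser [simp]: "cf (Ser f) = f"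
  by (simp add: Ser_inverse)

lemma pseries_eqI: "(\<And>\<alpha>. cf f \<alpha> = cf g \<alpha>) \<Longrightarrow> f = g"
  by (metis cf_inverse ext)

instantiation pseries :: comm_ring_1
begin

lift_definition zero_pseries :: pseries is "\<lambda>_. 0" .
lift_definition one_pseries :: pseries is "\<lambda>\<alpha>. if \<alpha> = 0 then 1 else 0" .
lift_definition plus_pseries :: "pseries \<Rightarrow> pseries \<Rightarrow> pseries" is "\<lambda>f g \<alpha>. f \<alpha> + g \<alpha>" .
lift_definition minus_pseries :: "pseries \<Rightarrow> pseries \<Rightarrow> pseries" is "\<lambda>f g \<alpha>. f \<alpha> - g \<alpha>" .
lift_definition uminus_pseries :: "pseries \<Rightarrow> pseries" is "\<lambda>f \<alpha>. - f \<alpha>" .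
lift_definition times_pseries :: "pseries \<Rightarrow> pseries \<Rightarrow> pseries" is series_mult .

instance
proof
  fix a b c :: pseries
  show "a * b = b * a"
    by transfer (auto simp: series_mult_def fun_eq_iff add.commute mult.commute
      intro!: sum.reindex_bij_witness[of _ "\<lambda>(x, y). (y, x)" "\<lambda>(x, y). (y, x)"])
  show "1 * a = a"
  proof (transfer, rule ext)
    fix a :: power_series and \<gamma>
    let ?g = "\<lambda>x :: expo \<times> expo. (if fst x = 0 then 1 else 0) * a (snd x)"
    have "series_mult (\<lambda>\<alpha>. if \<alpha> = 0 then 1 else 0) a \<gamma> = sum ?g {(\<alpha>, \<beta>). \<alpha> + \<beta> = \<gamma>}"
      by (simp add: series_mult_def case_prod_unfold)
    also have "\<dots> = sum ?g {(0, \<gamma>)}"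
      by (rule sum.mono_neutral_right) (auto split: if_splits)
    finally show "series_mult (\<lambda>\<alpha>. if \<alpha> = 0 then 1 else 0) a \<gamma> = a \<gamma>" by simp
  qed
  show "(a + b) * c = a * c + b * c"
    by transfer (simp add: series_mult_def fun_eq_iff sum.distrib ring_distribs case_prod_unfold)
  show "a * b * c = a * (b * c)"
  proof (transfer, rule ext)
    fix a b c :: power_series and \<delta>
    let ?S = "\<lambda>\<gamma>::expo. {(\<alpha>, \<beta>). \<alpha> + \<beta> = \<gamma>}"
    have "series_mult (series_mult a b) c \<delta>
        = (\<Sum>x\<in>?S \<delta>. \<Sum>y\<in>?S (fst x). a (fst y) * b (snd y) * c (snd x))"
      by (simp add: series_mult_def case_prod_unfold sum_distrib_right)
    also have "\<dots> = (\<Sum>(x, y)\<in>Sigma (?S \<delta>) (\<lambda>x. ?S (fst x)). a (fst y) * b (snd y) * c (snd x))"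
      by (rule sum.Sigma) auto
    \<comment> \<open>Both sides run over the ways to write \<delta> as a sum of three exponents;
      the bijection moves the brackets.\<close>
    also have "\<dots> = (\<Sum>(x, y)\<in>Sigma (?S \<delta>) (\<lambda>x. ?S (snd x)). a (fst x) * (b (fst y) * c (snd y)))"
      by (rule sum.reindex_bij_witness[of _
          "\<lambda>(x, y). ((fst x + fst y, snd y), (fst x, fst y))"
          "\<lambda>(x, y). ((fst y, snd y + snd x), (snd y, snd x))"]) (auto simp: add.assoc)
    also have "\<dots> = (\<Sum>x\<in>?S \<delta>. \<Sum>y\<in>?S (snd x). a (fst x) * (b (fst y) * c (snd y)))"
      by (rule sum.Sigma[symmetric]) auto
    also have "\<dots> = series_mult a (series_mult b c) \<delta>"
      by (simp add: series_mult_def case_prod_unfold sum_distrib_left)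
    finally show "series_mult (series_mult a b) c \<delta> = series_mult a (series_mult b c) \<delta>" .
  qed
  show "(0::pseries) \<noteq> 1"
    by transfer (auto simp: fun_eq_iff)
qed (transfer; simp add: fun_eq_iff)+

end

lemma cf_0 [simp]: "cf 0 \<alpha> = 0" by transfer simp
lemma cf_1: "cf 1 \<alpha> = (if \<alpha> = 0 then 1 else 0)" by transfer simp
lemma cf_add [simp]: "cf (f + g) \<alpha> = cf f \<alpha> + cf g \<alpha>" by transfer simp
lemma cf_diff [simp]: "cf (f - g) \<alpha> = cf f \<alpha> - cf g \<alpha>" by transfer simp
lemma cf_uminus [simp]: "cf (- f) \<alpha> = - cf f \<alpha>" by transfer simp
lemma cf_mult: "cf (f * g) \<gamma> = (\<Sum>(\<alpha>, \<beta>) | \<alpha> + \<beta> = \<gamma>. cf f \<alpha> * cf g \<beta>)"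
  by (simp only: times_pseries.rep_eq series_mult_def)
lemma cf_sum [simp]: "cf (sum f A) \<alpha> = (\<Sum>x\<in>A. cf (f x) \<alpha>)"
  by (induction A rule: infinite_finite_induct) auto

lift_definition scl :: "complex \<Rightarrow> pseries \<Rightarrow> pseries" is "\<lambda>c f \<alpha>. c * f \<alpha>" .

lemma cf_scl [simp]: "cf (scl c f) \<alpha> = c * cf f \<alpha>" by transfer simp

text \<open>Provides span, independence and dimension, on which the treatment of cotangent spaces
  and the artinian property of the test algebras rest.\<close>

interpretation pseries_vs: vector_space scl
  by standard (auto intro!: pseries_eqI simp: algebra_simps)

lemma scl_mult_left: "scl c f * g = scl c (f * g)"
  by (rule pseries_eqI) (simp add: cf_mult sum_distrib_left case_prod_unfold mult.assoc)

lemma scl_mult_right: "f * scl c g = scl c (f * g)"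
  by (metis mult.commute scl_mult_left)

definition xpow :: "expo \<Rightarrow> pseries"
  where "xpow \<alpha> = Ser (\<lambda>\<beta>. if \<beta> = \<alpha> then 1 else 0)"

lemma cf_xpow: "cf (xpow \<alpha>) \<beta> = (if \<beta> = \<alpha> then 1 else 0)"
  by (simp add: xpow_def)

lemma xpow_0: "xpow 0 = 1"
  by (rule pseries_eqI) (simp add: cf_xpow cf_1)

lemma cf_xpow_mult: "cf (xpow \<alpha> * f) (\<alpha> + \<gamma>) = cf f \<gamma>"
proof -
  have "cf (xpow \<alpha> * f) (\<alpha> + \<gamma>) = (\<Sum>(\<beta>, \<delta>) \<in> {(\<alpha>, \<gamma>)}. cf (xpow \<alpha>) \<beta> * cf f \<delta>)"
    unfolding cf_mult by (rule sum.mono_neutral_right) (auto simp: cf_xpow split: if_splits)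
  then show ?thesis by (simp add: cf_xpow)
qed

lemma cf_xpow_mult_0: "(\<And>\<delta>. \<gamma> \<noteq> \<alpha> + \<delta>) \<Longrightarrow> cf (xpow \<alpha> * f) \<gamma> = 0"
  unfolding cf_mult by (rule sum.neutral) (auto simp: cf_xpow)

lemma xpow_add: "xpow (\<alpha> + \<beta>) = xpow \<alpha> * xpow \<beta>"
proof (rule pseries_eqI)
  fix \<gamma>
  show "cf (xpow (\<alpha> + \<beta>)) \<gamma> = cf (xpow \<alpha> * xpow \<beta>) \<gamma>"
  proof (cases "\<exists>\<delta>. \<gamma> = \<alpha> + \<delta>")
    case True
    then show ?thesis by (auto simp: cf_xpow_mult) (simp add: cf_xpow)
  next
    case False
    then show ?thesis by (subst cf_xpow_mult_0) (auto simp: cf_xpow)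
  qed
qed

definition xv :: "nat \<Rightarrow> pseries"
  where "xv i = xpow (single1 i)"

lemma cf_xv: "cf (xv i) \<alpha> = (if \<alpha> = single1 i then 1 else 0)"
  by (simp add: xv_def cf_xpow)

lemma xpow_eq_mpow: "xpow \<alpha> = mpow xv \<alpha>"
proof (induction "mdeg \<alpha>" arbitrary: \<alpha>)
  case 0
  then show ?case by (simp add: mdeg_eq_0_iff xpow_0)
next
  case (Suc k)
  then have "keys \<alpha> \<noteq> {}" by auto
  then obtain i where "i \<in> keys \<alpha>" by blast
  then obtain \<beta> where \<beta>: "\<alpha> = single1 i + \<beta>" by (rule expo_split)
  then have "xpow \<beta> = mpow xv \<beta>" using Suc by simp
  then show ?case by (simp add: \<beta> mpow_add xpow_add xv_def)
qed

section \<open>Order of vanishing\<close>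

text \<open>A lower bound for the order of vanishing rather than the order itself, so that the zero
  series needs no value.\<close>

definition ordge :: "nat \<Rightarrow> pseries \<Rightarrow> bool"
  where "ordge k f \<longleftrightarrow> (\<forall>\<alpha>. cf f \<alpha> \<noteq> 0 \<longrightarrow> k \<le> mdeg \<alpha>)"

lemma ordgeD: "ordge k f \<Longrightarrow> mdeg \<alpha> < k \<Longrightarrow> cf f \<alpha> = 0"
  by (auto simp: ordge_def)

lemma ordge_0 [simp]: "ordge 0 f" "ordge k 0"
  by (auto simp: ordge_def)

lemma ordge_mono: "ordge k f \<Longrightarrow> j \<le> k \<Longrightarrow> ordge j f"
  by (auto simp: ordge_def)

lemma ordge_add: "ordge k f \<Longrightarrow> ordge k g \<Longrightarrow> ordge k (f + g)"
  by (auto simp: ordge_def) (metis add.right_neutral)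

lemma ordge_uminus: "ordge k f \<Longrightarrow> ordge k (- f)"
  by (auto simp: ordge_def)

lemma ordge_diff: "ordge k f \<Longrightarrow> ordge k g \<Longrightarrow> ordge k (f - g)"
  using ordge_add[of k f "- g"] ordge_uminus by simp

lemma ordge_scl: "ordge k f \<Longrightarrow> ordge k (scl c f)"
  by (auto simp: ordge_def)

lemma ordge_sum: "(\<And>x. x \<in> A \<Longrightarrow> ordge k (f x)) \<Longrightarrow> ordge k (sum f A)"
  by (induction A rule: infinite_finite_induct) (auto intro: ordge_add)

lemma ordge_mult:
  assumes "ordge j f" "ordge k g"
  shows "ordge (j + k) (f * g)"
  unfolding ordge_def
proof (intro allI impI)
  fix \<gamma> assume "cf (f * g) \<gamma> \<noteq> 0"
  then obtain x where "x \<in> {(\<alpha>, \<beta>). \<alpha> + \<beta> = \<gamma>}" "(case x of (\<alpha>, \<beta>) \<Rightarrow> cf f \<alpha> * cf g \<beta>) \<noteq> 0"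
    unfolding cf_mult by (rule sum.not_neutral_contains_not_neutral)
  then show "j + k \<le> mdeg \<gamma>" using assms by (auto simp: ordge_def add_mono)
qed

lemma ordge_mult_right: "ordge k g \<Longrightarrow> ordge k (f * g)"
  using ordge_mult[of 0 f k g] by simp

lemma ordge_mult_left: "ordge k f \<Longrightarrow> ordge k (f * g)"
  using ordge_mult[of k f 0 g] by simp

lemma ordge_power: "ordge 1 f \<Longrightarrow> ordge k (f ^ k)"
  by (induction k) (auto dest: ordge_mult)

lemma ordge_prod: "(\<And>i. i \<in> A \<Longrightarrow> ordge (k i) (f i)) \<Longrightarrow> finite A \<Longrightarrow> ordge (sum k A) (prod f A)"
  by (induction A rule: infinite_finite_induct) (auto intro: ordge_mult)

lemma ordge_mpow: "(\<And>i. i \<in> keys \<alpha> \<Longrightarrow> ordge 1 (g i)) \<Longrightarrow> ordge (mdeg \<alpha>) (mpow g \<alpha>)"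
  unfolding mpow_def mdeg_def by (intro ordge_prod ordge_power) auto

lemma ordge_xv: "ordge 1 (xv i)"
  by (auto simp: ordge_def cf_xv)

lemma ordge_1_iff: "ordge 1 f \<longleftrightarrow> cf f 0 = 0"
  by (auto simp: ordge_def Suc_le_eq) (metis gr0I mdeg_eq_0_iff)

lemma ordge_Suc_iff: "ordge (Suc k) f \<longleftrightarrow> ordge k f \<and> (\<forall>\<alpha>. mdeg \<alpha> = k \<longrightarrow> cf f \<alpha> = 0)"
  by (auto simp: ordge_def Suc_le_eq) (metis le_eq_less_or_eq)+

lemma ordge_2_iff: "ordge 2 f \<longleftrightarrow> cf f 0 = 0 \<and> (\<forall>i. cf f (single1 i) = 0)"
  using ordge_Suc_iff[of 1 f] ordge_1_iff[of f] mdeg_eq_1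
  by (auto simp: numeral_2_eq_2)

lemma cf_mult_0: "cf (f * g) 0 = cf f 0 * cf g 0"
proof -
  have "{(\<alpha>, \<beta>). \<alpha> + \<beta> = (0::expo)} = {(0, 0)}"
    by (auto simp: mdeg_eq_0_iff[symmetric] simp del: mdeg_eq_0_iff dest: arg_cong[of _ _ mdeg])
  then show ?thesis by (simp add: cf_mult)
qed

text \<open>The topology given by orders is separated. Identities between infinite substitutions are
  reduced by this to identities between polynomials.\<close>

lemma eq_if_ordge_diff: "(\<And>d. ordge d (f - g)) \<Longrightarrow> f = g"
proof (rule pseries_eqI)
  fix \<alpha> assume "\<And>d. ordge d (f - g)"
  then have "cf (f - g) \<alpha> = 0" using ordgeD[of "Suc (mdeg \<alpha>)"] by blast
  then show "cf f \<alpha> = cf g \<alpha>" by simp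
qed

lemma ordge_mult_diff:
  assumes "ordge d (f - f')" "ordge d (g - g')"
  shows "ordge d (f * g - f' * g')"
proof -
  have "f * g - f' * g' = (f - f') * g + f' * (g - g')" by (simp add: algebra_simps)
  then show ?thesis using assms by (simp add: ordge_add ordge_mult_left ordge_mult_right)
qed

declare One_nat_def [simp del]

section \<open>Weighted norms\<close>

text \<open>\<open>nb \<rho> f M\<close> says that \<open>\<Sum>\<^sub>\<alpha> \<bar>f\<^sub>\<alpha>\<bar> \<rho>\<^sup>\<alpha> \<le> M\<close>; finite partial sums avoid any summability side conditions.\<close>

definition nb :: "(nat \<Rightarrow> real) \<Rightarrow> pseries \<Rightarrow> real \<Rightarrow> bool"
  where "nb \<rho> f M \<longleftrightarrow> (\<forall>A. finite A \<longrightarrow> (\<Sum>\<alpha>\<in>A. cmod (cf f \<alpha>) * mpow \<rho> \<alpha>) \<le> M)"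

lemma nbD: "nb \<rho> f M \<Longrightarrow> finite A \<Longrightarrow> (\<Sum>\<alpha>\<in>A. cmod (cf f \<alpha>) * mpow \<rho> \<alpha>) \<le> M"
  by (simp add: nb_def)

lemma nb_nonneg: "nb \<rho> f M \<Longrightarrow> 0 \<le> M"
  using nbD[of \<rho> f M "{}"] by simp

lemma nb_weaken: "nb \<rho> f M \<Longrightarrow> M \<le> M' \<Longrightarrow> nb \<rho> f M'"
  by (auto simp: nb_def intro: order_trans)

lemma mpow_nonneg: "(\<And>i. 0 \<le> (\<rho> i :: real)) \<Longrightarrow> 0 \<le> mpow \<rho> \<alpha>"
  unfolding mpow_def by (intro prod_nonneg) auto

lemma nb_radius_mono:
  assumes "nb \<rho> f M" "\<And>i. 0 \<le> \<rho>' i" "\<And>i. \<rho>' i \<le> \<rho> i"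
  shows "nb \<rho>' f M"
  unfolding nb_def
proof (intro allI impI)
  fix A :: "expo set" assume A: "finite A"
  have "mpow \<rho>' \<alpha> \<le> mpow \<rho> \<alpha>" for \<alpha>
    unfolding mpow_def by (intro prod_mono conjI power_mono zero_le_power assms)
  then have "(\<Sum>\<alpha>\<in>A. cmod (cf f \<alpha>) * mpow \<rho>' \<alpha>) \<le> (\<Sum>\<alpha>\<in>A. cmod (cf f \<alpha>) * mpow \<rho> \<alpha>)"
    by (intro sum_mono mult_left_mono) auto
  also have "\<dots> \<le> M" by (rule nbD) fact+
  finally show "(\<Sum>\<alpha>\<in>A. cmod (cf f \<alpha>) * mpow \<rho>' \<alpha>) \<le> M" .
qed

lemma nb_0: "0 \<le> M \<Longrightarrow> nb \<rho> 0 M"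
  by (simp add: nb_def)

lemma nb_add:
  assumes "nb \<rho> f M" "nb \<rho> g N" "\<And>i. 0 \<le> \<rho> i"
  shows "nb \<rho> (f + g) (M + N)"
  unfolding nb_def
proof (intro allI impI)
  fix A :: "expo set" assume A: "finite A"
  have "(\<Sum>\<alpha>\<in>A. cmod (cf (f + g) \<alpha>) * mpow \<rho> \<alpha>)
      \<le> (\<Sum>\<alpha>\<in>A. cmod (cf f \<alpha>) * mpow \<rho> \<alpha> + cmod (cf g \<alpha>) * mpow \<rho> \<alpha>)"
    by (intro sum_mono) (metis cf_add distrib_right mpow_nonneg assms(3) mult_right_mono norm_triangle_ineq)
  also have "\<dots> \<le> M + N"
    by (simp add: sum.distrib add_mono nbD assms A)
  finally show "(\<Sum>\<alpha>\<in>A. cmod (cf (f + g) \<alpha>) * mpow \<rho> \<alpha>) \<le> M + N" .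
qed

lemma nb_scl:
  assumes "nb \<rho> f M"
  shows "nb \<rho> (scl c f) (cmod c * M)"
  unfolding nb_def
proof (intro allI impI)
  fix A :: "expo set" assume A: "finite A"
  have "(\<Sum>\<alpha>\<in>A. cmod (cf (scl c f) \<alpha>) * mpow \<rho> \<alpha>) = cmod c * (\<Sum>\<alpha>\<in>A. cmod (cf f \<alpha>) * mpow \<rho> \<alpha>)"
    by (simp add: norm_mult sum_distrib_left mult.assoc)
  also have "\<dots> \<le> cmod c * M"
    by (intro mult_left_mono nbD assms A) simp
  finally show "(\<Sum>\<alpha>\<in>A. cmod (cf (scl c f) \<alpha>) * mpow \<rho> \<alpha>) \<le> cmod c * M" .
qed

lemma nb_uminus: "nb \<rho> f M \<Longrightarrow> nb \<rho> (- f) M"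
  by (simp add: nb_def)

lemma nb_diff: "nb \<rho> f M \<Longrightarrow> nb \<rho> g N \<Longrightarrow> (\<And>i. 0 \<le> \<rho> i) \<Longrightarrow> nb \<rho> (f - g) (M + N)"
  using nb_add[of \<rho> f M "- g" N] nb_uminus[of \<rho> g N] by simp

lemma nb_sum:
  assumes "\<And>x. x \<in> A \<Longrightarrow> nb \<rho> (f x) (M x)" "\<And>i. 0 \<le> \<rho> i"
  shows "nb \<rho> (sum f A) (sum M A)"
  using assms(1) by (induction A rule: infinite_finite_induct) (auto intro!: nb_add nb_0 assms(2))

lemma nb_mult:
  assumes f: "nb \<rho> f M" and g: "nb \<rho> g N" and \<rho>: "\<And>i. 0 \<le> \<rho> i"
  shows "nb \<rho> (f * g) (M * N)"
  unfolding nb_def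
proof (intro allI impI)
  fix A :: "expo set" assume A: "finite A"
  let ?S = "\<lambda>\<gamma>::expo. {(\<alpha>, \<beta>). \<alpha> + \<beta> = \<gamma>}"
  let ?a = "\<lambda>\<alpha>. cmod (cf f \<alpha>) * mpow \<rho> \<alpha>" and ?b = "\<lambda>\<alpha>. cmod (cf g \<alpha>) * mpow \<rho> \<alpha>"
  have nn: "0 \<le> mpow \<rho> \<alpha>" for \<alpha> by (rule mpow_nonneg) (rule \<rho>)
  have "cmod (cf (f * g) \<gamma>) * mpow \<rho> \<gamma> \<le> (\<Sum>x\<in>?S \<gamma>. ?a (fst x) * ?b (snd x))" for \<gamma>
  proof -
    have "cmod (cf (f * g) \<gamma>) \<le> (\<Sum>x\<in>?S \<gamma>. cmod (cf f (fst x) * cf g (snd x)))"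
      unfolding cf_mult by (rule order_trans[OF norm_sum]) (simp add: case_prod_unfold)
    then have "cmod (cf (f * g) \<gamma>) * mpow \<rho> \<gamma> \<le> (\<Sum>x\<in>?S \<gamma>. cmod (cf f (fst x) * cf g (snd x))) * mpow \<rho> \<gamma>"
      by (rule mult_right_mono) (rule nn)
    also have "\<dots> = (\<Sum>x\<in>?S \<gamma>. ?a (fst x) * ?b (snd x))"
      by (subst sum_distrib_right, rule sum.cong) (auto simp: norm_mult mpow_add)
    finally show ?thesis .
  qed
  then have "(\<Sum>\<gamma>\<in>A. cmod (cf (f * g) \<gamma>) * mpow \<rho> \<gamma>) \<le> (\<Sum>\<gamma>\<in>A. \<Sum>x\<in>?S \<gamma>. ?a (fst x) * ?b (snd x))"
    by (intro sum_mono)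
  also have "\<dots> = (\<Sum>x\<in>(\<Union>\<gamma>\<in>A. ?S \<gamma>). ?a (fst x) * ?b (snd x))"
    by (rule sum.UNION_disjoint[symmetric]) (auto simp: A)
  \<comment> \<open>Enlarging the set of pairs to a rectangle turns the double sum into a product;
    all terms are nonnegative.\<close>
  also have "\<dots> \<le> (\<Sum>x\<in>(fst ` (\<Union>\<gamma>\<in>A. ?S \<gamma>)) \<times> (snd ` (\<Union>\<gamma>\<in>A. ?S \<gamma>)). ?a (fst x) * ?b (snd x))"
  proof (rule sum_mono2)
    show "finite ((fst ` (\<Union>\<gamma>\<in>A. ?S \<gamma>)) \<times> (snd ` (\<Union>\<gamma>\<in>A. ?S \<gamma>)))"
      by (intro finite_cartesian_product finite_imageI finite_UN_I A finite_splits)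
    show "(\<Union>\<gamma>\<in>A. ?S \<gamma>) \<subseteq> (fst ` (\<Union>\<gamma>\<in>A. ?S \<gamma>)) \<times> (snd ` (\<Union>\<gamma>\<in>A. ?S \<gamma>))"
      by force
  qed (intro mult_nonneg_nonneg nn norm_ge_zero)
  also have "\<dots> = sum ?a (fst ` (\<Union>\<gamma>\<in>A. ?S \<gamma>)) * sum ?b (snd ` (\<Union>\<gamma>\<in>A. ?S \<gamma>))"
    by (subst sum_product) (simp add: sum.cartesian_product case_prod_unfold)
  also have "\<dots> \<le> M * N"
    by (intro mult_mono nbD[OF f] nbD[OF g] finite_imageI finite_UN_I A finite_splits sum_nonneg
        mult_nonneg_nonneg nn norm_ge_zero nb_nonneg[OF f])
  finally show "(\<Sum>\<gamma>\<in>A. cmod (cf (f * g) \<gamma>) * mpow \<rho> \<gamma>) \<le> M * N" .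
qed

lemma nb_xpow:
  assumes "\<And>i. 0 \<le> \<rho> i"
  shows "nb \<rho> (xpow \<alpha>) (mpow \<rho> \<alpha>)"
  unfolding nb_def
proof (intro allI impI)
  fix A :: "expo set" assume A: "finite A"
  have "(\<Sum>\<beta>\<in>A. cmod (cf (xpow \<alpha>) \<beta>) * mpow \<rho> \<beta>) = (\<Sum>\<beta>\<in>A. if \<beta> = \<alpha> then mpow \<rho> \<alpha> else 0)"
    by (rule sum.cong) (auto simp: cf_xpow)
  also have "\<dots> \<le> mpow \<rho> \<alpha>"
    using A mpow_nonneg[of \<rho> \<alpha>] assms by simp
  finally show "(\<Sum>\<beta>\<in>A. cmod (cf (xpow \<alpha>) \<beta>) * mpow \<rho> \<beta>) \<le> mpow \<rho> \<alpha>" .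
qed

lemma nb_1: "(\<And>i. 0 \<le> \<rho> i) \<Longrightarrow> nb \<rho> 1 1"
  using nb_xpow[of \<rho> 0] by (simp add: xpow_0)

lemma nb_power: "nb \<rho> f M \<Longrightarrow> (\<And>i. 0 \<le> \<rho> i) \<Longrightarrow> nb \<rho> (f ^ k) (M ^ k)"
  by (induction k) (auto intro: nb_1 nb_mult)

lemma nb_prod:
  assumes "\<And>x. x \<in> A \<Longrightarrow> nb \<rho> (f x) (M x)" "\<And>i. 0 \<le> \<rho> i"
  shows "nb \<rho> (prod f A) (prod M A)"
  using assms(1) by (induction A rule: infinite_finite_induct) (auto intro!: nb_mult nb_1 assms(2))

lemma nb_mpow:
  "(\<And>i. i \<in> keys \<alpha> \<Longrightarrow> nb \<rho> (g i) (R i)) \<Longrightarrow> (\<And>i. 0 \<le> \<rho> i) \<Longrightarrow> nb \<rho> (mpow g \<alpha>) (mpow R \<alpha>)"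
  unfolding mpow_def by (intro nb_prod nb_power)

text \<open>Every monomial that occurs has degree at least \<open>k\<close>, so scaling the radius
  by \<epsilon> gains the factor \<open>\<epsilon> ^ k\<close>. This makes series of positive order
  small near 0.\<close>

lemma nb_shrink:
  assumes f: "nb (\<lambda>_. r) f M" and k: "ordge k f" and "0 \<le> r" "0 \<le> \<epsilon>" "\<epsilon> \<le> 1"
  shows "nb (\<lambda>_. \<epsilon> * r) f (\<epsilon> ^ k * M)"
  unfolding nb_def
proof (intro allI impI)
  fix A :: "expo set" assume A: "finite A"
  have "cmod (cf f \<alpha>) * mpow (\<lambda>_. \<epsilon> * r) \<alpha> \<le> \<epsilon> ^ k * (cmod (cf f \<alpha>) * mpow (\<lambda>_. r) \<alpha>)" for \<alpha>
  proof (cases "cf f \<alpha> = 0")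
    case False
    then have "k \<le> mdeg \<alpha>" using k by (auto simp: ordge_def)
    then have "\<epsilon> ^ mdeg \<alpha> \<le> \<epsilon> ^ k" using assms by (intro power_decreasing)
    then have "\<epsilon> ^ mdeg \<alpha> * (cmod (cf f \<alpha>) * r ^ mdeg \<alpha>) \<le> \<epsilon> ^ k * (cmod (cf f \<alpha>) * r ^ mdeg \<alpha>)"
      using assms by (intro mult_right_mono) auto
    then show ?thesis by (simp add: mpow_const power_mult_distrib mult_ac)
  qed simp
  then have "(\<Sum>\<alpha>\<in>A. cmod (cf f \<alpha>) * mpow (\<lambda>_. \<epsilon> * r) \<alpha>)
      \<le> (\<Sum>\<alpha>\<in>A. \<epsilon> ^ k * (cmod (cf f \<alpha>) * mpow (\<lambda>_. r) \<alpha>))"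
    by (intro sum_mono)
  also have "\<dots> \<le> \<epsilon> ^ k * M"
    unfolding sum_distrib_left[symmetric] using assms by (intro mult_left_mono nbD[OF f] A) auto
  finally show "(\<Sum>\<alpha>\<in>A. cmod (cf f \<alpha>) * mpow (\<lambda>_. \<epsilon> * r) \<alpha>) \<le> \<epsilon> ^ k * M" .
qed

section \<open>Substitution of power series\<close>

text \<open>Junk unless all \<open>g i\<close> with \<open>i < n\<close> vanish at \<open>0\<close>. Variables of index \<open>\<ge> n\<close> are replaced by \<open>0\<close>.\<close>

definition subst :: "nat \<Rightarrow> (nat \<Rightarrow> pseries) \<Rightarrow> pseries \<Rightarrow> pseries"
  where "subst n g f = Ser (\<lambda>\<gamma>. \<Sum>\<alpha>\<in>lowdeg n (mdeg \<gamma>). cf f \<alpha> * cf (mpow g \<alpha>) \<gamma>)"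

definition peval :: "nat \<Rightarrow> nat \<Rightarrow> (nat \<Rightarrow> pseries) \<Rightarrow> pseries \<Rightarrow> pseries"
  where "peval n d g f = (\<Sum>\<alpha>\<in>lowdeg n d. scl (cf f \<alpha>) (mpow g \<alpha>))"

lemma cf_subst: "cf (subst n g f) \<gamma> = (\<Sum>\<alpha>\<in>lowdeg n (mdeg \<gamma>). cf f \<alpha> * cf (mpow g \<alpha>) \<gamma>)"
  by (simp add: subst_def)

lemma cf_peval: "cf (peval n d g f) \<gamma> = (\<Sum>\<alpha>\<in>lowdeg n d. cf f \<alpha> * cf (mpow g \<alpha>) \<gamma>)"
  by (simp add: peval_def)

lemma lowdegD: "\<alpha> \<in> lowdeg n d \<Longrightarrow> i \<in> keys \<alpha> \<Longrightarrow> i < n"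
  by (auto simp: lowdeg_def)

text \<open>\<open>mpow g \<alpha>\<close> has order at least \<open>mdeg \<alpha>\<close>, so
  monomials of degree above that of \<gamma> contribute nothing and the finite sum in
  \<open>subst\<close> may be extended to any larger degree.\<close>

lemma cf_subst_peval:
  assumes g: "\<And>i. i < n \<Longrightarrow> ordge 1 (g i)" and "mdeg \<gamma> \<le> d"
  shows "cf (subst n g f) \<gamma> = cf (peval n d g f) \<gamma>"
  unfolding cf_subst cf_peval
proof (rule sum.mono_neutral_left)
  show "\<forall>\<alpha>\<in>lowdeg n d - lowdeg n (mdeg \<gamma>). cf f \<alpha> * cf (mpow g \<alpha>) \<gamma> = 0"
  proof
    fix \<alpha> assume *: "\<alpha> \<in> lowdeg n d - lowdeg n (mdeg \<gamma>)"
    then have "ordge (mdeg \<alpha>) (mpow g \<alpha>)"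
      by (intro ordge_mpow g) (auto dest: lowdegD)
    moreover have "mdeg \<gamma> < mdeg \<alpha>" using * by (auto simp: lowdeg_def)
    ultimately show "cf f \<alpha> * cf (mpow g \<alpha>) \<gamma> = 0" by (simp add: ordgeD)
  qed
  show "lowdeg n (mdeg \<gamma>) \<subseteq> lowdeg n d" using assms(2) by (auto simp: lowdeg_def)
qed simp

lemma subst_approx:
  assumes "\<And>i. i < n \<Longrightarrow> ordge 1 (g i)"
  shows "ordge (Suc d) (subst n g f - peval n d g f)"
  unfolding ordge_def
proof (intro allI impI)
  fix \<alpha> assume *: "cf (subst n g f - peval n d g f) \<alpha> \<noteq> 0"
  show "Suc d \<le> mdeg \<alpha>"
  proof (rule ccontr)
    assume "\<not> Suc d \<le> mdeg \<alpha>"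
    then have "cf (subst n g f) \<alpha> = cf (peval n d g f) \<alpha>"
      by (intro cf_subst_peval assms) auto
    then show False using * by simp
  qed
qed

lemma subst_cong: "(\<And>i. i < n \<Longrightarrow> g i = h i) \<Longrightarrow> subst n g f = subst n h f"
proof (rule pseries_eqI)
  fix \<gamma> assume gh: "\<And>i. i < n \<Longrightarrow> g i = h i"
  have "mpow g \<alpha> = mpow h \<alpha>" if "\<alpha> \<in> lowdeg n (mdeg \<gamma>)" for \<alpha>
    by (rule mpow_cong) (rule gh, rule lowdegD[OF that])
  then show "cf (subst n g f) \<gamma> = cf (subst n h f) \<gamma>"
    unfolding cf_subst by (intro sum.cong) auto
qed

lemma subst_add: "subst n g (f + h) = subst n g f + subst n g h"
  by (rule pseries_eqI) (simp add: cf_subst sum.distrib ring_distribs)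

lemma subst_scl: "subst n g (scl c f) = scl c (subst n g f)"
  by (rule pseries_eqI) (simp add: cf_subst sum_distrib_left mult.assoc)

lemma subst_diff: "subst n g (f - h) = subst n g f - subst n g h"
  by (rule pseries_eqI) (simp add: cf_subst sum_subtractf ring_distribs)

lemma subst_0 [simp]: "subst n g 0 = 0"
  by (rule pseries_eqI) (simp add: cf_subst)

lemma subst_sum: "subst n g (sum f A) = (\<Sum>x\<in>A. subst n g (f x))"
  by (induction A rule: infinite_finite_induct) (auto simp: subst_add)

lemma subst_1 [simp]: "subst n g 1 = 1"
proof (rule pseries_eqI)
  fix \<gamma>
  have "cf (subst n g 1) \<gamma> = (\<Sum>\<alpha>\<in>lowdeg n (mdeg \<gamma>). if \<alpha> = 0 then cf 1 \<gamma> else 0)"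
    unfolding cf_subst by (rule sum.cong) (auto simp: cf_1)
  also have "\<dots> = (if 0 \<in> lowdeg n (mdeg \<gamma>) then cf 1 \<gamma> else 0)" by simp
  also have "\<dots> = cf 1 \<gamma>" by (simp add: lowdeg_def)
  finally show "cf (subst n g 1) \<gamma> = cf 1 \<gamma>" .
qed

text \<open>Up to order \<open>d\<close>, substitution agrees with the polynomial
  \<open>peval\<close>, and the product of two truncations differs from the truncation of the
  product only by monomials of degree above \<open>d\<close>.\<close>

lemma subst_mult:
  assumes g: "\<And>i. i < n \<Longrightarrow> ordge 1 (g i)"
  shows "subst n g (f * h) = subst n g f * subst n g h"
proof (rule eq_if_ordge_diff)
  fix d
  let ?L = "lowdeg n d"
  let ?t = "\<lambda>x. scl (cf f (fst x) * cf h (snd x)) (mpow g (fst x + snd x))"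
  have "peval n d g f * peval n d g h = sum ?t (?L \<times> ?L)"
    unfolding peval_def sum_product sum.cartesian_product
    by (rule sum.cong) (auto simp: scl_mult_left scl_mult_right mpow_add mult.commute)
  also have "\<dots> = sum ?t {x \<in> ?L \<times> ?L. mdeg (fst x + snd x) \<le> d} + sum ?t {x \<in> ?L \<times> ?L. \<not> mdeg (fst x + snd x) \<le> d}"
    by (subst sum.union_disjoint[symmetric]) (auto intro: sum.cong)
  also have "sum ?t {x \<in> ?L \<times> ?L. mdeg (fst x + snd x) \<le> d} = peval n d g (f * h)"
  proof -
    have "peval n d g (f * h) = (\<Sum>\<gamma>\<in>?L. \<Sum>x | fst x + snd x = \<gamma>. scl (cf f (fst x) * cf h (snd x)) (mpow g \<gamma>))"
      unfolding peval_def cf_mult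
      by (simp add: case_prod_unfold pseries_vs.scale_sum_left)
    also have "\<dots> = (\<Sum>\<gamma>\<in>?L. \<Sum>x | fst x + snd x = \<gamma>. ?t x)"
      by (intro sum.cong) auto
    also have "\<dots> = sum ?t (\<Union>\<gamma>\<in>?L. {x. fst x + snd x = \<gamma>})"
      using finite_splits by (intro sum.UNION_disjoint[symmetric]) (auto simp: case_prod_unfold)
    also have "(\<Union>\<gamma>\<in>?L. {x. fst x + snd x = \<gamma>}) = {x \<in> ?L \<times> ?L. mdeg (fst x + snd x) \<le> d}"
      by (auto simp: lowdeg_def keys_add_nat)
    finally show ?thesis by simp
  qed
  finally have eq: "peval n d g f * peval n d g h - peval n d g (f * h) = sum ?t {x \<in> ?L \<times> ?L. \<not> mdeg (fst x + snd x) \<le> d}"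
    by simp
  have 1: "ordge (Suc d) (peval n d g f * peval n d g h - peval n d g (f * h))"
    unfolding eq
  proof (rule ordge_sum)
    fix x assume x: "x \<in> {x \<in> ?L \<times> ?L. \<not> mdeg (fst x + snd x) \<le> d}"
    then have "ordge (mdeg (fst x + snd x)) (mpow g (fst x + snd x))"
      by (intro ordge_mpow g) (auto simp: keys_add_nat dest: lowdegD)
    then show "ordge (Suc d) (?t x)"
      using x by (intro ordge_scl) (auto intro: ordge_mono)
  qed
  have 2: "ordge (Suc d) (subst n g f * subst n g h - peval n d g f * peval n d g h)"
    by (intro ordge_mult_diff subst_approx g)
  have 3: "ordge (Suc d) (subst n g (f * h) - peval n d g (f * h))"
    by (intro subst_approx g)
  have "subst n g (f * h) - subst n g f * subst n g h =
     (subst n g (f * h) - peval n d g (f * h)) - (peval n d g f * peval n d g h - peval n d g (f * h))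
       - (subst n g f * subst n g h - peval n d g f * peval n d g h)"
    by simp
  also have "ordge (Suc d) \<dots>" by (intro ordge_diff 1 2 3)
  finally show "ordge d (subst n g (f * h) - subst n g f * subst n g h)"
    by (rule ordge_mono) simp
qed

lemma subst_power: "(\<And>i. i < n \<Longrightarrow> ordge 1 (g i)) \<Longrightarrow> subst n g (f ^ k) = subst n g f ^ k"
  by (induction k) (auto simp: subst_mult)

lemma subst_prod:
  "(\<And>i. i < n \<Longrightarrow> ordge 1 (g i)) \<Longrightarrow> subst n g (prod f A) = (\<Prod>x\<in>A. subst n g (f x))"
  by (induction A rule: infinite_finite_induct) (auto simp: subst_mult)

lemma subst_mpow:
  "(\<And>i. i < n \<Longrightarrow> ordge 1 (g i)) \<Longrightarrow> subst n g (mpow h \<alpha>) = mpow (\<lambda>i. subst n g (h i)) \<alpha>"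
  by (simp add: mpow_def subst_prod subst_power)

lemma subst_xv:
  assumes "i < n" "ordge 1 (g i)"
  shows "subst n g (xv i) = g i"
proof (rule pseries_eqI)
  fix \<gamma>
  have "cf (subst n g (xv i)) \<gamma> = (\<Sum>\<alpha>\<in>lowdeg n (mdeg \<gamma>). if \<alpha> = single1 i then cf (g i) \<gamma> else 0)"
    unfolding cf_subst by (rule sum.cong) (auto simp: cf_xv)
  also have "\<dots> = (if single1 i \<in> lowdeg n (mdeg \<gamma>) then cf (g i) \<gamma> else 0)"
    by simp
  also have "\<dots> = cf (g i) \<gamma>"
    using assms by (auto simp: lowdeg_def not_le ordge_def)
  finally show "cf (subst n g (xv i)) \<gamma> = cf (g i) \<gamma>" .
qed

lemma subst_id:
  assumes "in_vars n (cf f)"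
  shows "subst n xv f = f"
proof (rule pseries_eqI)
  fix \<gamma>
  have "cf (subst n xv f) \<gamma> = (\<Sum>\<alpha>\<in>lowdeg n (mdeg \<gamma>). if \<alpha> = \<gamma> then cf f \<gamma> else 0)"
    unfolding cf_subst by (rule sum.cong) (auto simp: xpow_eq_mpow[symmetric] cf_xpow)
  also have "\<dots> = (if \<gamma> \<in> lowdeg n (mdeg \<gamma>) then cf f \<gamma> else 0)" by simp
  also have "\<dots> = cf f \<gamma>"
    using assms by (auto simp: lowdeg_def in_vars_def)
  finally show "cf (subst n xv f) \<gamma> = cf f \<gamma>" .
qed

lemma subst_ordge:
  assumes g: "\<And>i. i < n \<Longrightarrow> ordge 1 (g i)" and f: "ordge k f"
  shows "ordge k (subst n g f)"
  unfolding ordge_def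
proof (intro allI impI)
  fix \<gamma> assume "cf (subst n g f) \<gamma> \<noteq> 0"
  then obtain \<alpha> where \<alpha>: "\<alpha> \<in> lowdeg n (mdeg \<gamma>)" "cf f \<alpha> * cf (mpow g \<alpha>) \<gamma> \<noteq> 0"
    unfolding cf_subst by (rule sum.not_neutral_contains_not_neutral)
  have "k \<le> mdeg \<alpha>" using \<alpha>(2) f by (auto simp: ordge_def)
  also have "mdeg \<alpha> \<le> mdeg \<gamma>" using \<alpha>(1) by (simp add: lowdeg_def)
  finally show "k \<le> mdeg \<gamma>" .
qed

text \<open>For truncations this is multiplicativity; the tails have high order on both
  sides.\<close>

lemma subst_comp:
  assumes g: "\<And>i. i < n \<Longrightarrow> ordge 1 (g i)" and h: "\<And>i. i < k \<Longrightarrow> ordge 1 (h i)"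
  shows "subst k h (subst n g f) = subst n (\<lambda>i. subst k h (g i)) f"
proof (rule eq_if_ordge_diff)
  fix d
  let ?e = "\<lambda>i. subst k h (g i)"
  have e: "i < n \<Longrightarrow> ordge 1 (?e i)" for i by (intro subst_ordge g h)
  have *: "subst k h (peval n d g f) = peval n d ?e f"
    unfolding peval_def subst_sum subst_scl by (subst subst_mpow) (auto intro: h)
  have "subst k h (subst n g f) - subst n ?e f = subst k h (subst n g f - peval n d g f) - (subst n ?e f - peval n d ?e f)"
    by (simp add: subst_diff *)
  also have "ordge (Suc d) \<dots>"
    by (intro ordge_diff subst_ordge subst_approx g h e)
  finally show "ordge d (subst k h (subst n g f) - subst n ?e f)"
    by (rule ordge_mono) simp
qed

text \<open>Telescoping: one factor is exchanged at a time, and each of the remaining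
  \<open>mdeg \<alpha> - 1\<close> factors adds an order.\<close>

lemma mpow_diff_ordge:
  assumes "\<And>i. i \<in> keys \<alpha> \<Longrightarrow> ordge 1 (g i)" "\<And>i. i \<in> keys \<alpha> \<Longrightarrow> ordge 1 (h i)"
    "\<And>i. i \<in> keys \<alpha> \<Longrightarrow> ordge (Suc d) (g i - h i)"
  shows "ordge (d + mdeg \<alpha>) (mpow g \<alpha> - mpow h \<alpha>)"
  using assms
proof (induction "mdeg \<alpha>" arbitrary: \<alpha>)
  case 0
  then show ?case by (simp add: mdeg_eq_0_iff)
next
  case (Suc k)
  then have "keys \<alpha> \<noteq> {}" by auto
  then obtain i where i: "i \<in> keys \<alpha>" by blast
  then obtain \<beta> where \<beta>: "\<alpha> = single1 i + \<beta>" by (rule expo_split)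
  have sub: "keys \<beta> \<subseteq> keys \<alpha>" by (auto simp: \<beta> keys_add_nat)
  have IH: "ordge (d + mdeg \<beta>) (mpow g \<beta> - mpow h \<beta>)"
  proof (rule Suc.hyps(1))
    show "k = mdeg \<beta>" using Suc.hyps(2) by (simp add: \<beta>)
  qed (use sub in \<open>auto intro: Suc.prems\<close>)
  have "mpow g \<alpha> - mpow h \<alpha> = (g i - h i) * mpow g \<beta> + h i * (mpow g \<beta> - mpow h \<beta>)"
    by (simp add: \<beta> mpow_add algebra_simps)
  also have "ordge (d + mdeg \<alpha>) \<dots>"
  proof (rule ordge_add)
    have "ordge (Suc d + mdeg \<beta>) ((g i - h i) * mpow g \<beta>)"
      using sub by (intro ordge_mult ordge_mpow Suc.prems i) auto
    then show "ordge (d + mdeg \<alpha>) ((g i - h i) * mpow g \<beta>)" by (rule ordge_mono) (simp add: \<beta>)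
    have "ordge (1 + (d + mdeg \<beta>)) (h i * (mpow g \<beta> - mpow h \<beta>))"
      by (intro ordge_mult IH Suc.prems i)
    then show "ordge (d + mdeg \<alpha>) (h i * (mpow g \<beta> - mpow h \<beta>))" by (rule ordge_mono) (simp add: \<beta>)
  qed
  finally show ?case .
qed

text \<open>With \<open>k = 2\<close> this is the contraction behind the inverse function theorem.
  With \<open>d = 1\<close> it says that the lowest terms of a substitution depend only on the
  linear parts of the substituted series.\<close>

lemma subst_diff_ordge:
  assumes "\<And>i. i < n \<Longrightarrow> ordge 1 (g i)" "\<And>i. i < n \<Longrightarrow> ordge 1 (h i)"
    "\<And>i. i < n \<Longrightarrow> ordge (Suc d) (g i - h i)" "ordge k f"
  shows "ordge (d + k) (subst n g f - subst n h f)"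
  unfolding ordge_def
proof (intro allI impI)
  fix \<gamma> assume *: "cf (subst n g f - subst n h f) \<gamma> \<noteq> 0"
  have "cf (subst n g f - subst n h f) \<gamma> = (\<Sum>\<alpha>\<in>lowdeg n (mdeg \<gamma>). cf f \<alpha> * cf (mpow g \<alpha> - mpow h \<alpha>) \<gamma>)"
    by (simp add: cf_subst sum_subtractf ring_distribs)
  with * obtain \<alpha> where \<alpha>: "\<alpha> \<in> lowdeg n (mdeg \<gamma>)" "cf f \<alpha> * cf (mpow g \<alpha> - mpow h \<alpha>) \<gamma> \<noteq> 0"
    by (metis (no_types, lifting) sum.not_neutral_contains_not_neutral)
  have "ordge (d + mdeg \<alpha>) (mpow g \<alpha> - mpow h \<alpha>)"
    using \<alpha>(1) by (intro mpow_diff_ordge assms) (auto dest: lowdegD)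
  then have "d + mdeg \<alpha> \<le> mdeg \<gamma>" using \<alpha>(2) unfolding ordge_def by auto
  moreover have "k \<le> mdeg \<alpha>" using \<alpha>(2) assms(4) by (auto simp: ordge_def)
  ultimately show "d + k \<le> mdeg \<gamma>" by simp
qed

lemma subst_unipotent:
  assumes "\<And>i. i < n \<Longrightarrow> ordge 2 (g i - xv i)" "ordge k f" "in_vars n (cf f)"
  shows "ordge (Suc k) (subst n g f - f)"
proof -
  have 1: "ordge 1 (g i)" if "i < n" for i
    using ordge_add[OF ordge_mono[OF assms(1)[OF that], of 1] ordge_xv[of i]] by simp
  have "ordge (1 + k) (subst n g f - subst n xv f)"
    by (rule subst_diff_ordge) (auto simp: Suc_1 intro: 1 ordge_xv assms)
  then show ?thesis by (simp only: subst_id[OF assms(3)] plus_1_eq_Suc)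
qed

lemma nb_subst:
  assumes f: "nb R f M" and g: "\<And>i. i < n \<Longrightarrow> nb \<rho> (g i) (R i)"
    and ord: "\<And>i. i < n \<Longrightarrow> ordge 1 (g i)" and \<rho>: "\<And>i. 0 \<le> \<rho> i"
  shows "nb \<rho> (subst n g f) M"
  unfolding nb_def
proof (intro allI impI)
  fix A :: "expo set" assume A: "finite A"
  have nn: "0 \<le> mpow \<rho> \<alpha>" for \<alpha> by (rule mpow_nonneg) (rule \<rho>)
  \<comment> \<open>Only finitely many \<gamma> are tested, so one truncation degree serves them
    all.\<close>
  define d where "d = Max (insert 0 (mdeg ` A))"
  have d: "\<gamma> \<in> A \<Longrightarrow> mdeg \<gamma> \<le> d" for \<gamma> using A by (simp add: d_def)
  have "(\<Sum>\<gamma>\<in>A. cmod (cf (subst n g f) \<gamma>) * mpow \<rho> \<gamma>)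
      \<le> (\<Sum>\<gamma>\<in>A. \<Sum>\<alpha>\<in>lowdeg n d. cmod (cf f \<alpha>) * (cmod (cf (mpow g \<alpha>) \<gamma>) * mpow \<rho> \<gamma>))"
  proof (rule sum_mono)
    fix \<gamma> assume "\<gamma> \<in> A"
    then have "cf (subst n g f) \<gamma> = (\<Sum>\<alpha>\<in>lowdeg n d. cf f \<alpha> * cf (mpow g \<alpha>) \<gamma>)"
      using cf_subst_peval[OF ord d] by (simp add: cf_peval)
    then have "cmod (cf (subst n g f) \<gamma>) \<le> (\<Sum>\<alpha>\<in>lowdeg n d. cmod (cf f \<alpha>) * cmod (cf (mpow g \<alpha>) \<gamma>))"
      by (simp only: norm_mult[symmetric]) (rule norm_sum)
    then show "cmod (cf (subst n g f) \<gamma>) * mpow \<rho> \<gamma>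
        \<le> (\<Sum>\<alpha>\<in>lowdeg n d. cmod (cf f \<alpha>) * (cmod (cf (mpow g \<alpha>) \<gamma>) * mpow \<rho> \<gamma>))"
      unfolding mult.assoc[symmetric] sum_distrib_right[symmetric] by (rule mult_right_mono) (rule nn)
  qed
  also have "\<dots> = (\<Sum>\<alpha>\<in>lowdeg n d. cmod (cf f \<alpha>) * (\<Sum>\<gamma>\<in>A. cmod (cf (mpow g \<alpha>) \<gamma>) * mpow \<rho> \<gamma>))"
    unfolding sum_distrib_left by (rule sum.swap)
  also have "\<dots> \<le> (\<Sum>\<alpha>\<in>lowdeg n d. cmod (cf f \<alpha>) * mpow R \<alpha>)"
    by (intro sum_mono mult_left_mono nbD[OF nb_mpow] A g \<rho>) (auto dest: lowdegD)
  also have "\<dots> \<le> M" by (rule nbD[OF f]) simp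
  finally show "(\<Sum>\<gamma>\<in>A. cmod (cf (subst n g f) \<gamma>) * mpow \<rho> \<gamma>) \<le> M" .
qed

section \<open>Convergent power series\<close>

definition C :: "nat \<Rightarrow> pseries set"
  where "C n = {f. in_vars n (cf f) \<and> convergent_series (cf f)}"

lemma convergent_series_iff: "convergent_series (cf f) \<longleftrightarrow> (\<exists>r>0. \<exists>M. nb (\<lambda>_. r) f M)"
proof -
  have "(\<lambda>\<alpha>. cf f \<alpha> * of_real r ^ mdeg \<alpha>) abs_summable_on UNIV \<longleftrightarrow> (\<exists>M. nb (\<lambda>_. r) f M)" if "r > 0" for r
    unfolding abs_summable_iff_bdd_above using that
    by (auto simp: bdd_above_def nb_def norm_mult norm_power mpow_const)
  then show ?thesis unfolding convergent_series_def by blast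
qed

lemma C_iff: "f \<in> C n \<longleftrightarrow> in_vars n (cf f) \<and> (\<exists>r>0. \<exists>M. nb (\<lambda>_. r) f M)"
  by (simp add: C_def convergent_series_iff)

lemma C_in_vars: "f \<in> C n \<Longrightarrow> in_vars n (cf f)"
  by (simp add: C_def)

lemma C_common_radius:
  assumes "f \<in> C n" "g \<in> C m"
  obtains r M N where "r > 0" "nb (\<lambda>_. r) f M" "nb (\<lambda>_. r) g N"
proof -
  obtain r M s N where r: "r > 0" "nb (\<lambda>_. r) f M" and s: "s > 0" "nb (\<lambda>_. s) g N"
    using assms by (auto simp: C_iff)
  show ?thesis
    by (rule that[of "min r s" M N]) (use r s in \<open>auto intro: nb_radius_mono\<close>)
qed

lemma in_vars_mult: "in_vars n (cf f) \<Longrightarrow> in_vars n (cf g) \<Longrightarrow> in_vars n (cf (f * g))"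
  unfolding in_vars_def
proof (intro allI impI)
  fix \<gamma> assume *: "\<forall>\<alpha>. cf f \<alpha> \<noteq> 0 \<longrightarrow> keys \<alpha> \<subseteq> {..<n}" "\<forall>\<alpha>. cf g \<alpha> \<noteq> 0 \<longrightarrow> keys \<alpha> \<subseteq> {..<n}"
    and "cf (f * g) \<gamma> \<noteq> 0"
  then obtain x where "x \<in> {(\<alpha>, \<beta>). \<alpha> + \<beta> = \<gamma>}" "(case x of (\<alpha>, \<beta>) \<Rightarrow> cf f \<alpha> * cf g \<beta>) \<noteq> 0"
    unfolding cf_mult by (blast elim: sum.not_neutral_contains_not_neutral)
  then show "keys \<gamma> \<subseteq> {..<n}" using * unfolding keys_add_nat by (auto simp: keys_add_nat) (meson lessThan_iff subsetD)+
qed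

lemma in_vars_add: "in_vars n (cf f) \<Longrightarrow> in_vars n (cf g) \<Longrightarrow> in_vars n (cf (f + g))"
  unfolding in_vars_def by (metis add.right_neutral cf_add)

lemma in_vars_diff: "in_vars n (cf f) \<Longrightarrow> in_vars n (cf g) \<Longrightarrow> in_vars n (cf (f - g))"
  unfolding in_vars_def by (metis diff_0_right cf_diff)

lemma C_add: "f \<in> C n \<Longrightarrow> g \<in> C n \<Longrightarrow> f + g \<in> C n"
  by (rule C_common_radius, assumption+)
     (auto simp: C_iff[of "f + g"] C_in_vars intro!: in_vars_add nb_add less_imp_le exI)

lemma C_mult: "f \<in> C n \<Longrightarrow> g \<in> C n \<Longrightarrow> f * g \<in> C n"
  by (rule C_common_radius, assumption+)
     (auto simp: C_iff[of "f * g"] C_in_vars intro!: in_vars_mult nb_mult less_imp_le exI)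

lemma C_scl: "f \<in> C n \<Longrightarrow> scl c f \<in> C n"
  unfolding C_iff in_vars_def by (fastforce intro: nb_scl)

lemma C_uminus: "f \<in> C n \<Longrightarrow> - f \<in> C n"
  unfolding C_iff in_vars_def by (fastforce intro: nb_uminus)

lemma C_diff: "f \<in> C n \<Longrightarrow> g \<in> C n \<Longrightarrow> f - g \<in> C n"
  using C_add[of f n "- g"] C_uminus by simp

lemma C_xpow: "keys \<alpha> \<subseteq> {..<n} \<Longrightarrow> xpow \<alpha> \<in> C n"
  using nb_xpow[of "\<lambda>_. 1" \<alpha>] by (auto simp: C_iff in_vars_def cf_xpow intro: zero_less_one split: if_splits)

lemma C_0 [simp]: "0 \<in> C n"
  by (auto simp: C_iff in_vars_def intro!: exI[of _ 1] nb_0)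

lemma C_1 [simp]: "1 \<in> C n"
  using C_xpow[of 0 n] by (simp add: xpow_0)

lemma C_xv: "i < n \<Longrightarrow> xv i \<in> C n"
  using C_xpow[of "single1 i" n] by (simp add: xv_def)

lemma C_sum: "(\<And>x. x \<in> A \<Longrightarrow> f x \<in> C n) \<Longrightarrow> sum f A \<in> C n"
  by (induction A rule: infinite_finite_induct) (auto intro: C_add)

lemma C_power: "f \<in> C n \<Longrightarrow> f ^ k \<in> C n"
  by (induction k) (auto intro: C_mult)

lemma C_prod: "(\<And>x. x \<in> A \<Longrightarrow> f x \<in> C n) \<Longrightarrow> prod f A \<in> C n"
  by (induction A rule: infinite_finite_induct) (auto intro: C_mult)

lemma C_mpow: "(\<And>i. i \<in> keys \<alpha> \<Longrightarrow> g i \<in> C n) \<Longrightarrow> mpow g \<alpha> \<in> C n"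
  unfolding mpow_def by (intro C_prod C_power)

lemma C_mono: "n \<le> m \<Longrightarrow> C n \<subseteq> C m"
  by (fastforce simp: C_iff in_vars_def)

text \<open>By \<open>nb_shrink\<close> the norm at radius \<open>s\<close> is of the size of
  \<open>s ^ k\<close>; one factor \<open>s\<close> is spent on making the constant as small as
  prescribed.\<close>

lemma eventually_nb:
  assumes "f \<in> C n" "ordge k f" "k > 0" "r > 0"
  shows "eventually (\<lambda>s. nb (\<lambda>_. s) f (r * s ^ (k - 1))) (at_right 0)"
proof -
  obtain r0 M where r0: "r0 > 0" and M: "nb (\<lambda>_. r0) f M" using assms by (auto simp: C_iff)
  define b where "b = min r0 (r * r0 ^ k / (M + 1))"
  have M0: "0 \<le> M" using nb_nonneg[OF M] .
  have b: "b > 0" using r0 assms M0 by (simp add: b_def)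
  have "nb (\<lambda>_. s) f (r * s ^ (k - 1))" if s: "0 < s" "s < b" for s
  proof -
    have sr: "s < r0" "s * (M + 1) < r * r0 ^ k"
      using s M0 by (auto simp: b_def field_simps)
    have "nb (\<lambda>_. (s / r0) * r0) f ((s / r0) ^ k * M)"
      using s sr r0 by (intro nb_shrink M assms) auto
    moreover have "(s / r0) ^ k * M \<le> r * s ^ (k - 1)"
    proof -
      have "(s / r0) ^ k * M = (s * M / r0 ^ k) * s ^ (k - 1)"
        using \<open>k > 0\<close> by (cases k) (auto simp: power_divide field_simps)
      also have "\<dots> \<le> r * s ^ (k - 1)"
      proof (intro mult_right_mono)
        have "s * M \<le> s * (M + 1)" using s by simp
        then have "s * M \<le> r * r0 ^ k" using sr by linarith
        then show "s * M / r0 ^ k \<le> r" using r0 by (simp add: field_simps)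
      qed (use s in auto)
      finally show ?thesis .
    qed
    ultimately show ?thesis using r0 by (auto intro: nb_weaken)
  qed
  then show ?thesis
    unfolding eventually_at_right_field using b by (intro exI[of _ b]) auto
qed

lemma eventually_nb_all:
  fixes g :: "nat \<Rightarrow> pseries"
  assumes "\<And>i. i < n \<Longrightarrow> g i \<in> C m" "\<And>i. i < n \<Longrightarrow> ordge k (g i)" "k > 0" "r > 0"
  shows "\<exists>s>0. \<forall>i<n. nb (\<lambda>_. s) (g i) (r * s ^ (k - 1))"
proof -
  have "eventually (\<lambda>s. \<forall>i\<in>{..<n}. nb (\<lambda>_. s) (g i) (r * s ^ (k - 1))) (at_right 0)"
    by (rule eventually_ball_finite[OF finite_lessThan]) (auto intro: eventually_nb assms)
  with eventually_at_right_less[of "0::real"]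
  have "eventually (\<lambda>s. 0 < s \<and> (\<forall>i\<in>{..<n}. nb (\<lambda>_. s) (g i) (r * s ^ (k - 1)))) (at_right 0)"
    by eventually_elim auto
  from eventually_happens[OF this] show ?thesis by (auto simp: trivial_limit_at_right_real)
qed

lemma in_vars_peval_terms:
  "(\<And>i. i \<in> keys \<alpha> \<Longrightarrow> in_vars m (cf (g i))) \<Longrightarrow> in_vars m (cf (mpow g \<alpha>))"
proof -
  have 1: "in_vars m (cf 1)" by (simp add: in_vars_def cf_1)
  have pow: "in_vars m (cf (f ^ k))" if "in_vars m (cf f)" for f k
    by (induction k) (auto intro: in_vars_mult that 1)
  have pr: "(\<And>x. x \<in> A \<Longrightarrow> in_vars m (cf (f x))) \<Longrightarrow> in_vars m (cf (prod f A))" for A :: "nat set" and f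
    by (induction A rule: infinite_finite_induct) (auto intro: in_vars_mult 1)
  assume "\<And>i. i \<in> keys \<alpha> \<Longrightarrow> in_vars m (cf (g i))"
  then show ?thesis unfolding mpow_def by (intro pr pow)
qed

lemma in_vars_subst:
  assumes "\<And>i. i < n \<Longrightarrow> in_vars m (cf (g i))"
  shows "in_vars m (cf (subst n g f))"
  unfolding in_vars_def
proof (intro allI impI)
  fix \<gamma> assume "cf (subst n g f) \<gamma> \<noteq> 0"
  then obtain \<alpha> where \<alpha>: "\<alpha> \<in> lowdeg n (mdeg \<gamma>)" "cf f \<alpha> * cf (mpow g \<alpha>) \<gamma> \<noteq> 0"
    unfolding cf_subst by (rule sum.not_neutral_contains_not_neutral)
  have "in_vars m (cf (mpow g \<alpha>))"
    using \<alpha>(1) by (intro in_vars_peval_terms assms) (auto dest: lowdegD)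
  then show "keys \<gamma> \<subseteq> {..<m}" using \<alpha>(2) by (auto simp: in_vars_def)
qed

lemma C_subst:
  assumes f: "f \<in> C n" and g: "\<And>i. i < n \<Longrightarrow> g i \<in> C m" and ord: "\<And>i. i < n \<Longrightarrow> ordge 1 (g i)"
  shows "subst n g f \<in> C m"
proof -
  obtain r M where r: "r > 0" "nb (\<lambda>_. r) f M" using f by (auto simp: C_iff)
  \<comment> \<open>The exponent \<open>1 - 1\<close> leaves the plain bound \<open>r\<close>: at a
    small radius the \<open>g i\<close> stay inside the polydisc on which \<open>f\<close>
    converges.\<close>
  obtain s where s: "s > 0" "\<forall>i<n. nb (\<lambda>_. s) (g i) (r * s ^ (1 - 1))"
    using eventually_nb_all[of n g m 1 r, OF g ord] r by auto
  have "nb (\<lambda>_. s) (subst n g f) M"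
    using s by (intro nb_subst[OF r(2)] ord) auto
  moreover have "in_vars m (cf (subst n g f))"
    by (intro in_vars_subst C_in_vars g)
  ultimately show ?thesis using s by (auto simp: C_iff)
qed

section \<open>The inverse function theorem\<close>

text \<open>Iteration of \<open>h \<mapsto> x - p(h)\<close>, whose fixed point satisfies
  \<open>h + p(h) = x\<close> and so inverts \<open>x + p\<close>.\<close>

primrec inv_iter :: "nat \<Rightarrow> (nat \<Rightarrow> pseries) \<Rightarrow> nat \<Rightarrow> nat \<Rightarrow> pseries"
  where
    "inv_iter n p 0 = (\<lambda>_. 0)"
  | "inv_iter n p (Suc k) = (\<lambda>i. xv i - subst n (inv_iter n p k) (p i))"

text \<open>Since \<open>p\<close> has order 2, each iteration gains one order, so the coefficients
  stabilise. That the limit is a convergent series comes from a norm bound shared by all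
  iterates.\<close>

lemma right_inverse_exists:
  assumes p: "\<And>i. i < n \<Longrightarrow> p i \<in> C n" and p2: "\<And>i. i < n \<Longrightarrow> ordge 2 (p i)"
  shows "\<exists>h. \<forall>i<n. h i \<in> C n \<and> ordge 2 (h i - xv i) \<and> h i = xv i - subst n h (p i)"
proof -
  define H where "H = inv_iter n p"
  have H0: "H 0 = (\<lambda>_. 0)" and HS: "H (Suc k) i = xv i - subst n (H k) (p i)" for k i
    by (simp_all add: H_def)
  have p1: "ordge 1 (p i)" if "i < n" for i using ordge_mono[OF p2[OF that]] by simp
  have ord: "i < n \<Longrightarrow> ordge 1 (H k i)" for k i
  proof (induction k arbitrary: i)
    case (Suc k)
    then show ?case unfolding HS by (intro ordge_diff ordge_xv subst_ordge p1) auto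
  qed (simp add: H0)
  have iv: "i < n \<Longrightarrow> in_vars n (cf (H k i))" for k i
  proof (induction k arbitrary: i)
    case (Suc k)
    then show ?case
      unfolding HS by (intro in_vars_diff in_vars_subst C_in_vars[OF C_xv]) auto
  qed (simp add: H0 in_vars_def)
  have step: "i < n \<Longrightarrow> ordge (Suc k) (H (Suc k) i - H k i)" for k i
  proof (induction k arbitrary: i)
    case 0
    then show ?case using ord[of i "Suc 0"] by (simp add: H0 One_nat_def)
  next
    case (Suc k)
    have "ordge (k + 2) (subst n (H k) (p i) - subst n (H (Suc k)) (p i))"
    proof (intro subst_diff_ordge ord p2 Suc.prems)
      fix j assume "j < n"
      from ordge_uminus[OF Suc.IH[OF this]] show "ordge (Suc k) (H k j - H (Suc k) j)" by simp
    qed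
    then show ?case by (simp add: HS[of "Suc k"] HS[of k i])
  qed
  \<comment> \<open>Order 2 makes the norm of \<open>p i\<close> at radius \<open>s\<close> at most
    half of \<open>s\<close>. With variables of norm \<open>r = s / 2\<close>, the bound
    \<open>s\<close> for the iterates then reproduces itself as
    \<open>s / 2 + s / 2\<close>.\<close>
  obtain s where s: "s > 0" and ps: "\<forall>i<n. nb (\<lambda>_. s) (p i) (1/2 * s ^ (2 - 1))"
    using eventually_nb_all[of n p n 2 "1/2", OF p p2] by auto
  define r where "r = s / 2"
  have r: "r > 0" using s by (simp add: r_def)
  have bd: "i < n \<Longrightarrow> nb (\<lambda>_. r) (H k i) s" for k i
  proof (induction k arbitrary: i)
    case 0
    then show ?case using s by (simp add: H0 nb_0)
  next
    case (Suc k)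
    have "nb (\<lambda>_. r) (subst n (H k) (p i)) (1/2 * s ^ (2 - 1))"
      using Suc.IH r ps Suc.prems by (intro nb_subst[of "\<lambda>_. s"] ord) auto
    moreover have "nb (\<lambda>_. r) (xv i) r"
      using nb_xpow[of "\<lambda>_. r" "single1 i"] r by (simp add: xv_def)
    ultimately have "nb (\<lambda>_. r) (H (Suc k) i) (r + 1/2 * s ^ (2 - 1))"
      unfolding HS using r by (intro nb_diff) auto
    then show ?case by (simp add: r_def)
  qed
  \<comment> \<open>Coefficients of degree \<open>j\<close> no longer change from iterate
    \<open>j + 1\<close> on.\<close>
  define h where "h i = Ser (\<lambda>\<gamma>. cf (H (Suc (mdeg \<gamma>)) i) \<gamma>)" for i
  have stab: "cf (H k i) \<gamma> = cf (h i) \<gamma>" if "i < n" "mdeg \<gamma> < k" for i k \<gamma>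
    using that(2)
  proof (induction k)
    case (Suc k)
    show ?case
    proof (cases "mdeg \<gamma> = k")
      case False
      have "cf (H (Suc k) i - H k i) \<gamma> = 0"
        using Suc.prems by (intro ordgeD[OF step] that) auto
      then show ?thesis using Suc False by simp
    qed (simp add: h_def)
  qed simp
  have hH: "ordge d (h i - H d i)" if "i < n" for i d
    unfolding ordge_def using stab[OF that, of _ d] by (metis cf_diff diff_self not_le)
  have h1: "ordge 1 (h i)" if "i < n" for i
    using ordge_add[OF hH[OF that, of 1] ord[OF that, of 1]] by simp
  have "h i = xv i - subst n h (p i)" if i: "i < n" for i
  proof (rule eq_if_ordge_diff)
    fix d
    have "ordge (d + 2) (subst n (H (Suc d)) (p i) - subst n h (p i))"
    proof (intro subst_diff_ordge ord h1 p2 i)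
      fix j assume "j < n"
      from ordge_uminus[OF hH[OF this, of "Suc d"]] show "ordge (Suc d) (H (Suc d) j - h j)" by simp
    qed
    then have *: "ordge d (subst n (H (Suc d)) (p i) - subst n h (p i))" by (rule ordge_mono) simp
    have "h i - (xv i - subst n h (p i)) = (h i - H (Suc (Suc d)) i) - (subst n (H (Suc d)) (p i) - subst n h (p i))"
      by (simp add: HS)
    also have "ordge d \<dots>"
      by (intro ordge_diff * ordge_mono[OF hH[OF i]]) simp
    finally show "ordge d (h i - (xv i - subst n h (p i)))" .
  qed
  moreover have "h i \<in> C n" if i: "i < n" for i
  proof -
    have "in_vars n (cf (h i))"
      using iv[OF i] unfolding in_vars_def h_def by simp
    moreover have "nb (\<lambda>_. r) (h i) s"
      unfolding nb_def
    proof (intro allI impI)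
      fix A :: "expo set" assume A: "finite A"
      \<comment> \<open>Finitely many coefficients of the limit all occur in a single iterate, whose
        bound they inherit.\<close>
      define d where "d = Suc (Max (insert 0 (mdeg ` A)))"
      have "cf (h i) \<gamma> = cf (H d i) \<gamma>" if "\<gamma> \<in> A" for \<gamma>
        using A that by (intro stab[OF i, symmetric]) (auto simp: d_def less_Suc_eq_le)
      then have "(\<Sum>\<alpha>\<in>A. cmod (cf (h i) \<alpha>) * mpow (\<lambda>_. r) \<alpha>) = (\<Sum>\<alpha>\<in>A. cmod (cf (H d i) \<alpha>) * mpow (\<lambda>_. r) \<alpha>)"
        by simp
      also have "\<dots> \<le> s" by (rule nbD[OF bd[OF i] A])
      finally show "(\<Sum>\<alpha>\<in>A. cmod (cf (h i) \<alpha>) * mpow (\<lambda>_. r) \<alpha>) \<le> s" .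
    qed
    ultimately show ?thesis using r by (auto simp: C_iff)
  qed
  moreover have "ordge 2 (h i - xv i)" if "i < n" for i
  proof -
    have "ordge 2 (subst n h (p i))" by (intro subst_ordge h1 p2 that)
    then have "ordge 2 (- subst n h (p i))" by (rule ordge_uminus)
    then show ?thesis using calculation(1)[OF that] by (metis add_diff_cancel_left' diff_minus_eq_add uminus_add_conv_diff add.commute)
  qed
  ultimately show ?thesis by blast
qed

lemma ordge_1_if_unipotent: "ordge 2 (g - xv i) \<Longrightarrow> ordge 1 g"
  using ordge_add[of 1 "g - xv i" "xv i"] ordge_mono[of 2 _ 1] ordge_xv by simp

lemma left_inverse_exists:
  assumes t: "\<And>i. i < n \<Longrightarrow> t i \<in> C n" and t2: "\<And>i. i < n \<Longrightarrow> ordge 2 (t i - xv i)"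
  shows "\<exists>h. (\<forall>i<n. h i \<in> C n \<and> ordge 2 (h i - xv i)) \<and> (\<forall>f\<in>C n. subst n h (subst n t f) = f)"
proof -
  have "\<exists>h. \<forall>i<n. h i \<in> C n \<and> ordge 2 (h i - xv i) \<and> h i = xv i - subst n h (t i - xv i)"
    by (rule right_inverse_exists) (auto intro: t t2 C_diff C_xv)
  then obtain h where h: "\<And>i. i < n \<Longrightarrow> h i \<in> C n" "\<And>i. i < n \<Longrightarrow> ordge 2 (h i - xv i)"
      "\<And>i. i < n \<Longrightarrow> h i = xv i - subst n h (t i - xv i)" by blast
  have h1: "ordge 1 (h i)" if "i < n" for i using h(2)[OF that] by (rule ordge_1_if_unipotent)
  have t1: "ordge 1 (t i)" if "i < n" for i using t2[OF that] by (rule ordge_1_if_unipotent)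
  have *: "subst n h (t i) = xv i" if "i < n" for i
    using h(3)[OF that] by (simp add: subst_diff subst_xv that h1)
  have "subst n h (subst n t f) = f" if "f \<in> C n" for f
  proof -
    have "subst n h (subst n t f) = subst n (\<lambda>i. subst n h (t i)) f" by (rule subst_comp) (auto intro: t1 h1)
    also have "\<dots> = subst n xv f" by (rule subst_cong) (rule *)
    also have "\<dots> = f" by (rule subst_id) (rule C_in_vars[OF that])
    finally show ?thesis .
  qed
  with h show ?thesis by blast
qed

text \<open>One-sided inverses that exist for every element of a monoid are two-sided: the inverse
  \<open>h\<close> is again unipotent, so it has an inverse \<open>h'\<close> of the same kind,
  which must act as \<open>t\<close> does.\<close>

theorem unipotent_inverse:
  assumes t: "\<And>i. i < n \<Longrightarrow> t i \<in> C n" and t2: "\<And>i. i < n \<Longrightarrow> ordge 2 (t i - xv i)"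
  obtains h where "\<And>i. i < n \<Longrightarrow> h i \<in> C n" "\<And>i. i < n \<Longrightarrow> ordge 2 (h i - xv i)"
    "\<And>f. f \<in> C n \<Longrightarrow> subst n h (subst n t f) = f"
    "\<And>f. f \<in> C n \<Longrightarrow> subst n t (subst n h f) = f"
proof -
  obtain h where h: "\<And>i. i < n \<Longrightarrow> h i \<in> C n" "\<And>i. i < n \<Longrightarrow> ordge 2 (h i - xv i)"
    "\<And>f. f \<in> C n \<Longrightarrow> subst n h (subst n t f) = f"
    using left_inverse_exists[OF t t2] by blast
  obtain h' where h': "\<And>i. i < n \<Longrightarrow> h' i \<in> C n" "\<And>i. i < n \<Longrightarrow> ordge 2 (h' i - xv i)"
    "\<And>f. f \<in> C n \<Longrightarrow> subst n h' (subst n h f) = f"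
    using left_inverse_exists[OF h(1,2)] by blast
  have closed: "subst n t f \<in> C n" "subst n h f \<in> C n" if "f \<in> C n" for f
    using that by (auto intro!: C_subst t h ordge_1_if_unipotent[OF t2] ordge_1_if_unipotent[OF h(2)])
  have "subst n t (subst n h f) = f" if "f \<in> C n" for f
  proof -
    have "subst n t (subst n h f) = subst n h' (subst n h (subst n t (subst n h f)))"
      using that by (simp add: h' closed)
    also have "\<dots> = f" using that by (simp add: h h' closed)
    finally show ?thesis .
  qed
  with h that show ?thesis by blast
qed

section \<open>Division with remainder and Krull's intersection theorem\<close>

text \<open>The monomials are ordered by \<open>wgt\<close>, which maps \<open>x\<^sub>i\<close> to the \<open>i\<close>-th prime: it is multiplicative,
  injective by unique factorisation, and well-ordered because it takes values in \<open>\<nat>\<close>.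
  With the radii \<open>p\<^sub>i\<^sup>-\<^sup>\<sigma>\<close> the monomial \<open>x\<^sup>\<alpha>\<close> has norm \<open>(wgt \<alpha>)\<^sup>-\<^sup>\<sigma>\<close>, so that the initial monomial
  of a series dominates its norm as \<open>\<sigma> \<rightarrow> \<infinity>\<close>.\<close>

definition nth_pr :: "nat \<Rightarrow> nat"
  where "nth_pr = enumerate {p. prime p}"

definition wgt :: "expo \<Rightarrow> nat"
  where "wgt \<alpha> = mpow nth_pr \<alpha>"

lemma prime_nth_pr: "prime (nth_pr i)"
  using enumerate_in_set[OF primes_infinite] by (simp add: nth_pr_def)

lemma nth_pr_ge_2: "2 \<le> nth_pr i"
  by (rule prime_ge_2_nat) (rule prime_nth_pr)

lemma nth_pr_gt_0: "0 < nth_pr i"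
  using nth_pr_ge_2[of i] by linarith

lemma nth_pr_neq_0 [simp]: "nth_pr i \<noteq> 0"
  using nth_pr_gt_0[of i] by simp

lemma inj_nth_pr: "inj nth_pr"
  unfolding nth_pr_def by (intro strict_mono_imp_inj_on strict_mono_enumerate primes_infinite)

lemma nth_pr_le: "i \<le> j \<Longrightarrow> nth_pr i \<le> nth_pr j"
  unfolding nth_pr_def using strict_mono_enumerate[OF primes_infinite]
  by (simp add: strict_mono_less_eq)

lemma wgt_add: "wgt (\<alpha> + \<beta>) = wgt \<alpha> * wgt \<beta>"
  by (simp add: wgt_def mpow_add)

lemma wgt_pos: "0 < wgt \<alpha>"
  unfolding wgt_def mpow_def by (intro prod_pos) (simp add: nth_pr_gt_0)

lemma multiplicity_wgt: "multiplicity (nth_pr i) (wgt \<alpha>) = lookup \<alpha> i"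
proof -
  let ?A = "insert i (keys \<alpha>)"
  have "wgt \<alpha> = (\<Prod>j\<in>?A. nth_pr j ^ lookup \<alpha> j)"
    unfolding wgt_def by (rule mpow_superset) auto
  then have "multiplicity (nth_pr i) (wgt \<alpha>) = (\<Sum>j\<in>?A. multiplicity (nth_pr i) (nth_pr j ^ lookup \<alpha> j))"
    using prime_nth_pr nth_pr_gt_0 by (simp only:, subst prime_elem_multiplicity_prod_distrib)
      (auto simp: prime_imp_prime_elem)
  also have "\<dots> = (\<Sum>j\<in>?A. if j = i then lookup \<alpha> i else 0)"
  proof (rule sum.cong)
    fix j
    show "multiplicity (nth_pr i) (nth_pr j ^ lookup \<alpha> j) = (if j = i then lookup \<alpha> i else 0)"
    proof (cases "j = i")
      case True
      then show ?thesis using prime_nth_pr nth_pr_ge_2[of i]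
        by (simp add: multiplicity_same_power nth_pr_gt_0)
    next
      case False
      then have "nth_pr j \<noteq> nth_pr i" using inj_nth_pr by (auto dest: injD)
      then show ?thesis using False prime_nth_pr
        by (simp add: multiplicity_distinct_prime_power)
    qed
  qed simp
  also have "\<dots> = lookup \<alpha> i" by simp
  finally show ?thesis .
qed

lemma wgt_inj: "wgt \<alpha> = wgt \<beta> \<Longrightarrow> \<alpha> = \<beta>"
  by (rule poly_mapping_eqI) (metis multiplicity_wgt)

lemma wgt_ge: "2 ^ mdeg \<alpha> \<le> wgt \<alpha>"
  unfolding wgt_def mpow_const[symmetric] mpow_def
  by (intro prod_mono conjI power_mono nth_pr_ge_2) auto

definition rad :: "nat \<Rightarrow> nat \<Rightarrow> real"
  where "rad \<sigma> i = (1 / real (nth_pr i)) ^ \<sigma>"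

lemma rad_nonneg: "0 \<le> rad \<sigma> i"
  by (simp add: rad_def)

lemma mpow_rad: "mpow (rad \<sigma>) \<alpha> = (1 / real (wgt \<alpha>)) ^ \<sigma>"
proof -
  have "mpow (rad \<sigma>) \<alpha> = (\<Prod>i\<in>keys \<alpha>. ((1 / real (nth_pr i)) ^ lookup \<alpha> i) ^ \<sigma>)"
    unfolding mpow_def rad_def by (simp add: power_mult[symmetric] mult.commute)
  also have "\<dots> = (1 / real (wgt \<alpha>)) ^ \<sigma>"
    by (simp add: wgt_def mpow_def prod_power_distrib[symmetric] power_one_over prod_dividef)
  finally show ?thesis .
qed

lemma rad_antimono: "\<sigma> \<le> \<tau> \<Longrightarrow> rad \<tau> i \<le> rad \<sigma> i"
  unfolding rad_def using nth_pr_gt_0[of i] by (intro power_decreasing) auto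

lemma C_eventually_nb_rad:
  assumes "f \<in> C n"
  shows "eventually (\<lambda>\<sigma>. \<exists>M. nb (rad \<sigma>) f M) sequentially"
proof -
  obtain r M where r: "r > 0" "nb (\<lambda>_. r) f M" using assms by (auto simp: C_iff)
  obtain \<sigma>0 where \<sigma>0: "(1/2) ^ \<sigma>0 < r" using real_arch_pow_inv[OF r(1), of "1/2"] by auto
  have "rad \<sigma> i \<le> r" if "\<sigma> \<ge> \<sigma>0" for \<sigma> i
  proof -
    have "rad \<sigma> i \<le> rad \<sigma>0 i" by (rule rad_antimono) (rule that)
    also have "\<dots> \<le> (1/2) ^ \<sigma>0"
      unfolding rad_def using nth_pr_ge_2[of i] by (intro power_mono) (auto simp: field_simps)
    finally show ?thesis using \<sigma>0 by linarith
  qed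
  then have "nb (rad \<sigma>) f M" if "\<sigma> \<ge> \<sigma>0" for \<sigma>
    using that by (intro nb_radius_mono[OF r(2)]) (auto simp: rad_nonneg)
  then show ?thesis unfolding eventually_sequentially by blast
qed

lemma C_if_nb_rad:
  assumes iv: "in_vars n (cf f)" and M: "nb (rad \<sigma>) f M"
  shows "f \<in> C n"
proof -
  \<comment> \<open>The radii decrease with the index and only variables below \<open>n\<close>
    occur, so this single radius lies below all those that matter.\<close>
  define r where "r = rad \<sigma> n"
  have r: "r > 0" using nth_pr_gt_0[of n] by (simp add: r_def rad_def)
  have "nb (\<lambda>_. r) f M"
    unfolding nb_def
  proof (intro allI impI)
    fix A :: "expo set" assume A: "finite A"
    have "(\<Sum>\<alpha>\<in>A. cmod (cf f \<alpha>) * mpow (\<lambda>_. r) \<alpha>) \<le> (\<Sum>\<alpha>\<in>A. cmod (cf f \<alpha>) * mpow (rad \<sigma>) \<alpha>)"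
    proof (rule sum_mono)
      fix \<alpha>
      show "cmod (cf f \<alpha>) * mpow (\<lambda>_. r) \<alpha> \<le> cmod (cf f \<alpha>) * mpow (rad \<sigma>) \<alpha>"
      proof (cases "cf f \<alpha> = 0")
        case False
        have "r \<le> rad \<sigma> i" if "i \<in> keys \<alpha>" for i
        proof -
          have "i \<le> n" using that False iv unfolding in_vars_def by (meson lessThan_iff less_imp_le subsetD)
          then have "nth_pr i \<le> nth_pr n" by (rule nth_pr_le)
          then show ?thesis
            unfolding r_def rad_def using nth_pr_gt_0[of i] by (intro power_mono) (auto simp: field_simps)
        qed
        then have "mpow (\<lambda>_. r) \<alpha> \<le> mpow (rad \<sigma>) \<alpha>"
          unfolding mpow_def using r by (intro prod_mono conjI power_mono zero_le_power) auto
        then show ?thesis by (intro mult_left_mono) auto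
      qed simp
    qed
    also have "\<dots> \<le> M" by (rule nbD[OF M A])
    finally show "(\<Sum>\<alpha>\<in>A. cmod (cf f \<alpha>) * mpow (\<lambda>_. r) \<alpha>) \<le> M" .
  qed
  then show ?thesis using r iv by (auto simp: C_iff)
qed

text \<open>Weights are integers, so with \<open>w = wgt \<beta>\<close> every monomial of
  \<open>h\<close> has weight at least \<open>w + 1\<close>. Raising \<sigma> by \<tau> multiplies
  the norm of \<open>h\<close> by at most \<open>(1 / (w + 1)) ^ \<tau>\<close>, but that of the
  monomial \<beta> by \<open>(1 / w) ^ \<tau>\<close>.\<close>

lemma eventually_nb_tail:
  assumes h: "h \<in> C n" and gt: "\<And>\<alpha>. cf h \<alpha> \<noteq> 0 \<Longrightarrow> wgt \<beta> < wgt \<alpha>" and c: "c > 0"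
  shows "eventually (\<lambda>\<sigma>. nb (rad \<sigma>) h (c * mpow (rad \<sigma>) \<beta>)) sequentially"
proof -
  obtain \<sigma>0 M where M: "nb (rad \<sigma>0) h M"
    using eventually_happens[OF C_eventually_nb_rad[OF h]] by auto
  have M0: "0 \<le> M" by (rule nb_nonneg[OF M])
  define w where "w = real (wgt \<beta>)"
  have w: "w > 0" using wgt_pos[of \<beta>] by (simp add: w_def)
  have "(\<lambda>\<tau>. (w / (w + 1)) ^ \<tau>) \<longlonglongrightarrow> 0"
    using w by (intro LIMSEQ_power_zero) auto
  then have "(\<lambda>\<tau>. M * w ^ \<sigma>0 * (w / (w + 1)) ^ \<tau>) \<longlonglongrightarrow> 0"
    by (rule tendsto_mult_right_zero)
  then have "eventually (\<lambda>\<tau>. M * w ^ \<sigma>0 * (w / (w + 1)) ^ \<tau> < c) sequentially"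
    using c by (auto simp: order_tendsto_iff)
  then have "eventually (\<lambda>\<tau>. nb (rad (\<tau> + \<sigma>0)) h (c * mpow (rad (\<tau> + \<sigma>0)) \<beta>)) sequentially"
  proof eventually_elim
    case (elim \<tau>)
    have nbt: "nb (rad (\<tau> + \<sigma>0)) h ((1 / (w + 1)) ^ \<tau> * M)"
      unfolding nb_def
    proof (intro allI impI)
      fix A :: "expo set" assume A: "finite A"
      have "(\<Sum>\<alpha>\<in>A. cmod (cf h \<alpha>) * mpow (rad (\<tau> + \<sigma>0)) \<alpha>)
          \<le> (\<Sum>\<alpha>\<in>A. (1 / (w + 1)) ^ \<tau> * (cmod (cf h \<alpha>) * mpow (rad \<sigma>0) \<alpha>))"
      proof (rule sum_mono)
        fix \<alpha>
        show "cmod (cf h \<alpha>) * mpow (rad (\<tau> + \<sigma>0)) \<alpha> \<le> (1 / (w + 1)) ^ \<tau> * (cmod (cf h \<alpha>) * mpow (rad \<sigma>0) \<alpha>)"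
        proof (cases "cf h \<alpha> = 0")
          case False
          then have "w + 1 \<le> real (wgt \<alpha>)" using gt[of \<alpha>] by (simp add: w_def)
          then have "(1 / real (wgt \<alpha>)) ^ \<tau> \<le> (1 / (w + 1)) ^ \<tau>"
            using w by (intro power_mono) (auto simp: field_simps)
          then have "(1 / real (wgt \<alpha>)) ^ \<tau> * (cmod (cf h \<alpha>) * mpow (rad \<sigma>0) \<alpha>)
              \<le> (1 / (w + 1)) ^ \<tau> * (cmod (cf h \<alpha>) * mpow (rad \<sigma>0) \<alpha>)"
            by (intro mult_right_mono mult_nonneg_nonneg mpow_nonneg rad_nonneg) auto
          then show ?thesis by (simp add: mpow_rad power_add mult_ac)
        qed simp
      qed
      also have "\<dots> \<le> (1 / (w + 1)) ^ \<tau> * M"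
        unfolding sum_distrib_left[symmetric] using w by (intro mult_left_mono nbD[OF M A]) auto
      finally show "(\<Sum>\<alpha>\<in>A. cmod (cf h \<alpha>) * mpow (rad (\<tau> + \<sigma>0)) \<alpha>) \<le> (1 / (w + 1)) ^ \<tau> * M" .
    qed
    have "(1 / (w + 1)) ^ \<tau> * M = (M * w ^ \<sigma>0 * (w / (w + 1)) ^ \<tau>) * (1 / w) ^ (\<tau> + \<sigma>0)"
      using w by (simp add: power_add power_divide field_simps)
    also have "\<dots> \<le> c * (1 / w) ^ (\<tau> + \<sigma>0)"
      using elim w by (intro mult_right_mono) auto
    finally show ?case using nbt by (auto simp: mpow_rad w_def intro: nb_weaken)
  qed
  then show ?thesis
    using eventually_sequentially_seg[of "\<lambda>\<sigma>. nb (rad \<sigma>) h (c * mpow (rad \<sigma>) \<beta>)" \<sigma>0] by blast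
qed

subsection \<open>Dickson's lemma\<close>

lemma incseq_subseq_nat:
  fixes s :: "nat \<Rightarrow> nat"
  shows "\<exists>r::nat \<Rightarrow> nat. strict_mono r \<and> incseq (s \<circ> r)"
proof -
  obtain f :: "nat \<Rightarrow> nat" where f: "strict_mono f" "monoseq (\<lambda>n. s (f n))"
    using seq_monosub by blast
  show ?thesis
  proof (cases "incseq (\<lambda>n. s (f n))")
    case True
    then show ?thesis using f by (auto simp: comp_def)
  next
    case False
    then have dec: "decseq (\<lambda>n. s (f n))" using f by (simp add: monoseq_iff)
    obtain N where N: "\<And>k. s (f N) \<le> s (f k)"
      using ex_has_least_nat[of "\<lambda>_. True" 0 "\<lambda>n. s (f n)"] by auto
    have const: "s (f k) = s (f N)" if "k \<ge> N" for k
      using N[of k] decseqD[OF dec that] by simp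
    have "strict_mono (\<lambda>k. f (k + N))"
      using f(1) by (simp add: strict_mono_def)
    moreover have "(s \<circ> (\<lambda>k. f (k + N))) k = s (f N)" for k
      unfolding comp_def by (rule const) simp
    then have "incseq (s \<circ> (\<lambda>k. f (k + N)))"
      unfolding incseq_def by (simp only: order_refl) simp
    ultimately show ?thesis by blast
  qed
qed

lemma incseq_subseq_expo:
  fixes a :: "nat \<Rightarrow> expo"
  shows "\<exists>r::nat \<Rightarrow> nat. strict_mono r \<and> (\<forall>i<n. incseq (\<lambda>k. lookup (a (r k)) i))"
proof (induction n)
  case 0
  show ?case by (rule exI[of _ id]) (simp add: strict_mono_def)
next
  case (Suc n)
  then obtain r :: "nat \<Rightarrow> nat" where r: "strict_mono r" "\<forall>i<n. incseq (\<lambda>k. lookup (a (r k)) i)" by blast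
  obtain s :: "nat \<Rightarrow> nat" where s: "strict_mono s" "incseq ((\<lambda>k. lookup (a (r k)) n) \<circ> s)"
    using incseq_subseq_nat by blast
  have "strict_mono (r \<circ> s)" by (rule strict_mono_o) (rule r s)+
  moreover have "incseq (\<lambda>k. lookup (a ((r \<circ> s) k)) i)" if "i < Suc n" for i
  proof (cases "i = n")
    case True
    then show ?thesis using s by (simp add: comp_def)
  next
    case False
    then have "incseq (\<lambda>k. lookup (a (r k)) i)" using r that by simp
    then show ?thesis using s(1) by (simp add: incseq_def strict_mono_less_eq)
  qed
  ultimately show ?case by blast
qed

lemma expo_le_split:
  assumes "\<And>i. lookup \<beta> i \<le> lookup (\<alpha>::expo) i"
  shows "\<exists>\<delta>. \<alpha> = \<beta> + \<delta>"
  by (rule exI[of _ "\<alpha> - \<beta>"]) (intro poly_mapping_eqI, simp add: lookup_add lookup_minus assms)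

text \<open>The finite set consists of the minimal elements for divisibility. An infinite sequence
  of them would have a subsequence increasing in all \<open>n\<close> coordinates, hence two
  comparable members.\<close>

lemma dickson:
  assumes E: "\<And>\<alpha>. \<alpha> \<in> E \<Longrightarrow> keys (\<alpha>::expo) \<subseteq> {..<n}"
  shows "\<exists>B. finite B \<and> B \<subseteq> E \<and> (\<forall>\<alpha>\<in>E. \<exists>\<beta>\<in>B. \<exists>\<delta>. \<alpha> = \<beta> + \<delta>)"
proof -
  define B where "B = {\<beta> \<in> E. \<forall>\<delta> \<epsilon>. \<delta> \<in> E \<and> \<beta> = \<delta> + \<epsilon> \<longrightarrow> \<delta> = \<beta>}"
  have "finite B"
  proof (rule ccontr)
    assume "infinite B"
    then obtain a :: "nat \<Rightarrow> expo" where a: "inj a" "range a \<subseteq> B"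
      using infinite_countable_subset by blast
    obtain r :: "nat \<Rightarrow> nat" where r: "strict_mono r" "\<forall>i<n. incseq (\<lambda>k. lookup (a (r k)) i)"
      using incseq_subseq_expo by blast
    have "lookup (a (r 0)) i \<le> lookup (a (r 1)) i" for i
    proof (cases "i < n")
      case True
      then show ?thesis using r(2) by (simp add: incseq_def)
    next
      case False
      then have "i \<notin> keys (a (r 0))" using E[of "a (r 0)"] a(2) by (auto simp: B_def)
      then show ?thesis by (simp add: in_keys_iff)
    qed
    then obtain \<delta> where "a (r 1) = a (r 0) + \<delta>" using expo_le_split by blast
    moreover have "a (r 1) \<in> B" "a (r 0) \<in> E" using a(2) by (auto simp: B_def)
    ultimately have "a (r 0) = a (r 1)" unfolding B_def by blast
    then have "r 0 = r 1" using a(1) by (auto dest: injD)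
    then show False using strict_monoD[OF r(1), of 0 1] by simp
  qed
  moreover have "\<exists>\<beta>\<in>B. \<exists>\<delta>. \<alpha> = \<beta> + \<delta>" if "\<alpha> \<in> E" for \<alpha>
    using that
  proof (induction "mdeg \<alpha>" arbitrary: \<alpha> rule: less_induct)
    case less
    show ?case
    proof (cases "\<alpha> \<in> B")
      case True
      then show ?thesis by (metis add.right_neutral)
    next
      case False
      then obtain \<delta> \<epsilon> where \<delta>: "\<delta> \<in> E" "\<alpha> = \<delta> + \<epsilon>" "\<delta> \<noteq> \<alpha>" using less.prems by (auto simp: B_def)
      then have "\<epsilon> \<noteq> 0" by auto
      then have "mdeg \<delta> < mdeg \<alpha>" using \<delta> mdeg_eq_0_iff[of \<epsilon>] by simp
      then obtain \<beta> \<gamma> where "\<beta> \<in> B" "\<delta> = \<beta> + \<gamma>" using less.hyps \<delta> by blast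
      then show ?thesis using \<delta>(2) by (metis add.assoc)
    qed
  qed
  ultimately show ?thesis unfolding B_def by blast
qed

subsection \<open>Locally finite geometric sums\<close>

text \<open>Only the terms before \<open>L \<alpha>\<close> contribute to the coefficient of
  \<alpha>, so the infinite sum involves no convergence of coefficients.\<close>

definition lfsum :: "(expo \<Rightarrow> nat) \<Rightarrow> (nat \<Rightarrow> pseries) \<Rightarrow> pseries"
  where "lfsum L u = Ser (\<lambda>\<alpha>. \<Sum>k<L \<alpha>. cf (u k) \<alpha>)"

lemma cf_lfsum:
  assumes "\<And>k \<alpha>. L \<alpha> \<le> k \<Longrightarrow> cf (u k) \<alpha> = 0" "L \<alpha> \<le> K"
  shows "cf (lfsum L u) \<alpha> = (\<Sum>k<K. cf (u k) \<alpha>)"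
  unfolding lfsum_def cf_Ser by (rule sum.mono_neutral_left) (use assms in auto)

lemma nb_lfsum:
  assumes van: "\<And>k \<alpha>. L \<alpha> \<le> k \<Longrightarrow> cf (u k) \<alpha> = 0" and u: "\<And>k. nb \<rho> (u k) (M * (1/2) ^ k)"
    and \<rho>: "\<And>i. 0 \<le> \<rho> i"
  shows "nb \<rho> (lfsum L u) (2 * M)"
  unfolding nb_def
proof (intro allI impI)
  fix A :: "expo set" assume A: "finite A"
  define K where "K = Max (insert 0 (L ` A))"
  have M: "0 \<le> M" using nb_nonneg[OF u[of 0]] by simp
  have "(\<Sum>\<alpha>\<in>A. cmod (cf (lfsum L u) \<alpha>) * mpow \<rho> \<alpha>) \<le> (\<Sum>\<alpha>\<in>A. \<Sum>k<K. cmod (cf (u k) \<alpha>) * mpow \<rho> \<alpha>)"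
  proof (rule sum_mono)
    fix \<alpha> assume "\<alpha> \<in> A"
    then have "L \<alpha> \<le> K" using A by (simp add: K_def)
    then have "cf (lfsum L u) \<alpha> = (\<Sum>k<K. cf (u k) \<alpha>)" by (intro cf_lfsum van)
    then have "cmod (cf (lfsum L u) \<alpha>) \<le> (\<Sum>k<K. cmod (cf (u k) \<alpha>))" by (simp add: norm_sum)
    then show "cmod (cf (lfsum L u) \<alpha>) * mpow \<rho> \<alpha> \<le> (\<Sum>k<K. cmod (cf (u k) \<alpha>) * mpow \<rho> \<alpha>)"
      unfolding sum_distrib_right[symmetric] by (intro mult_right_mono mpow_nonneg \<rho>)
  qed
  also have "\<dots> = (\<Sum>k<K. \<Sum>\<alpha>\<in>A. cmod (cf (u k) \<alpha>) * mpow \<rho> \<alpha>)" by (rule sum.swap)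
  also have "\<dots> \<le> (\<Sum>k<K. M * (1/2) ^ k)" by (intro sum_mono nbD[OF u] A)
  also have "\<dots> = M * (\<Sum>k<K. (1/2) ^ k)" by (simp add: sum_distrib_left)
  also have "\<dots> \<le> M * 2" by (intro mult_left_mono M) (simp add: sum_gp_strict power_le_one)
  finally show "(\<Sum>\<alpha>\<in>A. cmod (cf (lfsum L u) \<alpha>) * mpow \<rho> \<alpha>) \<le> 2 * M" by (simp add: mult.commute)
qed

subsection \<open>The division theorem\<close>

text \<open>A monomial divisible by some \<beta> is traded for the tail of \<open>g \<beta>\<close>,
  which has larger weight. In each coefficient this ends, because weights are integers. For large
  \<sigma> the tails are so small that the norms decrease geometrically, so quotients and remainder
  converge.\<close>

lemma division:
  assumes B: "finite B" and gC: "\<And>\<beta>. \<beta> \<in> B \<Longrightarrow> g \<beta> \<in> C n"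
    and g1: "\<And>\<beta>. \<beta> \<in> B \<Longrightarrow> cf (g \<beta>) \<beta> = 1"
    and gw: "\<And>\<beta> \<alpha>. \<beta> \<in> B \<Longrightarrow> cf (g \<beta>) \<alpha> \<noteq> 0 \<Longrightarrow> wgt \<beta> \<le> wgt \<alpha>"
    and f: "f \<in> C n"
  shows "\<exists>q s. f = s + (\<Sum>\<beta>\<in>B. g \<beta> * q \<beta>) \<and> (\<forall>\<beta>\<in>B. q \<beta> \<in> C n) \<and> s \<in> C n \<and>
    (\<forall>\<alpha>. cf s \<alpha> \<noteq> 0 \<longrightarrow> (\<forall>\<beta>\<in>B. \<forall>\<delta>. \<alpha> \<noteq> \<beta> + \<delta>))"
proof -
  \<comment> \<open>Each divisible monomial is assigned to one element of \<open>B\<close>, so that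
    the series \<open>xpow \<beta> * Q \<beta> h\<close> have disjoint supports.\<close>
  define sel where "sel \<alpha> = (if \<exists>\<beta>\<in>B. \<exists>\<delta>. \<alpha> = \<beta> + \<delta> then Some (SOME \<beta>. \<beta> \<in> B \<and> (\<exists>\<delta>. \<alpha> = \<beta> + \<delta>)) else None)" for \<alpha>
  have selS: "\<beta> \<in> B \<and> (\<exists>\<delta>. \<alpha> = \<beta> + \<delta>)" if *: "sel \<alpha> = Some \<beta>" for \<alpha> \<beta>
  proof -
    have ex: "\<exists>\<beta>\<in>B. \<exists>\<delta>. \<alpha> = \<beta> + \<delta>"
      by (rule ccontr) (use * in \<open>simp add: sel_def\<close>)
    have eq: "\<beta> = (SOME \<beta>. \<beta> \<in> B \<and> (\<exists>\<delta>. \<alpha> = \<beta> + \<delta>))"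
      using * unfolding sel_def if_P[OF ex] by simp
    show ?thesis unfolding eq by (rule someI_ex) (use ex in blast)
  qed
  have selN: "sel \<alpha> = None \<Longrightarrow> \<beta> \<in> B \<Longrightarrow> \<alpha> \<noteq> \<beta> + \<delta>" for \<alpha> \<beta> \<delta>
    unfolding sel_def by (auto split: if_splits)
  define R where "R h = Ser (\<lambda>\<alpha>. if sel \<alpha> = None then cf h \<alpha> else 0)" for h
  define Q where "Q \<beta> h = Ser (\<lambda>\<delta>. if sel (\<beta> + \<delta>) = Some \<beta> then cf h (\<beta> + \<delta>) else 0)" for \<beta> h
  \<comment> \<open>What is left of \<open>h\<close> once the remainder \<open>R h\<close> is split
    off and the divisible part is written with \<open>g \<beta>\<close> in place of
    \<open>xpow \<beta>\<close>.\<close>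
  define T where "T h = (\<Sum>\<beta>\<in>B. (xpow \<beta> - g \<beta>) * Q \<beta> h)" for h
  define F where "F k = (T ^^ k) f" for k
  have FS: "F (Suc k) = T (F k)" and F0: "F 0 = f" for k by (simp_all add: F_def)
  have decomp: "h = R h + (\<Sum>\<beta>\<in>B. xpow \<beta> * Q \<beta> h)" for h
  proof (rule pseries_eqI)
    fix \<alpha>
    have mon: "cf (xpow \<beta> * Q \<beta> h) \<alpha> = (if sel \<alpha> = Some \<beta> then cf h \<alpha> else 0)" for \<beta>
    proof (cases "\<exists>\<delta>. \<alpha> = \<beta> + \<delta>")
      case True
      then show ?thesis by (auto simp: cf_xpow_mult Q_def)
    next
      case False
      then have "sel \<alpha> \<noteq> Some \<beta>" using selS by blast
      then show ?thesis using False by (simp add: cf_xpow_mult_0)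
    qed
    show "cf h \<alpha> = cf (R h + (\<Sum>\<beta>\<in>B. xpow \<beta> * Q \<beta> h)) \<alpha>"
    proof (cases "sel \<alpha>")
      case None
      then show ?thesis by (simp add: mon R_def)
    next
      case (Some \<gamma>)
      then have "\<gamma> \<in> B" using selS by blast
      then show ?thesis using B Some by (simp add: mon R_def)
    qed
  qed
  have step: "h = R h + (\<Sum>\<beta>\<in>B. g \<beta> * Q \<beta> h) + T h" for h
  proof -
    have "(\<Sum>\<beta>\<in>B. xpow \<beta> * Q \<beta> h) = (\<Sum>\<beta>\<in>B. g \<beta> * Q \<beta> h) + T h"
      unfolding T_def sum.distrib[symmetric] by (rule sum.cong) (auto simp: algebra_simps)
    then show ?thesis using decomp[of h] by (simp add: add.assoc)
  qed
  have tele: "f = (\<Sum>k<K. R (F k) + (\<Sum>\<beta>\<in>B. g \<beta> * Q \<beta> (F k))) + F K" for K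
  proof (induction K)
    case (Suc K)
    then show ?case using step[of "F K"] by (simp add: FS add.assoc)
  qed (simp add: F0)
  have gt: "wgt \<beta> < wgt \<alpha>" if "\<beta> \<in> B" "cf (xpow \<beta> - g \<beta>) \<alpha> \<noteq> 0" for \<beta> \<alpha>
  proof -
    have "\<alpha> \<noteq> \<beta>" using that g1 by (auto simp: cf_xpow)
    then have "wgt \<beta> \<le> wgt \<alpha>" using that gw[OF that(1), of \<alpha>] by (auto simp: cf_xpow)
    moreover have "wgt \<beta> \<noteq> wgt \<alpha>" using \<open>\<alpha> \<noteq> \<beta>\<close> wgt_inj by blast
    ultimately show ?thesis by simp
  qed
  \<comment> \<open>Each application of \<open>T\<close> trades monomials for ones of larger weight,
    and the weights start at 1.\<close>
  have van: "cf (F k) \<alpha> = 0" if "wgt \<alpha> \<le> k" for k \<alpha>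
    using that
  proof (induction k arbitrary: \<alpha>)
    case 0
    then show ?case using wgt_pos[of \<alpha>] by simp
  next
    case (Suc k)
    have "cf ((xpow \<beta> - g \<beta>) * Q \<beta> (F k)) \<alpha> = 0" if \<beta>: "\<beta> \<in> B" for \<beta>
      unfolding cf_mult
    proof (rule sum.neutral, safe)
      fix a \<delta> assume \<alpha>: "\<alpha> = a + \<delta>"
      show "cf (xpow \<beta> - g \<beta>) a * cf (Q \<beta> (F k)) \<delta> = 0"
      proof (cases "cf (xpow \<beta> - g \<beta>) a = 0")
        case False
        then have "wgt \<beta> < wgt a" using \<beta> gt by blast
        then have "wgt (\<beta> + \<delta>) < wgt \<alpha>" by (simp add: wgt_add \<alpha> wgt_pos)
        then have "cf (F k) (\<beta> + \<delta>) = 0" using Suc by simp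
        then show ?thesis by (simp add: Q_def)
      qed simp
    qed
    then show ?case by (simp add: FS T_def)
  qed
  have keysB: "keys \<beta> \<subseteq> {..<n}" if "\<beta> \<in> B" for \<beta>
    using C_in_vars[OF gC[OF that]] g1[OF that] unfolding in_vars_def by auto
  have ivR: "in_vars n (cf (R h))" if "in_vars n (cf h)" for h
    using that by (auto simp: in_vars_def R_def)
  have ivQ: "in_vars n (cf (Q \<beta> h))" if "in_vars n (cf h)" for \<beta> h
    using that by (fastforce simp: in_vars_def Q_def keys_add_nat split: if_splits)
  have in_vars_sum: "in_vars n (cf (sum u A))" if "\<And>x. x \<in> A \<Longrightarrow> in_vars n (cf (u x))" for u :: "expo \<Rightarrow> pseries" and A
    using that by (induction A rule: infinite_finite_induct) (auto intro: in_vars_add C_in_vars[OF C_0])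
  have ivF: "in_vars n (cf (F k))" for k
  proof (induction k)
    case 0
    then show ?case by (simp add: F0 C_in_vars[OF f])
  next
    case (Suc k)
    then show ?case unfolding FS T_def
      by (intro in_vars_sum in_vars_mult ivQ) (auto intro!: C_in_vars C_diff C_xpow gC keysB)
  qed
  \<comment> \<open>\<open>T\<close> has \<open>card B\<close> summands, each of norm at most
    \<open>c\<close> times that of the argument, so this value makes \<open>T\<close> a contraction
    by 1/2. Adding 1 covers the empty \<open>B\<close>.\<close>
  define c where "c = 1 / (2 * (real (card B) + 1))"
  have c: "c > 0" by (simp add: c_def add_pos_nonneg)
  have "eventually (\<lambda>\<sigma>. \<forall>\<beta>\<in>B. nb (rad \<sigma>) (xpow \<beta> - g \<beta>) (c * mpow (rad \<sigma>) \<beta>)) sequentially"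
    using gt c by (intro eventually_ball_finite[OF B] ballI eventually_nb_tail[where n = n])
      (auto intro!: C_diff C_xpow gC dest: keysB)
  then have "eventually (\<lambda>\<sigma>. (\<forall>\<beta>\<in>B. nb (rad \<sigma>) (xpow \<beta> - g \<beta>) (c * mpow (rad \<sigma>) \<beta>)) \<and> (\<exists>M. nb (rad \<sigma>) f M)) sequentially"
    using C_eventually_nb_rad[OF f] by eventually_elim blast
  then obtain \<sigma> M where tail: "\<And>\<beta>. \<beta> \<in> B \<Longrightarrow> nb (rad \<sigma>) (xpow \<beta> - g \<beta>) (c * mpow (rad \<sigma>) \<beta>)"
      and M: "nb (rad \<sigma>) f M"
    using eventually_happens[of _ sequentially] by fastforce
  have wpos: "mpow (rad \<sigma>) \<alpha> > 0" for \<alpha> by (simp add: mpow_rad wgt_pos)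
  \<comment> \<open>Dividing by \<open>xpow \<beta>\<close> costs the factor
    \<open>1 / mpow (rad \<sigma>) \<beta>\<close>, which the bound \<open>tail\<close> compensates
    exactly.\<close>
  have nbQ: "nb (rad \<sigma>) (Q \<beta> h) (N / mpow (rad \<sigma>) \<beta>)" if "nb (rad \<sigma>) h N" for \<beta> h N
    unfolding nb_def
  proof (intro allI impI)
    fix A :: "expo set" assume A: "finite A"
    have "(\<Sum>\<delta>\<in>A. cmod (cf (Q \<beta> h) \<delta>) * mpow (rad \<sigma>) \<delta>)
        \<le> (\<Sum>\<delta>\<in>A. (cmod (cf h (\<beta> + \<delta>)) * mpow (rad \<sigma>) (\<beta> + \<delta>)) / mpow (rad \<sigma>) \<beta>)"
      using wpos[of \<beta>] by (intro sum_mono) (auto simp: Q_def mpow_add intro!: mult_nonneg_nonneg less_imp_le[OF wpos])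
    also have "\<dots> = (\<Sum>\<delta>\<in>A. cmod (cf h (\<beta> + \<delta>)) * mpow (rad \<sigma>) (\<beta> + \<delta>)) / mpow (rad \<sigma>) \<beta>"
      by (simp add: sum_divide_distrib)
    also have "(\<Sum>\<delta>\<in>A. cmod (cf h (\<beta> + \<delta>)) * mpow (rad \<sigma>) (\<beta> + \<delta>)) = (\<Sum>\<alpha>\<in>(+) \<beta> ` A. cmod (cf h \<alpha>) * mpow (rad \<sigma>) \<alpha>)"
      by (subst sum.reindex) (auto simp: inj_on_def)
    also have "\<dots> / mpow (rad \<sigma>) \<beta> \<le> N / mpow (rad \<sigma>) \<beta>"
      using wpos[of \<beta>] A by (intro divide_right_mono nbD[OF that]) auto
    finally show "(\<Sum>\<delta>\<in>A. cmod (cf (Q \<beta> h) \<delta>) * mpow (rad \<sigma>) \<delta>) \<le> N / mpow (rad \<sigma>) \<beta>" .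
  qed
  have nbR: "nb (rad \<sigma>) (R h) N" if "nb (rad \<sigma>) h N" for h N
    unfolding nb_def
  proof (intro allI impI)
    fix A :: "expo set" assume A: "finite A"
    have "(\<Sum>\<delta>\<in>A. cmod (cf (R h) \<delta>) * mpow (rad \<sigma>) \<delta>) \<le> (\<Sum>\<delta>\<in>A. cmod (cf h \<delta>) * mpow (rad \<sigma>) \<delta>)"
      by (intro sum_mono mult_right_mono less_imp_le[OF wpos]) (auto simp: R_def)
    also have "\<dots> \<le> N" by (rule nbD[OF that A])
    finally show "(\<Sum>\<delta>\<in>A. cmod (cf (R h) \<delta>) * mpow (rad \<sigma>) \<delta>) \<le> N" .
  qed
  have nbT: "nb (rad \<sigma>) (T h) (N * (1/2))" if N: "nb (rad \<sigma>) h N" for h N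
  proof -
    have "nb (rad \<sigma>) (T h) (\<Sum>\<beta>\<in>B. (c * mpow (rad \<sigma>) \<beta>) * (N / mpow (rad \<sigma>) \<beta>))"
      unfolding T_def by (intro nb_sum nb_mult tail nbQ N rad_nonneg)
    moreover have "(\<Sum>\<beta>\<in>B. (c * mpow (rad \<sigma>) \<beta>) * (N / mpow (rad \<sigma>) \<beta>)) = (\<Sum>\<beta>\<in>B. c * N)"
      using wpos by (intro sum.cong) (auto simp: less_imp_neq[symmetric])
    moreover have "(\<Sum>\<beta>\<in>B. c * N) = (real (card B) * c) * N" by simp
    moreover have "(real (card B) * c) * N \<le> (1/2) * N"
      by (intro mult_right_mono nb_nonneg[OF N]) (simp add: c_def field_simps)
    ultimately show ?thesis by (auto intro: nb_weaken simp: mult.commute)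
  qed
  have nbF: "nb (rad \<sigma>) (F k) (M * (1/2) ^ k)" for k
  proof (induction k)
    case 0
    then show ?case by (simp add: F0 M)
  next
    case (Suc k)
    from nbT[OF this] show ?case by (simp add: FS mult_ac)
  qed
  define s where "s = lfsum wgt (\<lambda>k. R (F k))"
  \<comment> \<open>Coefficient \<delta> of \<open>Q \<beta> h\<close> is taken from coefficient
    \<open>\<beta> + \<delta>\<close> of \<open>h\<close>, so it is settled after
    \<open>wgt (\<beta> + \<delta>)\<close> steps.\<close>
  define q where "q \<beta> = lfsum (\<lambda>\<delta>. wgt (\<beta> + \<delta>)) (\<lambda>k. Q \<beta> (F k))" for \<beta>
  have vanR: "cf (R (F k)) \<alpha> = 0" if "wgt \<alpha> \<le> k" for k \<alpha> using van[OF that] by (simp add: R_def)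
  have vanQ: "cf (Q \<beta> (F k)) \<delta> = 0" if "wgt (\<beta> + \<delta>) \<le> k" for k \<beta> \<delta> using van[OF that] by (simp add: Q_def)
  have "s \<in> C n"
  proof (rule C_if_nb_rad)
    show "nb (rad \<sigma>) s (2 * M)"
      unfolding s_def by (intro nb_lfsum vanR nbR nbF rad_nonneg)
    show "in_vars n (cf s)"
      using ivR[OF ivF] unfolding s_def lfsum_def in_vars_def
      by (auto elim!: sum.not_neutral_contains_not_neutral)
  qed
  moreover have "q \<beta> \<in> C n" for \<beta>
  proof (rule C_if_nb_rad)
    have "nb (rad \<sigma>) (Q \<beta> (F k)) ((M / mpow (rad \<sigma>) \<beta>) * (1/2) ^ k)" for k
      using nbQ[OF nbF[of k], of \<beta>] by simp
    then show "nb (rad \<sigma>) (q \<beta>) (2 * (M / mpow (rad \<sigma>) \<beta>))"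
      unfolding q_def by (intro nb_lfsum vanQ rad_nonneg)
    show "in_vars n (cf (q \<beta>))"
      using ivQ[OF ivF] unfolding q_def lfsum_def in_vars_def
      by (auto elim!: sum.not_neutral_contains_not_neutral)
  qed
  moreover have "\<forall>\<beta>\<in>B. \<forall>\<delta>. \<alpha> \<noteq> \<beta> + \<delta>" if "cf s \<alpha> \<noteq> 0" for \<alpha>
  proof -
    have "sel \<alpha> = None"
    proof (rule ccontr)
      assume "sel \<alpha> \<noteq> None"
      then have "cf s \<alpha> = 0" unfolding s_def lfsum_def by (simp add: R_def del: not_None_eq)
      then show False using that by simp
    qed
    then show ?thesis using selN by blast
  qed
  moreover have "f = s + (\<Sum>\<beta>\<in>B. g \<beta> * q \<beta>)"
  proof (rule pseries_eqI)
    fix \<alpha>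
    \<comment> \<open>Later steps contribute nothing to the coefficient of \<alpha>, and the
      telescoped remainder \<open>F ?K\<close> vanishes there.\<close>
    let ?K = "wgt \<alpha>"
    have s: "cf s \<alpha> = (\<Sum>k<?K. cf (R (F k)) \<alpha>)"
      unfolding s_def by (intro cf_lfsum vanR) auto
    have q: "cf (g \<beta> * q \<beta>) \<alpha> = (\<Sum>k<?K. cf (g \<beta> * Q \<beta> (F k)) \<alpha>)" if \<beta>: "\<beta> \<in> B" for \<beta>
    proof -
      have "cf (g \<beta> * q \<beta>) \<alpha> = (\<Sum>(a, \<delta>) | a + \<delta> = \<alpha>. \<Sum>k<?K. cf (g \<beta>) a * cf (Q \<beta> (F k)) \<delta>)"
        unfolding cf_mult
      proof (rule sum.cong[OF refl], safe)
        fix a \<delta> assume \<alpha>: "\<alpha> = a + \<delta>"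
        show "cf (g \<beta>) a * cf (q \<beta>) \<delta> = (\<Sum>k<wgt (a + \<delta>). cf (g \<beta>) a * cf (Q \<beta> (F k)) \<delta>)"
        proof (cases "cf (g \<beta>) a = 0")
          case False
          then have "wgt \<beta> \<le> wgt a" using gw[OF \<beta>] by blast
          then have "wgt (\<beta> + \<delta>) \<le> wgt (a + \<delta>)" by (simp add: wgt_add)
          then have "cf (q \<beta>) \<delta> = (\<Sum>k<wgt (a + \<delta>). cf (Q \<beta> (F k)) \<delta>)"
            unfolding q_def by (intro cf_lfsum vanQ)
          then show ?thesis by (simp add: sum_distrib_left)
        qed simp
      qed
      also have "\<dots> = (\<Sum>k<?K. cf (g \<beta> * Q \<beta> (F k)) \<alpha>)"
        unfolding cf_mult case_prod_unfold by (rule sum.swap)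
      finally show ?thesis .
    qed
    have "cf f \<alpha> = (\<Sum>k<?K. cf (R (F k)) \<alpha> + (\<Sum>\<beta>\<in>B. cf (g \<beta> * Q \<beta> (F k)) \<alpha>)) + cf (F ?K) \<alpha>"
      by (subst tele[of ?K]) simp
    also have "\<dots> = cf s \<alpha> + (\<Sum>k<?K. \<Sum>\<beta>\<in>B. cf (g \<beta> * Q \<beta> (F k)) \<alpha>)"
      by (simp add: van sum.distrib s)
    also have "(\<Sum>k<?K. \<Sum>\<beta>\<in>B. cf (g \<beta> * Q \<beta> (F k)) \<alpha>) = (\<Sum>\<beta>\<in>B. cf (g \<beta> * q \<beta>) \<alpha>)"
      by (subst sum.swap) (simp add: q)
    finally show "cf f \<alpha> = cf (s + (\<Sum>\<beta>\<in>B. g \<beta> * q \<beta>)) \<alpha>" by simp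
  qed
  ultimately show ?thesis by blast
qed

subsection \<open>Ideals\<close>

text \<open>Closure under negatives comes from multiplication by -1.\<close>

definition isid :: "nat \<Rightarrow> pseries set \<Rightarrow> bool"
  where "isid n I \<longleftrightarrow> I \<subseteq> C n \<and> 0 \<in> I \<and> (\<forall>f\<in>I. \<forall>g\<in>I. f + g \<in> I) \<and> (\<forall>a\<in>C n. \<forall>f\<in>I. a * f \<in> I)"

lemma isidI:
  assumes "I \<subseteq> C n" "0 \<in> I" "\<And>f g. f \<in> I \<Longrightarrow> g \<in> I \<Longrightarrow> f + g \<in> I"
    "\<And>a f. a \<in> C n \<Longrightarrow> f \<in> I \<Longrightarrow> a * f \<in> I"
  shows "isid n I"
  using assms by (auto simp: isid_def)

lemma isid_subset: "isid n I \<Longrightarrow> f \<in> I \<Longrightarrow> f \<in> C n"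
  by (auto simp: isid_def)

lemma isid_0: "isid n I \<Longrightarrow> 0 \<in> I"
  by (auto simp: isid_def)

lemma isid_add: "isid n I \<Longrightarrow> f \<in> I \<Longrightarrow> g \<in> I \<Longrightarrow> f + g \<in> I"
  by (auto simp: isid_def)

lemma isid_mult: "isid n I \<Longrightarrow> a \<in> C n \<Longrightarrow> f \<in> I \<Longrightarrow> a * f \<in> I"
  by (auto simp: isid_def)

lemma isid_scl: "isid n I \<Longrightarrow> f \<in> I \<Longrightarrow> scl c f \<in> I"
  using isid_mult[of n I "scl c 1" f] by (simp add: C_scl scl_mult_left)

lemma isid_uminus: "isid n I \<Longrightarrow> f \<in> I \<Longrightarrow> - f \<in> I"
  using isid_mult[of n I "- 1" f] by (simp add: C_uminus)

lemma isid_diff: "isid n I \<Longrightarrow> f \<in> I \<Longrightarrow> g \<in> I \<Longrightarrow> f - g \<in> I"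
  using isid_add[of n I f "- g"] isid_uminus by simp

lemma isid_sum: "isid n I \<Longrightarrow> (\<And>x. x \<in> A \<Longrightarrow> f x \<in> I) \<Longrightarrow> sum f A \<in> I"
  by (induction A rule: infinite_finite_induct) (auto intro: isid_0 isid_add)

section \<open>Initial monomials and Krull's intersection theorem\<close>

definition inx :: "pseries \<Rightarrow> expo"
  where "inx f = (ARG_MIN wgt \<alpha>. cf f \<alpha> \<noteq> 0)"

lemma inx:
  assumes "f \<noteq> 0"
  shows "cf f (inx f) \<noteq> 0" "cf f \<alpha> \<noteq> 0 \<Longrightarrow> wgt (inx f) \<le> wgt \<alpha>"
proof -
  obtain \<beta> where \<beta>: "cf f \<beta> \<noteq> 0" using assms pseries_eqI[of f 0] by auto
  show "cf f (inx f) \<noteq> 0" unfolding inx_def by (rule arg_min_natI[where P = "\<lambda>\<alpha>. cf f \<alpha> \<noteq> 0", OF \<beta>])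
  show "cf f \<alpha> \<noteq> 0 \<Longrightarrow> wgt (inx f) \<le> wgt \<alpha>"
    unfolding inx_def by (rule arg_min_nat_le[where P = "\<lambda>\<alpha>. cf f \<alpha> \<noteq> 0"])
qed

text \<open>Divide \<open>f\<close> by finitely many elements of \<open>I\<close> whose initial
  monomials divide all initial monomials of \<open>I\<close>. If the remainder \<open>s\<close> were
  nonzero, some element of \<open>I\<close> would agree with \<open>s\<close> up to the weight of
  the initial monomial of \<open>s\<close>. This monomial would then be initial in \<open>I\<close>,
  although no monomial of \<open>s\<close> is divisible by such a one.\<close>

theorem krull:
  assumes I: "isid n I" and f: "f \<in> C n" and close: "\<And>k. \<exists>g\<in>I. ordge k (f - g)"
  shows "f \<in> I"
proof -
  define E where "E = inx ` (I - {0})"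
  have "keys \<alpha> \<subseteq> {..<n}" if "\<alpha> \<in> E" for \<alpha>
    using that inx(1) C_in_vars[OF isid_subset[OF I]] unfolding E_def in_vars_def by blast
  from dickson[of E n, OF this] obtain B where B: "finite B" "B \<subseteq> E" "\<forall>\<alpha>\<in>E. \<exists>\<beta>\<in>B. \<exists>\<delta>. \<alpha> = \<beta> + \<delta>"
    by blast
  have "\<exists>h. h \<in> I \<and> cf h \<beta> = 1 \<and> (\<forall>\<alpha>. cf h \<alpha> \<noteq> 0 \<longrightarrow> wgt \<beta> \<le> wgt \<alpha>)" if "\<beta> \<in> B" for \<beta>
  proof -
    have "\<beta> \<in> inx ` (I - {0})" using that B(2) by (auto simp: E_def)
    then obtain h where h: "h \<in> I" "h \<noteq> 0" "\<beta> = inx h" by blast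
    then show ?thesis
      using inx[OF h(2)] by (intro exI[of _ "scl (1 / cf h \<beta>) h"]) (auto intro: isid_scl[OF I])
  qed
  then obtain g where g: "\<And>\<beta>. \<beta> \<in> B \<Longrightarrow> g \<beta> \<in> I" "\<And>\<beta>. \<beta> \<in> B \<Longrightarrow> cf (g \<beta>) \<beta> = 1"
      "\<And>\<beta> \<alpha>. \<beta> \<in> B \<Longrightarrow> cf (g \<beta>) \<alpha> \<noteq> 0 \<Longrightarrow> wgt \<beta> \<le> wgt \<alpha>"
    by metis
  obtain q s where q: "f = s + (\<Sum>\<beta>\<in>B. g \<beta> * q \<beta>)" "\<forall>\<beta>\<in>B. q \<beta> \<in> C n" "s \<in> C n"
     "\<forall>\<alpha>. cf s \<alpha> \<noteq> 0 \<longrightarrow> (\<forall>\<beta>\<in>B. \<forall>\<delta>. \<alpha> \<noteq> \<beta> + \<delta>)"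
    using division[OF B(1) isid_subset[OF I g(1)] g(2,3) f] by blast
  have qI: "(\<Sum>\<beta>\<in>B. g \<beta> * q \<beta>) \<in> I"
    using g q(2) by (intro isid_sum[OF I]) (simp add: mult.commute[of "g _"] isid_mult[OF I])
  have "s = 0"
  proof (rule ccontr)
    assume s: "s \<noteq> 0"
    define \<alpha>0 where "\<alpha>0 = inx s"
    \<comment> \<open>Agreement in degrees below \<open>wgt \<alpha>0\<close> reaches all monomials
      of weight at most \<open>wgt \<alpha>0\<close>, since the degree of a monomial is smaller than
      its weight.\<close>
    obtain g0 where g0: "g0 \<in> I" "ordge (wgt \<alpha>0) (f - g0)" using close by blast
    define g1 where "g1 = g0 - (\<Sum>\<beta>\<in>B. g \<beta> * q \<beta>)"
    have g1: "g1 \<in> I" unfolding g1_def by (intro isid_diff[OF I] g0 qI)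
    have eq: "cf g1 \<alpha> = cf s \<alpha>" if "wgt \<alpha> \<le> wgt \<alpha>0" for \<alpha>
    proof -
      have "2 ^ mdeg \<alpha> \<le> wgt \<alpha>0" using wgt_ge[of \<alpha>] that by simp
      then have "mdeg \<alpha> < wgt \<alpha>0" using less_exp[of "mdeg \<alpha>"] by linarith
      then have "cf (f - g0) \<alpha> = 0" using g0(2) by (rule ordgeD[rotated])
      then show ?thesis by (subst (asm) q(1)) (auto simp: g1_def diff_eq_eq)
    qed
    have "cf g1 \<alpha>0 \<noteq> 0" using eq[of \<alpha>0] inx(1)[OF s] by (simp add: \<alpha>0_def)
    then have g1n: "g1 \<noteq> 0" by auto
    have "wgt (inx g1) \<le> wgt \<alpha>0" using inx(2)[OF g1n] \<open>cf g1 \<alpha>0 \<noteq> 0\<close> by blast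
    then have "cf s (inx g1) \<noteq> 0" using eq inx(1)[OF g1n] by metis
    then have "inx g1 = \<alpha>0"
      using inx(2)[OF s] \<open>wgt (inx g1) \<le> wgt \<alpha>0\<close> by (auto simp: \<alpha>0_def intro!: wgt_inj antisym)
    then have "\<alpha>0 \<in> E" using g1 g1n by (auto simp: E_def)
    then show False using B(3) q(4) inx(1)[OF s] unfolding \<alpha>0_def by metis
  qed
  then show ?thesis using q(1) qI by simp
qed

subsection \<open>Operations on ideals\<close>

definition idgen :: "nat \<Rightarrow> pseries set \<Rightarrow> pseries set"
  where "idgen n F = \<Inter>{I. isid n I \<and> F \<subseteq> I}"

lemma isid_C: "isid n (C n)"
  by (rule isidI) (auto intro: C_add C_mult)

lemma isid_idgen:
  assumes "F \<subseteq> C n"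
  shows "isid n (idgen n F)"
  unfolding idgen_def
proof (rule isidI)
  show "\<Inter>{I. isid n I \<and> F \<subseteq> I} \<subseteq> C n"
    by (rule Inter_lower) (simp add: assms isid_C)
qed (auto intro: isid_0 isid_add isid_mult)

lemma idgen_superset: "F \<subseteq> idgen n F"
  by (auto simp: idgen_def)

lemma idgen_least: "isid n I \<Longrightarrow> F \<subseteq> I \<Longrightarrow> idgen n F \<subseteq> I"
  by (auto simp: idgen_def)

text \<open>The \<open>k\<close>-th power of the maximal ideal, described by orders of vanishing so
  that no products of ideals are needed.\<close>

definition Mid :: "nat \<Rightarrow> nat \<Rightarrow> pseries set"
  where "Mid n k = {f \<in> C n. ordge k f}"

lemma isid_Mid: "isid n (Mid n k)"
  by (rule isidI) (auto simp: Mid_def intro: C_add C_mult ordge_add ordge_mult_right)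

definition idsum :: "pseries set \<Rightarrow> pseries set \<Rightarrow> pseries set"
  where "idsum I J = {f + g | f g. f \<in> I \<and> g \<in> J}"

lemma isid_idsum:
  assumes I: "isid n I" and J: "isid n J"
  shows "isid n (idsum I J)"
proof (rule isidI)
  show "idsum I J \<subseteq> C n"
    using isid_subset[OF I] isid_subset[OF J] by (auto simp: idsum_def intro: C_add)
  show "0 \<in> idsum I J"
    using isid_0[OF I] isid_0[OF J] unfolding idsum_def by force
next
  fix f g assume "f \<in> idsum I J" "g \<in> idsum I J"
  then obtain f1 f2 g1 g2 where *: "f = f1 + f2" "g = g1 + g2" "f1 \<in> I" "f2 \<in> J" "g1 \<in> I" "g2 \<in> J"
    by (auto simp: idsum_def)
  then have "f + g = (f1 + g1) + (f2 + g2)" "f1 + g1 \<in> I" "f2 + g2 \<in> J"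
    by (auto intro: isid_add[OF I] isid_add[OF J])
  then show "f + g \<in> idsum I J" unfolding idsum_def by blast
next
  fix a f assume "a \<in> C n" "f \<in> idsum I J"
  then obtain f1 f2 where *: "f = f1 + f2" "f1 \<in> I" "f2 \<in> J" by (auto simp: idsum_def)
  then have "a * f = a * f1 + a * f2" "a * f1 \<in> I" "a * f2 \<in> J"
    using \<open>a \<in> C n\<close> by (auto simp: ring_distribs intro: isid_mult[OF I] isid_mult[OF J])
  then show "a * f \<in> idsum I J" unfolding idsum_def by blast
qed

lemma idsum_left: "isid n J \<Longrightarrow> f \<in> I \<Longrightarrow> f \<in> idsum I J"
  unfolding idsum_def by (force dest: isid_0)

lemma idsum_right: "isid n I \<Longrightarrow> f \<in> J \<Longrightarrow> f \<in> idsum I J"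
  unfolding idsum_def by (force dest: isid_0)

section \<open>Congruences modulo an ideal under products and substitution\<close>

lemma isid_mult_diff:
  assumes I: "isid n I" and "f - f' \<in> I" "g - g' \<in> I" "g \<in> C n" "f' \<in> C n"
  shows "f * g - f' * g' \<in> I"
proof -
  have "f * g - f' * g' = g * (f - f') + f' * (g - g')" by (simp add: algebra_simps)
  then show ?thesis using assms by (auto intro: isid_add[OF I] isid_mult[OF I])
qed

lemma isid_mpow_diff:
  assumes I: "isid n I" and gh: "\<And>i. i \<in> keys \<alpha> \<Longrightarrow> g i - h i \<in> I"
    and g: "\<And>i. i \<in> keys \<alpha> \<Longrightarrow> g i \<in> C n" and h: "\<And>i. i \<in> keys \<alpha> \<Longrightarrow> h i \<in> C n"
  shows "mpow g \<alpha> - mpow h \<alpha> \<in> I"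
proof -
  have pow: "g i ^ k - h i ^ k \<in> I" if "i \<in> keys \<alpha>" for i k
    by (induction k) (use that in \<open>auto intro!: isid_mult_diff[OF I] gh g h C_power isid_0[OF I]\<close>)
  have "A \<subseteq> keys \<alpha> \<Longrightarrow> (\<Prod>i\<in>A. g i ^ lookup \<alpha> i) - (\<Prod>i\<in>A. h i ^ lookup \<alpha> i) \<in> I" if "finite A" for A
    using that
  proof (induction A)
    case (insert i A)
    then show ?case
      by (simp, intro isid_mult_diff[OF I] pow C_prod C_power g h) auto
  qed (simp add: isid_0[OF I])
  then show ?thesis unfolding mpow_def by simp
qed

lemma C_peval: "(\<And>i. i < n \<Longrightarrow> g i \<in> C p) \<Longrightarrow> peval n k g f \<in> C p"
  unfolding peval_def by (intro C_sum C_scl C_mpow) (auto dest: lowdegD)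

text \<open>For truncations this is the ideal property. The tails have arbitrarily high order, and
  \<open>krull\<close> absorbs them.\<close>

lemma isid_subst_diff:
  assumes K: "isid p K" and f: "f \<in> C n"
    and a: "\<And>i. i < n \<Longrightarrow> a i \<in> C p" "\<And>i. i < n \<Longrightarrow> ordge 1 (a i)"
    and b: "\<And>i. i < n \<Longrightarrow> b i \<in> C p" "\<And>i. i < n \<Longrightarrow> ordge 1 (b i)"
    and ab: "\<And>i. i < n \<Longrightarrow> a i - b i \<in> K"
  shows "subst n a f - subst n b f \<in> K"
proof (rule krull[OF K])
  show "subst n a f - subst n b f \<in> C p" by (intro C_diff C_subst f a b)
  fix k
  have "peval n k a f - peval n k b f = (\<Sum>\<alpha>\<in>lowdeg n k. scl (cf f \<alpha>) (mpow a \<alpha> - mpow b \<alpha>))"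
    by (simp add: peval_def sum_subtractf pseries_vs.scale_right_diff_distrib)
  also have "\<dots> \<in> K"
    by (intro isid_sum[OF K] isid_scl[OF K] isid_mpow_diff[OF K] ab a b) (auto dest: lowdegD)
  finally have 1: "peval n k a f - peval n k b f \<in> K" .
  have "ordge (Suc k) ((subst n a f - peval n k a f) - (subst n b f - peval n k b f))"
    by (intro ordge_diff subst_approx a b)
  then have "ordge k ((subst n a f - subst n b f) - (peval n k a f - peval n k b f))"
    by (intro ordge_mono[of "Suc k" _ k]) (simp_all add: algebra_simps)
  then show "\<exists>g\<in>K. ordge k (subst n a f - subst n b f - g)" using 1 by blast
qed

section \<open>Units\<close>

text \<open>One explicit inverse in one variable; substituting into it yields the inverses of all
  units, so convergence has to be checked only here.\<close>

lemma geometric_series: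
  obtains g where "g \<in> C 1" "(1 - xv 0) * g = 1"
proof
  define g where "g = Ser (\<lambda>\<alpha>. if keys \<alpha> \<subseteq> {0} then 1 else 0)"
  have single: "\<alpha> = Poly_Mapping.single 0 (mdeg \<alpha>)" if "keys \<alpha> \<subseteq> {0}" for \<alpha> :: expo
  proof (rule poly_mapping_eqI)
    fix i
    have "mdeg \<alpha> = lookup \<alpha> 0" using mdeg_superset[of "{0}" \<alpha>] that by simp
    then show "lookup \<alpha> i = lookup (Poly_Mapping.single 0 (mdeg \<alpha>)) i"
      using that by (cases "i = 0") (auto simp: lookup_single in_keys_iff when_def)
  qed
  have "nb (\<lambda>_. 1/2) g 2"
    unfolding nb_def
  proof (intro allI impI)
    fix A :: "expo set" assume A: "finite A"
    let ?B = "{\<alpha> \<in> A. keys \<alpha> \<subseteq> {0}}"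
    define K where "K = Suc (Max (insert 0 (mdeg ` A)))"
    have "(\<Sum>\<alpha>\<in>A. cmod (cf g \<alpha>) * mpow (\<lambda>_. 1/2) \<alpha>) = (\<Sum>\<alpha>\<in>?B. (1/2) ^ mdeg \<alpha>)"
      unfolding mpow_const g_def using A by (intro sum.mono_neutral_cong_right) auto
    also have "\<dots> = (\<Sum>k\<in>mdeg ` ?B. (1/2) ^ k)"
      by (subst sum.reindex) (auto intro!: inj_onI, metis single)
    also have "\<dots> \<le> (\<Sum>k<K. (1/2) ^ k)"
      using A by (intro sum_mono2) (auto simp: K_def less_Suc_eq_le)
    also have "\<dots> \<le> 2" by (simp add: sum_gp_strict)
    finally show "(\<Sum>\<alpha>\<in>A. cmod (cf g \<alpha>) * mpow (\<lambda>_. 1/2) \<alpha>) \<le> 2" .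
  qed
  moreover have "in_vars 1 (cf g)" by (auto simp: in_vars_def g_def split: if_splits)
  ultimately show "g \<in> C 1"
    unfolding C_iff by (intro conjI exI[of _ "1/2"] exI[of _ 2]) auto
  show "(1 - xv 0) * g = 1"
  proof (rule pseries_eqI)
    fix \<alpha>
    have "cf (xv 0 * g) \<alpha> = (if 0 \<in> keys \<alpha> then cf g \<alpha> else 0)"
    proof (cases "0 \<in> keys \<alpha>")
      case True
      then obtain \<beta> where "\<alpha> = single1 0 + \<beta>" by (rule expo_split)
      then show ?thesis by (simp add: xv_def cf_xpow_mult g_def keys_add_nat)
    next
      case False
      then show ?thesis by (simp add: xv_def, intro cf_xpow_mult_0) (auto simp: keys_add_nat)
    qed
    moreover have "cf g \<alpha> = (if \<alpha> = 0 then 1 else 0)" if "0 \<notin> keys \<alpha>"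
    proof (cases "keys \<alpha> \<subseteq> {0}")
      case True
      then have "keys \<alpha> = {}" using that by blast
      then show ?thesis by (simp add: g_def)
    next
      case False
      then have "\<alpha> \<noteq> 0" by auto
      then show ?thesis using False by (simp add: g_def)
    qed
    ultimately show "cf ((1 - xv 0) * g) \<alpha> = cf 1 \<alpha>"
      by (auto simp: algebra_simps cf_1)
  qed
qed

lemma C_unit:
  assumes f: "f \<in> C n" and f0: "cf f 0 \<noteq> 0"
  obtains g where "g \<in> C n" "f * g = 1"
proof -
  define a where "a = 1 - scl (1 / cf f 0) f"
  have a: "a \<in> C n" unfolding a_def by (intro C_diff C_1 C_scl f)
  have a1: "ordge 1 a" unfolding ordge_1_iff using f0 by (simp add: a_def cf_1)
  obtain g where g: "g \<in> C 1" "(1 - xv 0) * g = 1" by (rule geometric_series)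
  have "subst 1 (\<lambda>_. a) ((1 - xv 0) * g) = (1 - a) * subst 1 (\<lambda>_. a) g"
    using a1 by (subst subst_mult) (auto simp: subst_diff subst_xv)
  then have "(1 - a) * subst 1 (\<lambda>_. a) g = 1" by (simp add: g)
  then have "f * scl (1 / cf f 0) (subst 1 (\<lambda>_. a) g) = 1"
    by (simp add: a_def scl_mult_left scl_mult_right)
  moreover have "scl (1 / cf f 0) (subst 1 (\<lambda>_. a) g) \<in> C n"
    by (intro C_scl C_subst[OF g(1)] a a1)
  ultimately show ?thesis by (rule that[rotated])
qed

lemma proper_ideal_cf_0:
  assumes I: "isid n I" "1 \<notin> I" and f: "f \<in> I"
  shows "cf f 0 = 0"
proof (rule ccontr)
  assume "cf f 0 \<noteq> 0"
  then obtain g where "g \<in> C n" "f * g = 1" using C_unit isid_subset[OF I(1) f] by metis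
  then have "1 \<in> I" using isid_mult[OF I(1) _ f, of g] by (simp add: mult.commute)
  then show False using I by simp
qed

section \<open>Algebras presented by convergent power series\<close>

lemma complex_ring_simps [simp]:
  "carrier complex_ring = UNIV" "a \<oplus>\<^bsub>complex_ring\<^esub> b = a + b" "a \<otimes>\<^bsub>complex_ring\<^esub> b = a * b"
  "\<one>\<^bsub>complex_ring\<^esub> = 1" "\<zero>\<^bsub>complex_ring\<^esub> = 0"
  by (simp_all add: ring_of_type_algebra_def)

definition series_hom :: "nat \<Rightarrow> (complex, 'a) module \<Rightarrow> (pseries \<Rightarrow> 'a) \<Rightarrow> bool"
  where "series_hom n S \<phi> \<longleftrightarrow>
    (\<forall>f\<in>C n. \<phi> f \<in> carrier S) \<and>
    (\<forall>f\<in>C n. \<forall>g\<in>C n. \<phi> (f + g) = \<phi> f \<oplus>\<^bsub>S\<^esub> \<phi> g \<and> \<phi> (f * g) = \<phi> f \<otimes>\<^bsub>S\<^esub> \<phi> g) \<and>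
    \<phi> 1 = \<one>\<^bsub>S\<^esub> \<and> (\<forall>c. \<forall>f\<in>C n. \<phi> (scl c f) = c \<odot>\<^bsub>S\<^esub> \<phi> f)"

text \<open>The axioms hold for \<open>C n\<close> and pass to any image under a map that respects
  the operations; quotient algebras obtain them this way. As \<open>S\<close> is not yet known to be
  a ring, the image of 0 has to be prescribed.\<close>

lemma complex_algebra_image:
  fixes S :: "(complex, 'a) module" (structure)
  assumes hom: "series_hom n S \<phi>" and surj: "\<phi> ` C n = carrier S" and zero: "\<phi> 0 = \<zero>"
  shows "complex_algebra S"
proof -
  have add: "\<phi> f \<oplus> \<phi> g = \<phi> (f + g)" and mult: "\<phi> f \<otimes> \<phi> g = \<phi> (f * g)" and smult: "c \<odot> \<phi> f = \<phi> (scl c f)"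
    if "f \<in> C n" "g \<in> C n" for f g c
    using hom that by (auto simp: series_hom_def)
  have one: "\<one> = \<phi> 1" using hom by (simp add: series_hom_def)
  note rules = add mult smult one zero[symmetric] surj[symmetric] C_add C_mult C_scl C_uminus
  have ab: "abelian_group S"
  proof (rule abelian_groupI)
    fix x assume "x \<in> carrier S"
    then obtain f where "f \<in> C n" "x = \<phi> f" by (auto simp: surj[symmetric])
    then show "\<exists>y\<in>carrier S. y \<oplus> x = \<zero>"
      by (intro bexI[of _ "\<phi> (- f)"]) (auto simp: rules)
  qed (auto simp: rules algebra_simps)
  have cm: "comm_monoid S"
    by (rule comm_monoidI) (auto simp: rules algebra_simps)
  have "cring S"
    by (rule cringI[OF ab cm]) (auto simp: rules algebra_simps)
  then show ?thesis
    unfolding complex_algebra_def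
    by (intro algebraI cring_from_type_algebra)
       (auto simp: rules algebra_simps scl_mult_left scl_mult_right pseries_vs.scale_left_distrib pseries_vs.scale_right_distrib)
qed

locale series_image =
  fixes n :: nat and S :: "(complex, 'a) module" (structure) and \<phi> :: "pseries \<Rightarrow> 'a"
  assumes alg: "complex_algebra S" and hom: "series_hom n S \<phi>" and surj: "\<phi> ` C n = carrier S"
begin

sublocale S: cring S
  using alg unfolding complex_algebra_def by (rule algebra.axioms(2))

lemma closed [simp]: "f \<in> C n \<Longrightarrow> \<phi> f \<in> carrier S"
  using hom by (simp add: series_hom_def)

lemma add: "f \<in> C n \<Longrightarrow> g \<in> C n \<Longrightarrow> \<phi> (f + g) = \<phi> f \<oplus> \<phi> g"
  using hom by (simp add: series_hom_def)

lemma mult: "f \<in> C n \<Longrightarrow> g \<in> C n \<Longrightarrow> \<phi> (f * g) = \<phi> f \<otimes> \<phi> g"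
  using hom by (simp add: series_hom_def)

lemma one: "\<phi> 1 = \<one>"
  using hom by (simp add: series_hom_def)

lemma smult: "f \<in> C n \<Longrightarrow> \<phi> (scl c f) = c \<odot> \<phi> f"
  using hom by (simp add: series_hom_def)

lemma zero: "\<phi> 0 = \<zero>"
  using add[of 0 0] S.add.l_cancel_one'[of "\<phi> 0" "\<phi> 0"] by simp

lemma uminus: "f \<in> C n \<Longrightarrow> \<phi> (- f) = \<ominus> \<phi> f"
  using add[of "- f" f] by (intro S.minus_equality[symmetric]) (auto simp: zero C_uminus)

lemma diff: "f \<in> C n \<Longrightarrow> g \<in> C n \<Longrightarrow> \<phi> (f - g) = \<phi> f \<ominus> \<phi> g"
  using add[of f "- g"] by (simp add: uminus C_uminus S.minus_eq)

lemma obtain_series: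
  assumes "a \<in> carrier S"
  obtains f where "f \<in> C n" "a = \<phi> f"
  using assms surj by auto

lemma eq_iff: "f \<in> C n \<Longrightarrow> g \<in> C n \<Longrightarrow> \<phi> f = \<phi> g \<longleftrightarrow> \<phi> (f - g) = \<zero>"
  by (simp add: diff)

lemma ideal_image:
  assumes I: "isid n I"
  shows "ideal (\<phi> ` I) S"
proof (rule idealI)
  note [simp] = isid_subset[OF I]
  show "ring S" by (rule S.ring_axioms)
  show "subgroup (\<phi> ` I) (add_monoid S)"
  proof (rule S.add.subgroupI)
    show "\<phi> ` I \<subseteq> carrier S" by auto
    show "\<phi> ` I \<noteq> {}" using isid_0[OF I] by auto
    fix a assume "a \<in> \<phi> ` I"
    then show "\<ominus> a \<in> \<phi> ` I"
      by (auto simp: uminus[symmetric] intro!: imageI isid_uminus[OF I])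
    fix b assume "b \<in> \<phi> ` I"
    then show "a \<oplus> b \<in> \<phi> ` I"
      using \<open>a \<in> \<phi> ` I\<close> by (auto simp: add[symmetric] intro!: imageI isid_add[OF I])
  qed
next
  note [simp] = isid_subset[OF I]
  fix a x assume "a \<in> \<phi> ` I" "x \<in> carrier S"
  then obtain f g where *: "f \<in> I" "a = \<phi> f" "g \<in> C n" "x = \<phi> g" by (auto elim: obtain_series)
  then show "x \<otimes> a \<in> \<phi> ` I" by (auto simp: mult[symmetric] intro!: imageI isid_mult[OF I])
  then show "a \<otimes> x \<in> \<phi> ` I" using * by (simp add: S.m_comm)
qed

lemma ideal_vimage:
  assumes "ideal J S"
  shows "isid n {f \<in> C n. \<phi> f \<in> J}"
proof -
  interpret J: ideal J S by fact
  show ?thesis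
    by (rule isidI) (auto simp: zero add mult intro: C_add C_mult J.I_l_closed)
qed

lemma isid_kernel: "isid n {f \<in> C n. \<phi> f = \<zero>}"
  using ideal_vimage[OF S.zeroideal] by simp

end

text \<open>Generators and relations are recorded in \<open>pseries\<close>, while \<open>S\<close>
  keeps its own carrier type; a change of coordinates replaces \<open>n\<close>, \<open>I\<close>
  and \<pi> but never \<open>S\<close>.\<close>

definition presents :: "nat \<Rightarrow> pseries set \<Rightarrow> (complex, 'a) module \<Rightarrow> (pseries \<Rightarrow> 'a) \<Rightarrow> bool"
  where "presents n I S \<pi> \<longleftrightarrow> series_image n S \<pi> \<and> I = {f \<in> C n. \<pi> f = \<zero>\<^bsub>S\<^esub>} \<and> 1 \<notin> I"

lemma presents_image: "presents n I S \<pi> \<Longrightarrow> series_image n S \<pi>"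
  by (simp add: presents_def)

lemma presents_isid: "presents n I S \<pi> \<Longrightarrow> isid n I"
  by (auto simp: presents_def intro: series_image.isid_kernel)

lemma presents_proper: "presents n I S \<pi> \<Longrightarrow> 1 \<notin> I"
  unfolding presents_def by blast

lemma presents_zero: "presents n I S \<pi> \<Longrightarrow> f \<in> C n \<Longrightarrow> \<pi> f = \<zero>\<^bsub>S\<^esub> \<longleftrightarrow> f \<in> I"
  by (simp add: presents_def)

lemma presents_eq: "presents n I S \<pi> \<Longrightarrow> f \<in> C n \<Longrightarrow> g \<in> C n \<Longrightarrow> \<pi> f = \<pi> g \<longleftrightarrow> f - g \<in> I"
  by (auto simp: presents_def series_image.eq_iff C_diff)

lemma conv_series_simps [simp]:
  "carrier (conv_series n) = cf ` C n" "cf f \<oplus>\<^bsub>conv_series n\<^esub> cf g = cf (f + g)"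
  "cf f \<otimes>\<^bsub>conv_series n\<^esub> cf g = cf (f * g)" "\<one>\<^bsub>conv_series n\<^esub> = cf 1" "\<zero>\<^bsub>conv_series n\<^esub> = cf 0"
  "c \<odot>\<^bsub>conv_series n\<^esub> cf f = cf (scl c f)"
proof -
  show "carrier (conv_series n) = cf ` C n"
    unfolding conv_series_def C_def by (auto simp: image_iff intro!: exI[of _ "Ser _"])
qed (simp_all add: conv_series_def plus_pseries.rep_eq times_pseries.rep_eq one_pseries.rep_eq
      zero_pseries.rep_eq scl.rep_eq)

lemma series_image_conv_series: "series_image n (conv_series n) cf"
proof -
  have hom: "series_hom n (conv_series n) cf" by (simp add: series_hom_def)
  show ?thesis
    by (rule series_image.intro[OF complex_algebra_image[OF hom] hom]) simp_all
qed

lemma ideal_conv_series: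
  assumes "ideal J (conv_series n)"
  obtains I where "isid n I" "J = cf ` I"
proof
  interpret series_image n "conv_series n" cf by (rule series_image_conv_series)
  show "isid n {f \<in> C n. cf f \<in> J}" by (rule ideal_vimage[OF assms])
  have "J \<subseteq> cf ` C n"
    using additive_subgroup.a_subset[OF ideal.axioms(1)[OF assms]] by simp
  then show "J = cf ` {f \<in> C n. cf f \<in> J}" by auto
qed

lemma inj_cf: "inj cf"
  by (rule injI) (simp add: cf_inject)

lemma presents_quot:
  assumes I: "isid n I" and proper: "1 \<notin> I"
  shows "presents n I (quot_algebra (conv_series n) (cf ` I)) (\<lambda>f. cf ` I +>\<^bsub>conv_series n\<^esub> cf f)"
proof -
  interpret P: series_image n "conv_series n" cf by (rule series_image_conv_series)
  let ?C = "conv_series n" and ?J = "cf ` I"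
  let ?Q = "quot_algebra ?C ?J" and ?\<pi> = "\<lambda>f. cf ` I +>\<^bsub>conv_series n\<^esub> cf f"
  have J: "ideal ?J ?C" by (rule P.ideal_image[OF I])
  interpret J: ideal ?J ?C by (rule J)
  have coset_eq: "?\<pi> f = ?\<pi> g \<longleftrightarrow> f - g \<in> I" if "f \<in> C n" "g \<in> C n" for f g
    using that P.S.quotient_eq_iff_same_a_r_cos[OF J, of "cf f" "cf g"]
    by (simp add: P.diff[symmetric] inj_image_mem_iff[OF inj_cf])
  have carr: "carrier ?Q = ?\<pi> ` C n"
    by (auto simp: quot_algebra_def FactRing_def A_RCOSETS_def' )
  have mem: "cf f \<in> ?\<pi> f" if "f \<in> C n" for f
    using that J.a_rcos_self[of "cf f"] by simp
  have elem: "\<exists>g\<in>C n. x = cf g \<and> ?\<pi> g = ?\<pi> f" if f: "f \<in> C n" and x: "x \<in> ?\<pi> f" for f x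
  proof -
    obtain i where i: "i \<in> I" "x = cf i \<oplus>\<^bsub>?C\<^esub> cf f" using x by (auto simp: a_r_coset_def')
    then have "i + f \<in> C n" using f isid_subset[OF I] by (auto intro: C_add)
    moreover have "x = cf (i + f)" using i by simp
    ultimately show ?thesis using coset_eq[of "i + f" f] f i by auto
  qed
  have hom: "series_hom n ?Q ?\<pi>"
    unfolding series_hom_def
  proof (intro conjI ballI allI)
    fix f assume f: "f \<in> C n"
    show "?\<pi> f \<in> carrier ?Q" using f by (simp add: carr)
    fix c
    have "c \<odot>\<^bsub>?Q\<^esub> ?\<pi> f = (\<Union>x\<in>?\<pi> f. ?J +>\<^bsub>?C\<^esub> (c \<odot>\<^bsub>?C\<^esub> x))" by (simp add: quot_algebra_def)
    \<comment> \<open>All representatives of a coset have the same scaled coset, so the union in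
      \<open>quot_algebra\<close> is just that coset.\<close>
    also have "\<dots> = (\<Union>x\<in>?\<pi> f. ?\<pi> (scl c f))"
    proof (rule SUP_cong[OF refl])
      fix x assume "x \<in> ?\<pi> f"
      then obtain g where g: "g \<in> C n" "x = cf g" "?\<pi> g = ?\<pi> f" using elem[OF f] by blast
      then have "scl c (g - f) \<in> I" using f by (simp add: coset_eq isid_scl[OF I])
      then show "?J +>\<^bsub>?C\<^esub> (c \<odot>\<^bsub>?C\<^esub> x) = ?\<pi> (scl c f)"
        using g f by (simp add: coset_eq C_scl pseries_vs.scale_right_diff_distrib)
    qed
    also have "\<dots> = ?\<pi> (scl c f)" using mem[OF f] by auto
    finally show "?\<pi> (scl c f) = c \<odot>\<^bsub>?Q\<^esub> ?\<pi> f" ..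
  next
    fix f g assume fg: "f \<in> C n" "g \<in> C n"
    show "?\<pi> (f + g) = ?\<pi> f \<oplus>\<^bsub>?Q\<^esub> ?\<pi> g"
      using J.a_rcos_sum[of "cf f" "cf g"] fg by (simp add: quot_algebra_def FactRing_def)
    show "?\<pi> (f * g) = ?\<pi> f \<otimes>\<^bsub>?Q\<^esub> ?\<pi> g"
      using J.rcoset_mult_add[of "cf f" "cf g"] fg by (simp add: quot_algebra_def FactRing_def)
  next
    show "?\<pi> 1 = \<one>\<^bsub>?Q\<^esub>" by (simp add: quot_algebra_def FactRing_def)
  qed
  have zero: "?\<pi> 0 = \<zero>\<^bsub>?Q\<^esub>"
    using P.S.a_rcos_zero[OF J, of "cf 0"] isid_0[OF I] by (simp add: quot_algebra_def FactRing_def)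
  have "series_image n ?Q ?\<pi>"
    by (rule series_image.intro[OF complex_algebra_image[OF hom carr[symmetric] zero] hom carr[symmetric]])
  moreover have "I = {f \<in> C n. ?\<pi> f = \<zero>\<^bsub>?Q\<^esub>}"
    using isid_subset[OF I] coset_eq[of _ 0] by (auto simp: zero[symmetric])
  ultimately show ?thesis using proper by (simp add: presents_def)
qed

text \<open>The universal property of the quotient: \<alpha> chooses an arbitrary preimage, and the
  vanishing of \<phi> on \<open>J\<close> makes the choice irrelevant.\<close>

lemma presents_descend:
  assumes R: "presents m J R \<pi>" and B: "complex_algebra B" and \<phi>: "series_hom m B \<phi>"
    and J: "\<And>f. f \<in> J \<Longrightarrow> \<phi> f = \<zero>\<^bsub>B\<^esub>"
  obtains \<alpha> where "\<alpha> \<in> algebra_hom R B" "\<And>f. f \<in> C m \<Longrightarrow> \<alpha> (\<pi> f) = \<phi> f"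
proof -
  interpret R: series_image m R \<pi> by (rule presents_image[OF R])
  have cringB: "cring B" using B unfolding complex_algebra_def by (rule algebra.axioms(2))
  interpret B: cring B by (rule cringB)
  have \<phi>add: "\<phi> (f + g) = \<phi> f \<oplus>\<^bsub>B\<^esub> \<phi> g" and \<phi>closed: "\<phi> f \<in> carrier B" if "f \<in> C m" "g \<in> C m" for f g
    using \<phi> that by (auto simp: series_hom_def)
  define \<alpha> where "\<alpha> a = \<phi> (SOME f. f \<in> C m \<and> \<pi> f = a)" for a
  have \<alpha>: "\<alpha> (\<pi> f) = \<phi> f" if f: "f \<in> C m" for f
  proof -
    define g where "g = (SOME g. g \<in> C m \<and> \<pi> g = \<pi> f)"
    have g: "g \<in> C m" "\<pi> g = \<pi> f"
      using someI[of "\<lambda>g. g \<in> C m \<and> \<pi> g = \<pi> f" f] f by (auto simp: g_def)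
    then have "g - f \<in> J" using presents_eq[OF R] f by blast
    then have "\<phi> (g - f) = \<zero>\<^bsub>B\<^esub>" by (rule J)
    moreover have "\<phi> g = \<phi> (g - f) \<oplus>\<^bsub>B\<^esub> \<phi> f" using \<phi>add[of "g - f" f] f g by (simp add: C_diff)
    ultimately have "\<phi> g = \<phi> f" using \<phi>closed[OF f f] by simp
    then show ?thesis by (simp add: \<alpha>_def g_def)
  qed
  have "\<alpha> \<in> ring_hom R B"
  proof (rule ring_hom_memI)
    fix x assume "x \<in> carrier R"
    then obtain f where f: "f \<in> C m" "x = \<pi> f" by (rule R.obtain_series)
    then show "\<alpha> x \<in> carrier B" using \<phi>closed[of f f] by (simp add: \<alpha>)
    fix y assume "y \<in> carrier R"
    then obtain g where g: "g \<in> C m" "y = \<pi> g" by (rule R.obtain_series)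
    show "\<alpha> (x \<otimes>\<^bsub>R\<^esub> y) = \<alpha> x \<otimes>\<^bsub>B\<^esub> \<alpha> y"
      using f g \<phi> by (simp add: R.mult[symmetric] \<alpha> C_mult) (simp add: series_hom_def)
    show "\<alpha> (x \<oplus>\<^bsub>R\<^esub> y) = \<alpha> x \<oplus>\<^bsub>B\<^esub> \<alpha> y"
      using f g by (simp add: R.add[symmetric] \<alpha> C_add \<phi>add)
  next
    show "\<alpha> \<one>\<^bsub>R\<^esub> = \<one>\<^bsub>B\<^esub>"
      using \<phi> by (simp add: R.one[symmetric] \<alpha>) (simp add: series_hom_def)
  qed
  moreover have "\<alpha> (c \<odot>\<^bsub>R\<^esub> a) = c \<odot>\<^bsub>B\<^esub> \<alpha> a" if "a \<in> carrier R" for c a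
  proof -
    from that obtain f where f: "f \<in> C m" "a = \<pi> f" by (rule R.obtain_series)
    then show ?thesis using \<phi> by (simp add: R.smult[symmetric] \<alpha> C_scl) (simp add: series_hom_def)
  qed
  ultimately have "\<alpha> \<in> algebra_hom R B" by (simp add: algebra_hom_def)
  then show ?thesis using \<alpha> that by blast
qed

lemma presents_iso:
  assumes S: "presents n I S \<pi>" and Q: "presents n I Q \<pi>'"
  shows "algebra_iso S Q \<noteq> {}"
proof -
  interpret S: series_image n S \<pi> by (rule presents_image[OF S])
  interpret Q: series_image n Q \<pi>' by (rule presents_image[OF Q])
  obtain \<alpha> where \<alpha>: "\<alpha> \<in> algebra_hom S Q" "\<And>f. f \<in> C n \<Longrightarrow> \<alpha> (\<pi> f) = \<pi>' f"
    using presents_descend[OF S Q.alg Q.hom] Q isid_subset[OF presents_isid[OF S]] presents_zero[OF Q] by metis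
  have "bij_betw \<alpha> (carrier S) (carrier Q)"
    unfolding bij_betw_def
  proof
    show "inj_on \<alpha> (carrier S)"
      unfolding S.surj[symmetric]
      by (auto simp: inj_on_def \<alpha> presents_eq[OF S] presents_eq[OF Q])
    show "\<alpha> ` carrier S = carrier Q"
      unfolding S.surj[symmetric] Q.surj[symmetric] by (simp add: image_image \<alpha>)
  qed
  then show ?thesis using \<alpha>(1) by (auto simp: algebra_iso_def)
qed

lemma presents_transport:
  assumes Q: "presents n I Q \<pi>" and A: "complex_algebra A" and f: "f \<in> algebra_iso A Q"
  shows "presents n I A (\<lambda>x. inv_into (carrier A) f (\<pi> x))"
proof -
  interpret Q: series_image n Q \<pi> by (rule presents_image[OF Q])
  have cringA: "cring A" using A unfolding complex_algebra_def by (rule algebra.axioms(2))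
  interpret A: cring A by (rule cringA)
  have smultA: "c \<odot>\<^bsub>A\<^esub> a \<in> carrier A" if "a \<in> carrier A" for c a
    using A that unfolding complex_algebra_def
    by (intro module.smult_closed[OF algebra.axioms(1)]) auto
  have bij: "bij_betw f (carrier A) (carrier Q)" and fh: "f \<in> algebra_hom A Q" and fr: "f \<in> ring_hom A Q"
    using f by (auto simp: algebra_iso_def algebra_hom_def)
  let ?g = "inv_into (carrier A) f"
  have g: "?g b \<in> carrier A" "f (?g b) = b" if "b \<in> carrier Q" for b
    using that bij by (auto simp: bij_betw_def inv_into_into f_inv_into_f)
  have eqI: "?g b = a" if "a \<in> carrier A" "f a = b" for a b
    using that bij by (auto simp: bij_betw_def)
  have hom: "series_hom n A (\<lambda>x. ?g (\<pi> x))"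
    unfolding series_hom_def
  proof (intro conjI ballI allI)
    fix x assume x: "x \<in> C n"
    show "?g (\<pi> x) \<in> carrier A" using x g by simp
    fix c show "?g (\<pi> (scl c x)) = c \<odot>\<^bsub>A\<^esub> ?g (\<pi> x)"
      using x fh by (intro eqI) (auto simp: g smultA algebra_hom_def Q.smult)
  next
    fix x y assume xy: "x \<in> C n" "y \<in> C n"
    show "?g (\<pi> (x + y)) = ?g (\<pi> x) \<oplus>\<^bsub>A\<^esub> ?g (\<pi> y)"
      using xy ring_hom_add[OF fr] by (intro eqI) (auto simp: g Q.add)
    show "?g (\<pi> (x * y)) = ?g (\<pi> x) \<otimes>\<^bsub>A\<^esub> ?g (\<pi> y)"
      using xy ring_hom_mult[OF fr] by (intro eqI) (auto simp: g Q.mult)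
  next
    show "?g (\<pi> 1) = \<one>\<^bsub>A\<^esub>"
      using ring_hom_one[OF fr] by (intro eqI) (auto simp: Q.one)
  qed
  have "(\<lambda>x. ?g (\<pi> x)) ` C n = ?g ` carrier Q" by (simp add: Q.surj[symmetric] image_image)
  also have "\<dots> = carrier A" using bij_betw_inv_into[OF bij] by (simp add: bij_betw_def)
  finally have im: "series_image n A (\<lambda>x. ?g (\<pi> x))" by (intro series_image.intro A hom)
  interpret A': series_image n A "\<lambda>x. ?g (\<pi> x)" by (rule im)
  have "?g (\<pi> x) = \<zero>\<^bsub>A\<^esub> \<longleftrightarrow> x \<in> I" if x: "x \<in> C n" for x
  proof -
    have "?g (\<pi> x) = \<zero>\<^bsub>A\<^esub> \<longleftrightarrow> ?g (\<pi> x) = ?g (\<pi> 0)" by (simp add: A'.zero)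
    also have "\<dots> \<longleftrightarrow> \<pi> x = \<pi> 0" using g(2)[OF Q.closed[OF x]] g(2)[OF Q.closed[OF C_0]] by metis
    also have "\<dots> \<longleftrightarrow> x \<in> I" using x presents_zero[OF Q] by (simp add: Q.zero)
    finally show ?thesis .
  qed
  then have "I = {x \<in> C n. ?g (\<pi> x) = \<zero>\<^bsub>A\<^esub>}" using isid_subset[OF presents_isid[OF Q]] by blast
  then show ?thesis using im presents_proper[OF Q] by (simp add: presents_def)
qed

lemma analytic_algebra_presents:
  assumes "analytic_algebra A"
  obtains n I \<pi> where "presents n I A \<pi>"
proof -
  obtain n J f where A: "complex_algebra A" and J: "ideal J (conv_series n)" "J \<noteq> carrier (conv_series n)"
      and f: "f \<in> algebra_iso A (quot_algebra (conv_series n) J)"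
    using assms by (auto simp: analytic_algebra_def)
  obtain I where I: "isid n I" "J = cf ` I" using J(1) by (rule ideal_conv_series)
  have "1 \<notin> I"
  proof
    assume "1 \<in> I"
    then have "I = C n" using isid_mult[OF I(1), of _ 1] isid_subset[OF I(1)] by auto
    then show False using J(2) I(2) by simp
  qed
  then show ?thesis
    using presents_transport[OF presents_quot[OF I(1)] A] f that unfolding I(2) by blast
qed

section \<open>Quadratic singularities in terms of presentations\<close>

lemma Idl_conv_series:
  assumes F: "F \<subseteq> C n"
  shows "Idl\<^bsub>conv_series n\<^esub> (cf ` F) = cf ` idgen n F"
proof -
  interpret P: series_image n "conv_series n" cf by (rule series_image_conv_series)
  have sub: "cf ` F \<subseteq> carrier (conv_series n)" using F by auto
  show ?thesis
  proof
    show "Idl\<^bsub>conv_series n\<^esub> (cf ` F) \<subseteq> cf ` idgen n F"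
      by (rule P.S.genideal_minimal[OF P.ideal_image[OF isid_idgen[OF F]]]) (use idgen_superset in blast)
    obtain I where I: "isid n I" "Idl\<^bsub>conv_series n\<^esub> (cf ` F) = cf ` I"
      using P.S.genideal_ideal[OF sub] by (rule ideal_conv_series)
    have "cf ` F \<subseteq> cf ` I" using P.S.genideal_self[OF sub] by (simp add: I)
    then have "F \<subseteq> I" using inj_image_subset_iff[OF inj_cf] by blast
    then show "cf ` idgen n F \<subseteq> Idl\<^bsub>conv_series n\<^esub> (cf ` F)"
      unfolding I(2) by (intro image_mono idgen_least I)
  qed
qed

text \<open>There are only finitely many monomials of degree 2 in \<open>n\<close> variables, so
  convergence is automatic.\<close>

lemma homogeneous_quadratic_Mid:
  assumes "homogeneous_quadratic n (cf f)"
  shows "f \<in> Mid n 2"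
proof -
  have "f = (\<Sum>\<alpha>\<in>lowdeg n 2. scl (cf f \<alpha>) (xpow \<alpha>))"
  proof (rule pseries_eqI)
    fix \<gamma>
    have "cf (\<Sum>\<alpha>\<in>lowdeg n 2. scl (cf f \<alpha>) (xpow \<alpha>)) \<gamma> = (\<Sum>\<alpha>\<in>lowdeg n 2. if \<alpha> = \<gamma> then cf f \<gamma> else 0)"
      unfolding cf_sum by (rule sum.cong) (auto simp: cf_xpow)
    also have "\<dots> = (if \<gamma> \<in> lowdeg n 2 then cf f \<gamma> else 0)" by simp
    also have "\<dots> = cf f \<gamma>"
      using assms by (auto simp: homogeneous_quadratic_def in_vars_def lowdeg_def)
    finally show "cf f \<gamma> = cf (\<Sum>\<alpha>\<in>lowdeg n 2. scl (cf f \<alpha>) (xpow \<alpha>)) \<gamma>" ..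
  qed
  also have "\<dots> \<in> C n" by (intro C_sum C_scl C_xpow) (simp add: lowdeg_def)
  finally show ?thesis using assms by (auto simp: Mid_def ordge_def homogeneous_quadratic_def)
qed

lemma quadratic_iff_presents:
  assumes A: "complex_algebra A"
  shows "quadratic_algebraic_singularities A \<longleftrightarrow>
    (\<exists>n F \<pi>. finite F \<and> (\<forall>f\<in>F. homogeneous_quadratic n (cf f)) \<and> presents n (idgen n F) A \<pi>)"
proof -
  \<comment> \<open>Quadrics vanish at 0, so the ideal they generate is proper, as
    \<open>presents\<close> demands.\<close>
  have prp: "F \<subseteq> C n" "1 \<notin> idgen n F" if "\<forall>f\<in>F. homogeneous_quadratic n (cf f)" for F n
  proof -
    have F: "F \<subseteq> Mid n 2" using that homogeneous_quadratic_Mid by blast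
    then show "F \<subseteq> C n" by (auto simp: Mid_def)
    have "idgen n F \<subseteq> Mid n 2" by (rule idgen_least[OF isid_Mid F])
    then show "1 \<notin> idgen n F" by (auto simp: Mid_def ordge_2_iff cf_1 dest: subsetD)
  qed
  show ?thesis
  proof
    assume "quadratic_algebraic_singularities A"
    then obtain n F' f where F': "finite F'" "\<forall>f\<in>F'. homogeneous_quadratic n f"
        and f: "f \<in> algebra_iso A (quot_algebra (conv_series n) (Idl\<^bsub>conv_series n\<^esub> F'))"
      by (auto simp: quadratic_algebraic_singularities_def)
    define F where "F = Ser ` F'"
    have FF': "F' = cf ` F" by (simp add: F_def image_image)
    have F: "finite F" "\<forall>f\<in>F. homogeneous_quadratic n (cf f)" using F' by (auto simp: F_def)
    have "presents n (idgen n F) A (\<lambda>x. inv_into (carrier A) f (cf ` idgen n F +>\<^bsub>conv_series n\<^esub> cf x))"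
      using f prp[OF F(2)] unfolding FF'
      by (intro presents_transport[OF presents_quot A]) (auto simp: Idl_conv_series isid_idgen)
    then show "\<exists>n F \<pi>. finite F \<and> (\<forall>f\<in>F. homogeneous_quadratic n (cf f)) \<and> presents n (idgen n F) A \<pi>"
      using F by blast
  next
    assume "\<exists>n F \<pi>. finite F \<and> (\<forall>f\<in>F. homogeneous_quadratic n (cf f)) \<and> presents n (idgen n F) A \<pi>"
    then obtain n F \<pi> where F: "finite F" "\<forall>f\<in>F. homogeneous_quadratic n (cf f)" and \<pi>: "presents n (idgen n F) A \<pi>"
      by blast
    have "algebra_iso A (quot_algebra (conv_series n) (Idl\<^bsub>conv_series n\<^esub> (cf ` F))) \<noteq> {}"
      unfolding Idl_conv_series[OF prp(1)[OF F(2)]]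
      by (rule presents_iso[OF \<pi> presents_quot]) (use prp[OF F(2)] isid_idgen in auto)
    then show "quadratic_algebraic_singularities A"
      using F unfolding quadratic_algebraic_singularities_def by (intro exI[of _ n] exI[of _ "cf ` F"]) auto
  qed
qed

subsection \<open>Homomorphisms are substitutions\<close>

lemma ordge_decompose:
  assumes f: "f \<in> C n" and k: "ordge (Suc k) f"
  obtains h where "\<And>i. i < n \<Longrightarrow> h i \<in> C n" "\<And>i. i < n \<Longrightarrow> ordge k (h i)" "f = (\<Sum>i<n. xv i * h i)"
proof
  \<comment> \<open>Each monomial is charged to its variable of smallest index, so that none is
    counted twice. Dividing by that variable raises the norm by at most the factor
    \<open>1 / r\<close>.\<close>
  define h where "h i = Ser (\<lambda>\<alpha>. if \<forall>j<i. j \<notin> keys \<alpha> then cf f (single1 i + \<alpha>) else 0)" for i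
  obtain r M where r: "r > 0" "nb (\<lambda>_. r) f M" using f by (auto simp: C_iff)
  show "h i \<in> C n" if "i < n" for i
  proof -
    have "nb (\<lambda>_. r) (h i) (M / r)"
      unfolding nb_def
    proof (intro allI impI)
      fix A :: "expo set" assume A: "finite A"
      have "(\<Sum>\<alpha>\<in>A. cmod (cf (h i) \<alpha>) * mpow (\<lambda>_. r) \<alpha>)
          \<le> (\<Sum>\<alpha>\<in>A. (cmod (cf f (single1 i + \<alpha>)) * mpow (\<lambda>_. r) (single1 i + \<alpha>)) / r)"
        using r(1) by (intro sum_mono) (auto simp: h_def mpow_const power_add)
      also have "\<dots> = (\<Sum>\<alpha>\<in>A. cmod (cf f (single1 i + \<alpha>)) * mpow (\<lambda>_. r) (single1 i + \<alpha>)) / r"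
        by (simp add: sum_divide_distrib)
      also have "(\<Sum>\<alpha>\<in>A. cmod (cf f (single1 i + \<alpha>)) * mpow (\<lambda>_. r) (single1 i + \<alpha>))
          = (\<Sum>\<alpha>\<in>(+) (single1 i) ` A. cmod (cf f \<alpha>) * mpow (\<lambda>_. r) \<alpha>)"
        by (subst sum.reindex) (auto simp: inj_on_def)
      also have "\<dots> / r \<le> M / r"
        using r A by (intro divide_right_mono nbD[OF r(2)]) auto
      finally show "(\<Sum>\<alpha>\<in>A. cmod (cf (h i) \<alpha>) * mpow (\<lambda>_. r) \<alpha>) \<le> M / r" .
    qed
    moreover have "in_vars n (cf (h i))"
    proof -
      have "keys \<alpha> \<subseteq> {..<n}" if "cf f (single1 i + \<alpha>) \<noteq> 0" for \<alpha>
        using C_in_vars[OF f] that unfolding in_vars_def by (metis Un_subset_iff keys_add_nat)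
      then show ?thesis unfolding in_vars_def h_def by (simp split: if_splits)
    qed
    ultimately show ?thesis using r(1) by (auto simp: C_iff)
  qed
  show "ordge k (h i)" for i
    using k by (auto simp: ordge_def h_def)
  show "f = (\<Sum>i<n. xv i * h i)"
  proof (rule pseries_eqI)
    fix \<gamma>
    have trm: "cf (xv i * h i) \<gamma> = (if i \<in> keys \<gamma> \<and> (\<forall>j<i. j \<notin> keys \<gamma>) then cf f \<gamma> else 0)" for i
    proof (cases "i \<in> keys \<gamma>")
      case True
      then obtain \<beta> where \<beta>: "\<gamma> = single1 i + \<beta>" by (rule expo_split)
      show ?thesis unfolding \<beta> xv_def cf_xpow_mult by (auto simp: h_def keys_add_nat)
    next
      case False
      then show ?thesis by (simp add: xv_def, intro cf_xpow_mult_0) (auto simp: keys_add_nat)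
    qed
    show "cf f \<gamma> = cf (\<Sum>i<n. xv i * h i) \<gamma>"
    proof (cases "cf f \<gamma> = 0")
      case True
      then have "cf (xv i * h i) \<gamma> = 0" for i by (simp only: trm if_cancel)
      then show ?thesis using True by simp
    next
      case False
      then have sub: "keys \<gamma> \<subseteq> {..<n}" using C_in_vars[OF f] by (auto simp: in_vars_def)
      have "mdeg \<gamma> \<noteq> 0" using False k by (auto simp: ordge_def)
      then have ne: "keys \<gamma> \<noteq> {}" by auto
      have "(i \<in> keys \<gamma> \<and> (\<forall>j<i. j \<notin> keys \<gamma>)) = (i = Min (keys \<gamma>))" for i
      proof
        assume "i \<in> keys \<gamma> \<and> (\<forall>j<i. j \<notin> keys \<gamma>)"
        then show "i = Min (keys \<gamma>)" by (intro Min_eqI[symmetric] finite_keys) (auto simp: not_less[symmetric])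
      next
        assume "i = Min (keys \<gamma>)"
        then show "i \<in> keys \<gamma> \<and> (\<forall>j<i. j \<notin> keys \<gamma>)"
          using Min_in[OF finite_keys ne] Min_le[OF finite_keys, of _ \<gamma>] by (metis not_less)
      qed
      then have "cf (\<Sum>i<n. xv i * h i) \<gamma> = (\<Sum>i<n. if i = Min (keys \<gamma>) then cf f \<gamma> else 0)"
        by (simp add: trm)
      also have "\<dots> = cf f \<gamma>" using Min_in[OF finite_keys ne] sub by auto
      finally show ?thesis ..
    qed
  qed
qed

text \<open>Let \<open>c\<close> be the constant term of a representative \<open>h\<close> of the
  image. If \<open>c\<close> were nonzero, \<open>f - c\<close> would be a unit whose image is
  represented by the non-unit \<open>h - c\<close>. This makes every algebra homomorphism between
  analytic algebras local.\<close>

lemma series_hom_order_1: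
  assumes S: "presents n I S \<pi>" and \<phi>: "series_hom m S \<phi>" and f: "f \<in> C m" "ordge 1 f"
  obtains h where "h \<in> C n" "ordge 1 h" "\<phi> f = \<pi> h"
proof -
  interpret S: series_image n S \<pi> by (rule presents_image[OF S])
  have "\<phi> f \<in> carrier S" using \<phi> f by (simp add: series_hom_def)
  then obtain h where h: "h \<in> C n" "\<phi> f = \<pi> h" by (rule S.obtain_series)
  have "cf h 0 = 0"
  proof (rule ccontr)
    define c where "c = cf h 0"
    assume "cf h 0 \<noteq> 0"
    then have c: "cf (f - scl c 1) 0 \<noteq> 0" using f(2) by (simp add: ordge_1_iff cf_1 c_def)
    have fc: "f - scl c 1 \<in> C m" by (intro C_diff C_scl C_1 f)
    obtain v where v: "v \<in> C m" "(f - scl c 1) * v = 1" using C_unit[OF fc c] by blast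
    have "\<phi> v \<in> carrier S" using \<phi> v by (simp add: series_hom_def)
    then obtain w where w: "w \<in> C n" "\<phi> v = \<pi> w" by (rule S.obtain_series)
    have hc: "h - scl c 1 \<in> C n" by (intro C_diff C_scl C_1 h)
    have "\<phi> f = \<phi> (f - scl c 1) \<oplus>\<^bsub>S\<^esub> \<phi> (scl c 1)"
      using \<phi> fc C_scl[OF C_1, of c m] unfolding series_hom_def by (metis diff_add_cancel)
    moreover have "\<phi> (scl c 1) = \<pi> (scl c 1)" using \<phi> S.hom by (simp add: series_hom_def)
    moreover have "\<pi> h = \<pi> (h - scl c 1) \<oplus>\<^bsub>S\<^esub> \<pi> (scl c 1)"
      using S.add[OF hc C_scl[OF C_1, of c]] by simp
    ultimately have "\<phi> (f - scl c 1) \<oplus>\<^bsub>S\<^esub> \<pi> (scl c 1) = \<pi> (h - scl c 1) \<oplus>\<^bsub>S\<^esub> \<pi> (scl c 1)"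
      using h(2) by simp
    moreover have "\<phi> (f - scl c 1) \<in> carrier S" using \<phi> fc by (simp add: series_hom_def)
    ultimately have eq: "\<phi> (f - scl c 1) = \<pi> (h - scl c 1)"
      using hc C_scl[OF C_1, of c n] by (simp add: S.S.add.r_cancel)
    have "\<pi> ((h - scl c 1) * w) = \<phi> ((f - scl c 1) * v)"
      using \<phi> fc v(1) hc w by (simp add: S.mult eq[symmetric]) (simp add: series_hom_def)
    also have "\<dots> = \<pi> 1" using \<phi> by (simp add: v S.one series_hom_def)
    finally have "(h - scl c 1) * w - 1 \<in> I"
      using presents_eq[OF S] hc w(1) by (simp add: C_mult)
    then have "cf ((h - scl c 1) * w - 1) 0 = 0"
      by (rule proper_ideal_cf_0[OF presents_isid[OF S] presents_proper[OF S]])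
    then show False by (simp add: cf_mult_0 cf_1 c_def)
  qed
  then show ?thesis using that h by (simp add: ordge_1_iff)
qed

text \<open>Continuity of \<phi> is not assumed but follows: a series of order \<open>k\<close> has
  an image represented by a series of order \<open>k\<close>. Both sides agree on polynomials, so
  they differ by an element of \<open>I\<close> up to every order, and \<open>krull\<close>
  applies.\<close>

lemma series_hom_eq_subst:
  assumes S: "presents n I S \<pi>" and \<phi>: "series_hom m S \<phi>"
    and g: "\<And>i. i < m \<Longrightarrow> g i \<in> C n" "\<And>i. i < m \<Longrightarrow> ordge 1 (g i)"
    and eq: "\<And>i. i < m \<Longrightarrow> \<phi> (xv i) = \<pi> (g i)" and f: "f \<in> C m"
  shows "\<phi> f = \<pi> (subst m g f)"
proof -
  interpret S: series_image n S \<pi> by (rule presents_image[OF S])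
  have I: "isid n I" by (rule presents_isid[OF S])
  have \<phi>add: "\<phi> (a + b) = \<phi> a \<oplus>\<^bsub>S\<^esub> \<phi> b" and \<phi>mult: "\<phi> (a * b) = \<phi> a \<otimes>\<^bsub>S\<^esub> \<phi> b"
    and \<phi>scl: "\<phi> (scl c a) = c \<odot>\<^bsub>S\<^esub> \<phi> a" and \<phi>cl: "\<phi> a \<in> carrier S"
    if "a \<in> C m" "b \<in> C m" for a b c
    using \<phi> that by (auto simp: series_hom_def)
  have \<phi>1: "\<phi> 1 = \<pi> 1" using \<phi> by (simp add: series_hom_def S.one)
  have \<phi>0: "\<phi> 0 = \<pi> 0"
  proof -
    have "\<phi> 0 = \<zero>\<^bsub>S\<^esub>" using \<phi>add[of 0 0] \<phi>cl[of 0 0] by (simp add: S.S.add.l_cancel_one')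
    then show ?thesis by (simp add: S.zero)
  qed
  have sum_eq: "(\<And>x. x \<in> A \<Longrightarrow> u x \<in> C m \<and> v x \<in> C n \<and> \<phi> (u x) = \<pi> (v x)) \<Longrightarrow> \<phi> (sum u A) = \<pi> (sum v A)"
    for A :: "'z set" and u v
    by (induction A rule: infinite_finite_induct) (simp_all add: \<phi>0 \<phi>add S.add C_sum)
  have mpow_eq: "\<phi> (mpow xv \<alpha>) = \<pi> (mpow g \<alpha>)" if "keys \<alpha> \<subseteq> {..<m}" for \<alpha>
    using that
  proof (induction "mdeg \<alpha>" arbitrary: \<alpha>)
    case 0
    then show ?case by (simp add: mdeg_eq_0_iff \<phi>1)
  next
    case (Suc k)
    then have "keys \<alpha> \<noteq> {}" by auto
    then obtain i where i: "i \<in> keys \<alpha>" by blast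
    then obtain \<beta> where \<beta>: "\<alpha> = single1 i + \<beta>" by (rule expo_split)
    have "i < m" "keys \<beta> \<subseteq> {..<m}" using Suc.prems i by (auto simp: \<beta> keys_add_nat)
    moreover from this have "\<phi> (mpow xv \<beta>) = \<pi> (mpow g \<beta>)" using Suc by (simp add: \<beta>)
    moreover have "mpow xv \<beta> \<in> C m" "mpow g \<beta> \<in> C n"
      using \<open>keys \<beta> \<subseteq> {..<m}\<close> by (auto intro!: C_mpow C_xv g)
    ultimately show ?case by (simp add: \<beta> mpow_add \<phi>mult S.mult C_xv g eq)
  qed
  have poly_eq: "\<phi> (peval m k xv f) = \<pi> (peval m k g f)" for k
    unfolding peval_def
  proof (rule sum_eq)
    fix \<alpha> assume "\<alpha> \<in> lowdeg m k"
    then have keys: "keys \<alpha> \<subseteq> {..<m}" by (simp add: lowdeg_def)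
    then have "mpow xv \<alpha> \<in> C m" "mpow g \<alpha> \<in> C n" by (auto intro!: C_mpow C_xv g)
    then show "scl (cf f \<alpha>) (mpow xv \<alpha>) \<in> C m \<and> scl (cf f \<alpha>) (mpow g \<alpha>) \<in> C n \<and>
        \<phi> (scl (cf f \<alpha>) (mpow xv \<alpha>)) = \<pi> (scl (cf f \<alpha>) (mpow g \<alpha>))"
      using mpow_eq[OF keys] by (simp add: C_scl \<phi>scl[OF _ C_0] S.smult)
  qed
  \<comment> \<open>A series of order \<open>k + 1\<close> is a combination of the variables with
    coefficients of order \<open>k\<close>, and \<phi> respects this finite sum.\<close>
  have tail: "\<exists>h\<in>C n. ordge k h \<and> \<phi> a = \<pi> h" if "a \<in> C m" "ordge k a" for a k
    using that
  proof (induction k arbitrary: a)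
    case 0
    then show ?case using S.obtain_series[OF \<phi>cl[of a a]] by auto
  next
    case (Suc k)
    obtain b where b: "\<And>i. i < m \<Longrightarrow> b i \<in> C m" "\<And>i. i < m \<Longrightarrow> ordge k (b i)" "a = (\<Sum>i<m. xv i * b i)"
      using ordge_decompose[OF Suc.prems] by blast
    have "\<forall>i. i < m \<longrightarrow> (\<exists>h\<in>C n. ordge k h \<and> \<phi> (b i) = \<pi> h)" using Suc.IH b by blast
    then obtain h where h: "\<And>i. i < m \<Longrightarrow> h i \<in> C n" "\<And>i. i < m \<Longrightarrow> ordge k (h i)" "\<And>i. i < m \<Longrightarrow> \<phi> (b i) = \<pi> (h i)"
      by metis
    have "\<phi> a = \<pi> (\<Sum>i<m. g i * h i)"
      unfolding b(3) by (rule sum_eq) (auto simp: \<phi>mult S.mult C_xv b h g eq C_mult)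
    moreover have "(\<Sum>i<m. g i * h i) \<in> C n" by (intro C_sum C_mult) (auto simp: g h)
    moreover have "ordge (1 + k) (\<Sum>i<m. g i * h i)" by (intro ordge_sum ordge_mult) (auto intro: g h)
    ultimately show ?case by (metis plus_1_eq_Suc)
  qed
  obtain h0 where h0: "h0 \<in> C n" "\<phi> f = \<pi> h0" using S.obtain_series[OF \<phi>cl[OF f f]] by blast
  have sC: "subst m g f \<in> C n" by (intro C_subst f g)
  have "h0 - subst m g f \<in> I"
  proof (rule krull[OF I])
    show "h0 - subst m g f \<in> C n" by (intro C_diff h0 sC)
    fix k
    have pC: "peval m k xv f \<in> C m" "peval m k g f \<in> C n" by (intro C_peval C_xv g, assumption)+
    have "ordge (Suc k) (f - peval m k xv f)"
      using subst_approx[of m xv k f] by (simp add: ordge_xv subst_id[OF C_in_vars[OF f]])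
    then obtain t where t: "t \<in> C n" "ordge (Suc k) t" "\<phi> (f - peval m k xv f) = \<pi> t"
      using tail[OF C_diff[OF f pC(1)]] by blast
    have "\<pi> h0 = \<phi> (f - peval m k xv f) \<oplus>\<^bsub>S\<^esub> \<phi> (peval m k xv f)"
      using \<phi>add[OF C_diff[OF f pC(1)] pC(1)] by (simp add: h0(2)[symmetric])
    also have "\<dots> = \<pi> (t + peval m k g f)" by (simp add: t poly_eq S.add pC)
    finally have "h0 - (t + peval m k g f) \<in> I" using presents_eq[OF S h0(1)] t pC by (simp add: C_add)
    moreover have "ordge (Suc k) (t - (subst m g f - peval m k g f))"
      by (intro ordge_diff t subst_approx g)
    then have "ordge k ((h0 - subst m g f) - (h0 - (t + peval m k g f)))"
      by (intro ordge_mono[of "Suc k" _ k]) (simp_all add: algebra_simps)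
    ultimately show "\<exists>x\<in>I. ordge k (h0 - subst m g f - x)" by blast
  qed
  then show ?thesis using presents_eq[OF S h0(1) sC] h0(2) by simp
qed

lemma series_hom_comp:
  assumes R: "presents m J R \<pi>" and \<alpha>: "\<alpha> \<in> algebra_hom R S"
  shows "series_hom m S (\<lambda>f. \<alpha> (\<pi> f))"
proof -
  interpret R: series_image m R \<pi> by (rule presents_image[OF R])
  have "\<alpha> \<in> ring_hom R S" using \<alpha> by (simp add: algebra_hom_def)
  then show ?thesis
    using \<alpha> unfolding series_hom_def algebra_hom_def
    by (auto simp: R.add R.mult R.one R.smult ring_hom_add ring_hom_mult ring_hom_one ring_hom_closed)
qed

lemma series_hom_subst:
  assumes S: "series_image p S \<pi>" and u: "\<And>i. i < m \<Longrightarrow> u i \<in> Mid p 1"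
  shows "series_hom m S (\<lambda>f. \<pi> (subst m u f))"
proof -
  interpret S: series_image p S \<pi> by (rule S)
  have "subst m u f \<in> C p" if "f \<in> C m" for f
    using u by (intro C_subst that) (auto simp: Mid_def)
  moreover have "subst m u (f * g) = subst m u f * subst m u g" for f g
    using u by (intro subst_mult) (auto simp: Mid_def)
  ultimately show ?thesis
    by (simp add: series_hom_def subst_add subst_scl S.add S.mult S.smult S.one)
qed

lemma presents_hom_subst:
  assumes R: "presents m J R \<pi>R" and S: "presents n I S \<pi>" and \<alpha>: "\<alpha> \<in> algebra_hom R S"
  obtains g where "\<And>i. i < m \<Longrightarrow> g i \<in> Mid n 1" "\<And>f. f \<in> C m \<Longrightarrow> \<alpha> (\<pi>R f) = \<pi> (subst m g f)"
proof -
  have hom: "series_hom m S (\<lambda>f. \<alpha> (\<pi>R f))" by (rule series_hom_comp[OF R \<alpha>])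
  have "\<forall>i. i < m \<longrightarrow> (\<exists>h. h \<in> C n \<and> ordge 1 h \<and> \<alpha> (\<pi>R (xv i)) = \<pi> h)"
    using series_hom_order_1[OF S hom C_xv ordge_xv] by metis
  then obtain g where g: "\<And>i. i < m \<Longrightarrow> g i \<in> C n" "\<And>i. i < m \<Longrightarrow> ordge 1 (g i)"
      "\<And>i. i < m \<Longrightarrow> \<alpha> (\<pi>R (xv i)) = \<pi> (g i)" by metis
  show ?thesis
    by (rule that[of g]) (use g series_hom_eq_subst[OF S hom] in \<open>auto simp: Mid_def\<close>)
qed

subsection \<open>Maximal ideals and artinian quotients\<close>

text \<open>Series with nonzero constant term are units, so every proper ideal lies in the image of
  the series of order 1.\<close>

lemma presents_maximalideal:
  assumes S: "presents n I S \<pi>"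
  shows "maximalideal (\<pi> ` Mid n 1) S" "maximalideal M S \<Longrightarrow> M = \<pi> ` Mid n 1"
proof -
  interpret S: series_image n S \<pi> by (rule presents_image[OF S])
  let ?N = "\<pi> ` Mid n 1"
  have N: "ideal ?N S" by (rule S.ideal_image[OF isid_Mid])
  have one: "\<one>\<^bsub>S\<^esub> \<notin> ?N"
  proof
    assume "\<one>\<^bsub>S\<^esub> \<in> ?N"
    then obtain f where f: "f \<in> C n" "cf f 0 = 0" "\<pi> 1 = \<pi> f"
      by (auto simp: Mid_def ordge_1_iff S.one)
    then have "1 - f \<in> I" using presents_eq[OF S] by simp
    then have "cf (1 - f) 0 = 0"
      by (rule proper_ideal_cf_0[OF presents_isid[OF S] presents_proper[OF S]])
    then show False using f by (simp add: cf_1)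
  qed
  have sub: "J \<subseteq> ?N" if J: "ideal J S" "J \<noteq> carrier S" for J
  proof
    interpret J: ideal J S by (rule J)
    fix a assume a: "a \<in> J"
    then have "a \<in> carrier S" using J.a_subset by blast
    then obtain f where f: "f \<in> C n" "a = \<pi> f" by (rule S.obtain_series)
    show "a \<in> ?N"
    proof (cases "cf f 0 = 0")
      case True
      then show ?thesis using f by (auto simp: Mid_def ordge_1_iff)
    next
      case False
      then obtain g where g: "g \<in> C n" "f * g = 1" using C_unit f by metis
      have "\<pi> f \<otimes>\<^bsub>S\<^esub> \<pi> g \<in> J" using a f g by (intro J.I_r_closed) auto
      then have "\<one>\<^bsub>S\<^esub> \<in> J" using f g by (simp add: S.mult[symmetric] S.one)
      then show ?thesis using J(2) J.one_imp_carrier by blast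
    qed
  qed
  have Nne: "?N \<noteq> carrier S" using one by auto
  show "maximalideal ?N S"
  proof (rule maximalidealI[OF N])
    show "carrier S \<noteq> ?N" using Nne by simp
    fix J assume "ideal J S" "?N \<subseteq> J"
    then show "J = ?N \<or> J = carrier S" using sub by blast
  qed
  assume M: "maximalideal M S"
  interpret M: maximalideal M S by (rule M)
  have "M \<subseteq> ?N" using sub[OF M.ideal_axioms] M.I_notcarr by blast
  moreover have "?N \<subseteq> carrier S" by (auto simp: Mid_def)
  ultimately show "M = ?N" using M.I_maximal[OF N] Nne by blast
qed

lemma presents_local:
  assumes S: "presents n I S \<pi>"
  shows "local_ring S" "max_ideal S = \<pi> ` Mid n 1"
proof -
  interpret S: series_image n S \<pi> by (rule presents_image[OF S])
  show "local_ring S"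
    unfolding local_ring_def using presents_maximalideal[OF S] S.S.cring_axioms by blast
  show "max_ideal S = \<pi> ` Mid n 1"
    unfolding max_ideal_def using presents_maximalideal[OF S] by (rule the_equality)
qed

lemma algebra_hom_local:
  assumes R: "presents m J R \<pi>R" and S: "presents n I S \<pi>" and \<alpha>: "\<alpha> \<in> algebra_hom R S"
  shows "\<alpha> \<in> local_algebra_hom R S"
proof -
  have "\<alpha> (\<pi>R f) \<in> \<pi> ` Mid n 1" if "f \<in> C m" "ordge 1 f" for f
    using series_hom_order_1[OF S series_hom_comp[OF R \<alpha>] that] by (auto simp: Mid_def)
  then show ?thesis
    using \<alpha> unfolding local_algebra_hom_def presents_local(2)[OF R] presents_local(2)[OF S]
    by (auto simp: Mid_def)
qed

text \<open>Take \<open>k\<close> with the dimension of \<open>W k\<close> least. If a later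
  \<open>W l\<close> were smaller, a vector of \<open>W k\<close> outside it would enlarge a basis
  of \<open>W l\<close> to an independent set that is too large for \<open>W k\<close>.\<close>

lemma subspace_chain_stabilizes:
  assumes sub: "\<And>k::nat. pseries_vs.subspace (W k)" and dec: "\<And>k. W (Suc k) \<subseteq> W k"
    and T: "finite T" "W 0 \<subseteq> pseries_vs.span T"
  shows "\<exists>k. \<forall>l\<ge>k. W l = W k"
proof -
  have anti: "W l \<subseteq> W k" if "k \<le> l" for k l
    by (rule lift_Suc_antimono_le[of W, OF dec that])
  obtain k where k: "\<And>l. pseries_vs.dim (W k) \<le> pseries_vs.dim (W l)"
    using ex_has_least_nat[of "\<lambda>_. True" 0 "\<lambda>k. pseries_vs.dim (W k)"] by auto
  have "W l = W k" if l: "k \<le> l" for l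
  proof (rule antisym[OF anti[OF l]])
    obtain B where B: "B \<subseteq> W l" "pseries_vs.independent B" "W l \<subseteq> pseries_vs.span B" "card B = pseries_vs.dim (W l)"
      using pseries_vs.basis_exists by blast
    obtain D where D: "D \<subseteq> W k" "pseries_vs.independent D" "W k \<subseteq> pseries_vs.span D" "card D = pseries_vs.dim (W k)"
      using pseries_vs.basis_exists by blast
    have bound: "finite E \<and> card E \<le> card D" if E: "pseries_vs.independent E" "E \<subseteq> W k" for E
    proof -
      have "finite D"
        using pseries_vs.independent_span_bound[OF T(1) D(2)] D(1) anti[of 0 k] T(2) by blast
      then show ?thesis
        using pseries_vs.independent_span_bound[OF _ E(1)] E(2) D(3) by blast
    qed
    show "W k \<subseteq> W l"
    proof (rule ccontr)
      assume "\<not> W k \<subseteq> W l"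
      then obtain x where x: "x \<in> W k" "x \<notin> W l" by blast
      have "pseries_vs.span B \<subseteq> W l" by (rule pseries_vs.span_minimal[OF B(1) sub])
      then have nx: "x \<notin> pseries_vs.span B" using x by blast
      have ind: "pseries_vs.independent (insert x B)" by (rule pseries_vs.independent_insertI[OF nx B(2)])
      have BW: "B \<subseteq> W k" using B(1) anti[OF l] by blast
      have "card (insert x B) \<le> card D" using bound[OF ind] BW x by blast
      moreover have "card (insert x B) = Suc (card B)"
        using nx bound[OF B(2) BW] pseries_vs.span_base by (intro card_insert_disjoint) blast+
      ultimately show False using k[of l] B(4) D(4) by simp
    qed
  qed
  then show ?thesis by blast
qed

text \<open>Modulo \<open>Mid p e\<close> every series is a polynomial of degree at most
  \<open>e\<close>. Hence an ideal of \<open>B\<close> is determined by the polynomials in its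
  preimage, a subspace of a finite-dimensional space.\<close>

lemma presents_artinian:
  assumes B: "presents p K B \<pi>" and e: "Mid p e \<subseteq> K"
  shows "artinian_ring B"
  unfolding artinian_ring_def
proof (intro allI impI)
  interpret B: series_image p B \<pi> by (rule presents_image[OF B])
  fix J :: "nat \<Rightarrow> 'a set"
  assume "(\<forall>k. ideal (J k) B) \<and> (\<forall>k. J (Suc k) \<subseteq> J k)"
  then have J: "\<And>k. ideal (J k) B" "\<And>k. J (Suc k) \<subseteq> J k" by auto
  define U where "U k = {f \<in> C p. \<pi> f \<in> J k}" for k
  have U: "isid p (U k)" for k unfolding U_def by (rule B.ideal_vimage[OF J(1)])
  define P where "P = pseries_vs.span (xpow ` lowdeg p e)"
  have "pseries_vs.subspace (U k)" for k
    unfolding pseries_vs.subspace_def using isid_0[OF U] isid_add[OF U] isid_scl[OF U] by blast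
  then have sub: "pseries_vs.subspace (U k \<inter> P)" for k
    unfolding P_def by (intro pseries_vs.subspace_inter pseries_vs.subspace_span)
  have "\<exists>k. \<forall>l\<ge>k. U l \<inter> P = U k \<inter> P"
    by (rule subspace_chain_stabilizes[OF sub, where T = "xpow ` lowdeg p e"])
       (use J(2) in \<open>auto simp: U_def P_def\<close>)
  then obtain k where k: "\<And>l. l \<ge> k \<Longrightarrow> U l \<inter> P = U k \<inter> P" by blast
  have KU: "K \<subseteq> U l" for l
  proof
    fix f assume "f \<in> K"
    then have "f \<in> C p" "\<pi> f = \<zero>\<^bsub>B\<^esub>"
      using presents_zero[OF B] isid_subset[OF presents_isid[OF B]] by blast+
    then show "f \<in> U l"
      using additive_subgroup.zero_closed[OF ideal.axioms(1)[OF J(1)[of l]]] by (simp add: U_def)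
  qed
  have mem: "f \<in> U l \<longleftrightarrow> peval p e xv f \<in> U l \<inter> P" if f: "f \<in> C p" for f l
  proof -
    have "ordge (Suc e) (f - peval p e xv f)"
      using subst_approx[of p xv e f] by (simp add: ordge_xv subst_id[OF C_in_vars[OF f]])
    moreover have pC: "peval p e xv f \<in> C p" by (intro C_peval C_xv)
    ultimately have "f - peval p e xv f \<in> Mid p e"
      using f by (auto simp: Mid_def intro: C_diff ordge_mono)
    then have d: "f - peval p e xv f \<in> U l" using e KU by blast
    have "peval p e xv f \<in> P"
      unfolding peval_def P_def xpow_eq_mpow[symmetric]
      by (intro pseries_vs.span_sum pseries_vs.span_scale pseries_vs.span_base) auto
    moreover have "f \<in> U l \<longleftrightarrow> peval p e xv f \<in> U l"
      using isid_diff[OF U _ d, of f] isid_add[OF U d, of "peval p e xv f"] by auto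
    ultimately show ?thesis by blast
  qed
  have "U l = U k" if "l \<ge> k" for l
    using mem[of _ l] mem[of _ k] k[OF that] unfolding U_def by blast
  moreover have "J l = \<pi> ` U l" for l
  proof -
    have "J l \<subseteq> \<pi> ` C p"
      using additive_subgroup.a_subset[OF ideal.axioms(1)[OF J(1)[of l]]] by (simp add: B.surj)
    then show ?thesis by (auto simp: U_def)
  qed
  ultimately show "\<exists>k. \<forall>l\<ge>k. J l = J k" by auto
qed

lemma presents_local_artinian:
  assumes B: "presents p K B \<pi>" and e: "Mid p e \<subseteq> K"
  shows "local_artinian_algebra B"
proof -
  interpret B: series_image p B \<pi> by (rule presents_image[OF B])
  let ?N = "max_ideal B"
  have N: "?N = \<pi> ` Mid p 1" by (rule presents_local(2)[OF B])
  have idN: "ideal ?N B" unfolding N by (rule B.ideal_image[OF isid_Mid])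
  interpret N: ideal ?N B by (rule idN)
  let ?h = "\<lambda>c. ?N +>\<^bsub>B\<^esub> (c \<odot>\<^bsub>B\<^esub> \<one>\<^bsub>B\<^esub>)"
  have h: "?h c = ?N +>\<^bsub>B\<^esub> \<pi> (scl c 1)" for c by (simp add: B.smult B.one)
  have sC: "scl c 1 \<in> C p" for c by (simp add: C_scl)
  \<comment> \<open>The residue class of a series is its constant term, which identifies the residue
    field with the complex numbers.\<close>
  have eq: "?N +>\<^bsub>B\<^esub> \<pi> f = ?N +>\<^bsub>B\<^esub> \<pi> g \<longleftrightarrow> cf f 0 = cf g 0" if "f \<in> C p" "g \<in> C p" for f g
  proof -
    have "?N +>\<^bsub>B\<^esub> \<pi> f = ?N +>\<^bsub>B\<^esub> \<pi> g \<longleftrightarrow> \<pi> (f - g) \<in> ?N"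
      using B.S.quotient_eq_iff_same_a_r_cos[OF idN, of "\<pi> f" "\<pi> g"] that by (simp add: B.diff)
    also have "\<dots> \<longleftrightarrow> cf (f - g) 0 = 0"
    proof
      assume "\<pi> (f - g) \<in> ?N"
      then obtain q where q: "q \<in> C p" "cf q 0 = 0" "\<pi> (f - g) = \<pi> q" by (auto simp: N Mid_def ordge_1_iff)
      then have "(f - g) - q \<in> K" using presents_eq[OF B] that by (simp add: C_diff)
      then have "cf ((f - g) - q) 0 = 0"
        by (rule proper_ideal_cf_0[OF presents_isid[OF B] presents_proper[OF B]])
      then show "cf (f - g) 0 = 0" using q by simp
    next
      assume "cf (f - g) 0 = 0"
      then show "\<pi> (f - g) \<in> ?N" using that by (auto simp: N Mid_def ordge_1_iff C_diff)
    qed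
    finally show ?thesis by simp
  qed
  have "?h \<in> ring_iso complex_ring (B Quot ?N)"
  proof (rule ring_iso_memI)
    fix x y :: complex
    show "?h x \<in> carrier (B Quot ?N)"
      unfolding h by (auto simp: FactRing_def A_RCOSETS_def' sC)
    have "\<pi> (scl (x * y) 1) = \<pi> (scl x 1) \<otimes>\<^bsub>B\<^esub> \<pi> (scl y 1)"
      by (simp add: B.mult[symmetric] sC scl_mult_left)
    then show "?h (x \<otimes>\<^bsub>complex_ring\<^esub> y) = ?h x \<otimes>\<^bsub>B Quot ?N\<^esub> ?h y"
      unfolding h using N.rcoset_mult_add[of "\<pi> (scl x 1)" "\<pi> (scl y 1)"] sC by (simp add: FactRing_def)
    have "\<pi> (scl (x + y) 1) = \<pi> (scl x 1) \<oplus>\<^bsub>B\<^esub> \<pi> (scl y 1)"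
      by (simp add: B.add[symmetric] sC pseries_vs.scale_left_distrib)
    then show "?h (x \<oplus>\<^bsub>complex_ring\<^esub> y) = ?h x \<oplus>\<^bsub>B Quot ?N\<^esub> ?h y"
      unfolding h using N.a_rcos_sum[of "\<pi> (scl x 1)" "\<pi> (scl y 1)"] sC by (simp add: FactRing_def)
  next
    show "?h \<one>\<^bsub>complex_ring\<^esub> = \<one>\<^bsub>B Quot ?N\<^esub>"
      unfolding h by (simp add: FactRing_def B.one)
    show "bij_betw ?h (carrier complex_ring) (carrier (B Quot ?N))"
      unfolding bij_betw_def
    proof
      show "inj_on ?h (carrier complex_ring)"
        unfolding h by (auto simp: inj_on_def eq sC cf_1)
      have "\<exists>c. ?N +>\<^bsub>B\<^esub> a = ?h c" if "a \<in> carrier B" for a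
      proof -
        from that obtain f where f: "f \<in> C p" "a = \<pi> f" by (rule B.obtain_series)
        then have "?N +>\<^bsub>B\<^esub> a = ?h (cf f 0)" unfolding h by (simp add: eq sC cf_1)
        then show ?thesis by blast
      qed
      moreover have "?h c \<in> carrier (B Quot ?N)" for c
        unfolding h by (auto simp: FactRing_def A_RCOSETS_def' sC)
      ultimately show "?h ` carrier complex_ring = carrier (B Quot ?N)"
        by (auto simp: FactRing_def A_RCOSETS_def' image_iff)
    qed
  qed
  then show ?thesis
    unfolding local_artinian_algebra_def
    using B.alg presents_local(1)[OF B] presents_artinian[OF B e] by blast
qed

subsection \<open>Formal smoothness in coordinates\<close>

text \<open>Formal smoothness of \<open>C m / J\<close> to \<open>C n / I\<close> along
  \<open>g\<close>, tested on the surjection from \<open>C p / K2\<close> to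
  \<open>C p / K1\<close>: \<open>u\<close> is the structure map, \<open>v\<close> the homomorphism
  to be lifted and \<open>v'\<close> the lift. The exponent \<open>e\<close> makes the test algebras
  artinian.\<close>

definition lifting :: "nat \<Rightarrow> pseries set \<Rightarrow> nat \<Rightarrow> pseries set \<Rightarrow> (nat \<Rightarrow> pseries) \<Rightarrow> bool"
  where "lifting m J n I g \<longleftrightarrow>
    (\<forall>p K1 K2 u v e. isid p K1 \<and> isid p K2 \<and> K2 \<subseteq> K1 \<and> 1 \<notin> K1 \<and> Mid p e \<subseteq> K2 \<and>
       (\<forall>a\<in>Mid p 1. \<forall>x\<in>K1. a * x \<in> K2) \<and>
       (\<forall>i<m. u i \<in> Mid p 1) \<and> (\<forall>j<n. v j \<in> Mid p 1) \<and>
       (\<forall>f\<in>J. subst m u f \<in> K2) \<and> (\<forall>f\<in>I. subst n v f \<in> K1) \<and>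
       (\<forall>i<m. subst n v (g i) - u i \<in> K1) \<longrightarrow>
       (\<exists>v'. (\<forall>j<n. v' j \<in> Mid p 1 \<and> v' j - v j \<in> K1) \<and>
          (\<forall>f\<in>I. subst n v' f \<in> K2) \<and> (\<forall>i<m. subst n v' (g i) - u i \<in> K2)))"

text \<open>The quotients of \<open>conv_series p\<close> by ideals have their carriers in exactly
  the type over which \<open>formally_smooth\<close> quantifies, so they may serve as test
  algebras.\<close>

lemma formally_smooth_lifting:
  assumes smooth: "formally_smooth R S \<psi>"
    and R: "presents m J R \<pi>R" and S: "presents n I S \<pi>S"
    and g: "\<And>i. i < m \<Longrightarrow> g i \<in> Mid n 1" and \<psi>: "\<And>f. f \<in> C m \<Longrightarrow> \<psi> (\<pi>R f) = \<pi>S (subst m g f)"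
  shows "lifting m J n I g"
  unfolding lifting_def
proof (intro allI impI, elim conjE)
  fix p K1 K2 u v e
  assume K1: "isid p K1" and K2: "isid p K2" and K21: "K2 \<subseteq> K1" and proper: "1 \<notin> K1" and e: "Mid p e \<subseteq> K2"
    and ann: "\<forall>a\<in>Mid p 1. \<forall>x\<in>K1. a * x \<in> K2"
    and u: "\<forall>i<m. u i \<in> Mid p 1" and v: "\<forall>j<n. v j \<in> Mid p 1"
    and uJ: "\<forall>f\<in>J. subst m u f \<in> K2" and vI: "\<forall>f\<in>I. subst n v f \<in> K1"
    and vg: "\<forall>i<m. subst n v (g i) - u i \<in> K1"
  interpret R: series_image m R \<pi>R by (rule presents_image[OF R])
  interpret S: series_image n S \<pi>S by (rule presents_image[OF S])
  define B where "B = quot_algebra (conv_series p) (cf ` K2)"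
  define A where "A = quot_algebra (conv_series p) (cf ` K1)"
  define \<pi>B where "\<pi>B f = cf ` K2 +>\<^bsub>conv_series p\<^esub> cf f" for f
  define \<pi>A where "\<pi>A f = cf ` K1 +>\<^bsub>conv_series p\<^esub> cf f" for f
  have B: "presents p K2 B \<pi>B" unfolding B_def \<pi>B_def by (rule presents_quot) (use K2 K21 proper in auto)
  have A: "presents p K1 A \<pi>A" unfolding A_def \<pi>A_def by (rule presents_quot[OF K1 proper])
  interpret B: series_image p B \<pi>B by (rule presents_image[OF B])
  interpret A: series_image p A \<pi>A by (rule presents_image[OF A])
  have uC: "subst m u f \<in> C p" if "f \<in> C m" for f using u that by (intro C_subst) (auto simp: Mid_def)
  have vC: "subst n v f \<in> C p" if "f \<in> C n" for f using v that by (intro C_subst) (auto simp: Mid_def)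
  have gC: "subst m g f \<in> C n" if "f \<in> C m" for f using g that by (intro C_subst) (auto simp: Mid_def)
  have JC: "f \<in> C m" if "f \<in> J" for f using isid_subset[OF presents_isid[OF R] that] .
  have IC: "f \<in> C n" if "f \<in> I" for f using isid_subset[OF presents_isid[OF S] that] .
  have zeroB: "\<pi>B f = \<zero>\<^bsub>B\<^esub>" if "f \<in> K2" for f
    using presents_zero[OF B isid_subset[OF K2 that]] that by simp
  have zeroA: "\<pi>A f = \<zero>\<^bsub>A\<^esub>" if "f \<in> K1" for f
    using presents_zero[OF A isid_subset[OF K1 that]] that by simp
  have homs: "series_hom m B (\<lambda>f. \<pi>B (subst m u f))" "series_hom m A (\<lambda>f. \<pi>A (subst m u f))"
      "series_hom n A (\<lambda>f. \<pi>A (subst n v f))"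
    using u v by (auto intro!: series_hom_subst B.series_image_axioms A.series_image_axioms)
  obtain \<beta> where \<beta>: "\<beta> \<in> algebra_hom R B" "\<And>f. f \<in> C m \<Longrightarrow> \<beta> (\<pi>R f) = \<pi>B (subst m u f)"
    using presents_descend[OF R B.alg homs(1) zeroB[OF uJ[rule_format]]] by blast
  obtain \<alpha> where \<alpha>: "\<alpha> \<in> algebra_hom R A" "\<And>f. f \<in> C m \<Longrightarrow> \<alpha> (\<pi>R f) = \<pi>A (subst m u f)"
    using presents_descend[OF R A.alg homs(2) zeroA[OF subsetD[OF K21 uJ[rule_format]]]] by blast
  obtain q where q: "q \<in> algebra_hom B A" "\<And>f. f \<in> C p \<Longrightarrow> q (\<pi>B f) = \<pi>A f"
    using presents_descend[OF B A.alg A.hom zeroA[OF subsetD[OF K21]]] by blast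
  obtain \<gamma> where \<gamma>: "\<gamma> \<in> algebra_hom S A" "\<And>f. f \<in> C n \<Longrightarrow> \<gamma> (\<pi>S f) = \<pi>A (subst n v f)"
    using presents_descend[OF S A.alg homs(3) zeroA[OF vI[rule_format]]] by blast
  have q_over: "q \<in> hom_over R B \<beta> A \<alpha>"
    unfolding hom_over_def R.surj[symmetric] using algebra_hom_local[OF B A q(1)] by (auto simp: \<beta> \<alpha> q uC)
  have q_surj: "q ` carrier B = carrier A"
    unfolding B.surj[symmetric] A.surj[symmetric] by (simp add: image_image q)
  have q_ker: "\<forall>x \<in> a_kernel B A q. \<forall>a \<in> max_ideal B. a \<otimes>\<^bsub>B\<^esub> x = \<zero>\<^bsub>B\<^esub>"
  proof (intro ballI)
    fix x a assume "x \<in> a_kernel B A q" "a \<in> max_ideal B"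
    then obtain f h where f: "f \<in> C p" "x = \<pi>B f" "\<pi>A f = \<zero>\<^bsub>A\<^esub>" and h: "h \<in> Mid p 1" "a = \<pi>B h"
      by (auto simp: a_kernel_def' presents_local(2)[OF B] q elim!: B.obtain_series)
    then have "h * f \<in> K2" using ann presents_zero[OF A] by blast
    then show "a \<otimes>\<^bsub>B\<^esub> x = \<zero>\<^bsub>B\<^esub>"
      using f h presents_zero[OF B, of "h * f"] by (simp add: B.mult Mid_def C_mult)
  qed
  have \<gamma>_over: "\<gamma> \<in> hom_over R S \<psi> A \<alpha>"
  proof -
    have "\<pi>A (subst n v (subst m g f)) = \<pi>A (subst m u f)" if f: "f \<in> C m" for f
    proof -
      have "subst n v (subst m g f) = subst m (\<lambda>i. subst n v (g i)) f"
        using g v by (intro subst_comp) (auto simp: Mid_def)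
      \<comment> \<open>The hypothesis compares the images of the variables only;
        \<open>isid_subst_diff\<close> extends the congruence to all series.\<close>
      moreover have "subst m (\<lambda>i. subst n v (g i)) f - subst m u f \<in> K1"
        using g v u vg by (intro isid_subst_diff[OF K1 f]) (auto simp: Mid_def intro!: C_subst subst_ordge)
      ultimately show ?thesis using presents_eq[OF A vC[OF gC[OF f]] uC[OF f]] by simp
    qed
    then show ?thesis
      unfolding hom_over_def R.surj[symmetric] using algebra_hom_local[OF S A \<gamma>(1)]
      by (auto simp: \<psi> \<gamma> \<alpha> gC)
  qed
  have "local_artinian_algebra A" by (rule presents_local_artinian[OF A]) (use e K21 in blast)
  moreover have "local_artinian_algebra B" by (rule presents_local_artinian[OF B e])
  moreover have "\<alpha> \<in> local_algebra_hom R A" "\<beta> \<in> local_algebra_hom R B"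
    using algebra_hom_local[OF R A \<alpha>(1)] algebra_hom_local[OF R B \<beta>(1)] by auto
  ultimately obtain h where h: "h \<in> hom_over R S \<psi> B \<beta>" "\<forall>s \<in> carrier S. q (h s) = \<gamma> s"
    using smooth q_over q_surj q_ker \<gamma>_over unfolding formally_smooth_def by blast
  have "h \<in> algebra_hom S B" using h by (simp add: hom_over_def local_algebra_hom_def)
  then obtain v' where v': "\<And>i. i < n \<Longrightarrow> v' i \<in> Mid p 1" "\<And>f. f \<in> C n \<Longrightarrow> h (\<pi>S f) = \<pi>B (subst n v' f)"
    using presents_hom_subst[OF S B] by blast
  have v'C: "subst n v' f \<in> C p" if "f \<in> C n" for f using v' that by (intro C_subst) (auto simp: Mid_def)
  have v'x: "subst n v' (xv j) = v' j" if "j < n" for j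
    using v'(1)[OF that] by (intro subst_xv that) (simp add: Mid_def)
  show "\<exists>v'. (\<forall>j<n. v' j \<in> Mid p 1 \<and> v' j - v j \<in> K1) \<and>
      (\<forall>f\<in>I. subst n v' f \<in> K2) \<and> (\<forall>i<m. subst n v' (g i) - u i \<in> K2)"
  proof (intro exI[of _ v'] conjI allI impI ballI)
    fix j assume j: "j < n"
    show "v' j \<in> Mid p 1" by (rule v'(1)[OF j])
    have "\<pi>A (v' j) = \<pi>A (v j)"
    proof -
      have "q (h (\<pi>S (xv j))) = \<gamma> (\<pi>S (xv j))" using h(2) S.closed[OF C_xv[OF j]] by blast
      then have "\<pi>A (subst n v' (xv j)) = \<pi>A (subst n v (xv j))"
        using j by (simp add: \<gamma> v' C_xv v'C q)
      moreover have "subst n v (xv j) = v j" using v j by (intro subst_xv) (auto simp: Mid_def)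
      ultimately show ?thesis by (simp add: v'x[OF j])
    qed
    then show "v' j - v j \<in> K1"
      using presents_eq[OF A] v'(1)[OF j] v j by (auto simp: Mid_def)
  next
    fix f assume f: "f \<in> I"
    have "\<pi>S f = \<pi>S 0" using presents_zero[OF S IC[OF f]] f by (simp add: S.zero)
    then have "\<pi>B (subst n v' f) = \<pi>B (subst n v' 0)" using v'(2) IC[OF f] C_0 by metis
    then show "subst n v' f \<in> K2" using presents_eq[OF B] v'C IC[OF f] by auto
  next
    fix i assume i: "i < m"
    have gi: "g i \<in> C n" "ordge 1 (g i)" "u i \<in> C p" "ordge 1 (u i)" using g i u by (auto simp: Mid_def)
    have "h (\<psi> (\<pi>R (xv i))) = \<beta> (\<pi>R (xv i))" using h(1) i by (simp add: hom_over_def C_xv)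
    then have "\<pi>B (subst n v' (g i)) = \<pi>B (u i)" using i gi by (simp add: \<psi> \<beta> C_xv subst_xv v')
    then show "subst n v' (g i) - u i \<in> K2" using presents_eq[OF B] v'C gi by auto
  qed
qed

section \<open>Coordinates on a quotient relative to given series\<close>

definition linpart :: "nat \<Rightarrow> pseries \<Rightarrow> pseries"
  where "linpart n f = (\<Sum>i<n. scl (cf f (single1 i)) (xv i))"

lemma single1_eq_iff [simp]: "single1 i = single1 j \<longleftrightarrow> i = j"
  by (metis lookup_single_eq lookup_single_not_eq one_neq_zero)

lemma cf_single1_beyond:
  assumes "f \<in> C n" "n \<le> i"
  shows "cf f (single1 i) = 0"
  using C_in_vars[OF assms(1)] assms(2) unfolding in_vars_def by force

lemma cf_linpart_single1: "cf (linpart n f) (single1 i) = (if i < n then cf f (single1 i) else 0)"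
  by (auto simp: linpart_def cf_xv if_distrib[of "\<lambda>x. _ * x"] sum.delta' cong: if_cong)

lemma C_linpart: "linpart n f \<in> C n"
  unfolding linpart_def by (intro C_sum C_scl C_xv) auto

lemma linpart_approx:
  assumes "f \<in> Mid n 1"
  shows "f - linpart n f \<in> Mid n 2"
proof -
  have f: "f \<in> C n" "cf f 0 = 0" using assms by (auto simp: Mid_def ordge_1_iff)
  have "ordge 1 (linpart n f)"
    unfolding linpart_def by (intro ordge_sum ordge_scl ordge_xv)
  then have "cf (f - linpart n f) 0 = 0"
    using f by (simp add: ordge_1_iff)
  moreover have "cf (f - linpart n f) (single1 i) = 0" for i
    using cf_single1_beyond[OF f(1)] by (simp add: cf_linpart_single1)
  ultimately show ?thesis
    using f by (simp add: Mid_def ordge_2_iff C_diff C_linpart)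
qed

lemma subst_linpart:
  assumes "\<And>i. i < p \<Longrightarrow> ordge 1 (G i)"
  shows "subst p G (linpart p f) = (\<Sum>i<p. scl (cf f (single1 i)) (G i))"
  unfolding linpart_def subst_sum
  by (intro sum.cong refl) (simp add: subst_scl subst_xv assms)

lemma subst_linpart_approx:
  assumes G: "\<And>i. i < p \<Longrightarrow> G i \<in> Mid n 1" and f: "f \<in> Mid p 1"
  shows "subst p G f - (\<Sum>i<p. scl (cf f (single1 i)) (G i)) \<in> Mid n 2"
proof -
  have o: "ordge 1 (G i)" "G i \<in> C n" if "i < p" for i using G[OF that] by (auto simp: Mid_def)
  have "subst p G (f - linpart p f) \<in> Mid n 2"
    using linpart_approx[OF f] o by (auto simp: Mid_def intro: C_subst subst_ordge)
  then show ?thesis by (simp add: subst_diff subst_linpart o)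
qed

text \<open>The images of \<open>G\<^sub>0, \<dots>, G\<^bsub>p-1\<^esub>\<close> span the cotangent space of \<open>C n / I\<close>.\<close>

definition cotangent_spanning :: "nat \<Rightarrow> pseries set \<Rightarrow> nat \<Rightarrow> (nat \<Rightarrow> pseries) \<Rightarrow> bool"
  where "cotangent_spanning n I p G \<longleftrightarrow>
    xv ` {..<n} \<subseteq> pseries_vs.span (G ` {..<p} \<union> I \<union> Mid n 2)"

text \<open>The elements with such an expansion form a subspace that contains all generators of the
  span.\<close>

lemma cotangent_spanning_expand:
  assumes I: "isid n I" and G: "cotangent_spanning n I p G" and j: "j < n"
  obtains c where "xv j - (\<Sum>i<p. scl (c i) (G i)) \<in> idsum I (Mid n 2)"
proof -
  let ?Q = "idsum I (Mid n 2)"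
  have Q: "isid n ?Q" by (rule isid_idsum[OF I isid_Mid])
  let ?V = "{x. \<exists>c. x - (\<Sum>i<p. scl (c i) (G i)) \<in> ?Q}"
  have "pseries_vs.span (G ` {..<p} \<union> I \<union> Mid n 2) \<subseteq> ?V"
  proof (rule pseries_vs.span_minimal)
    have "G i \<in> ?V" if "i < p" for i
    proof -
      have "(\<Sum>k<p. scl (if k = i then 1 else 0) (G k)) = G i"
        using that by (simp add: if_distrib[of "\<lambda>c. scl c _"] cong: if_cong)
      then show ?thesis using isid_0[OF Q] by (auto intro!: exI[of _ "\<lambda>k. if k = i then 1 else 0"])
    qed
    moreover have "x \<in> ?V" if "x \<in> ?Q" for x
      using that by (auto intro!: exI[of _ "\<lambda>_. 0"])
    ultimately show "G ` {..<p} \<union> I \<union> Mid n 2 \<subseteq> ?V"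
      using idsum_left[OF isid_Mid, of _ I n 2] idsum_right[OF I, of _ "Mid n 2"] by blast
    show "pseries_vs.subspace ?V"
    proof (rule pseries_vs.subspaceI)
      show "0 \<in> ?V" using isid_0[OF Q] by (auto intro!: exI[of _ "\<lambda>_. 0"])
    next
      fix x y assume "x \<in> ?V" "y \<in> ?V"
      then obtain a b where ab: "x - (\<Sum>i<p. scl (a i) (G i)) \<in> ?Q" "y - (\<Sum>i<p. scl (b i) (G i)) \<in> ?Q"
        by blast
      have "x + y - (\<Sum>i<p. scl (a i + b i) (G i)) \<in> ?Q"
        using isid_add[OF Q ab] by (simp add: pseries_vs.scale_left_distrib sum.distrib algebra_simps)
      then show "x + y \<in> ?V" by (intro CollectI exI)
    next
      fix c x assume "x \<in> ?V"
      then obtain a where a: "x - (\<Sum>i<p. scl (a i) (G i)) \<in> ?Q" by blast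
      have "scl c x - (\<Sum>i<p. scl (c * a i) (G i)) \<in> ?Q"
        using isid_scl[OF Q a, of c] by (simp add: pseries_vs.scale_right_diff_distrib pseries_vs.scale_sum_right)
      then show "scl c x \<in> ?V" by (intro CollectI exI)
    qed
  qed
  then show ?thesis using G j that unfolding cotangent_spanning_def by blast
qed

text \<open>Takes the place of Nakayama's lemma: generation to first order is made exact by
  inverting a substitution that is tangent to the identity.\<close>

lemma cotangent_spanning_surj:
  assumes I: "isid n I" and G: "\<And>i. i < p \<Longrightarrow> G i \<in> Mid n 1" and span: "cotangent_spanning n I p G"
  obtains w where "\<And>j. j < n \<Longrightarrow> w j \<in> Mid p 1" "\<And>j. j < n \<Longrightarrow> subst p G (w j) - xv j \<in> I"
proof -
  have "\<exists>c k. k \<in> I \<and> xv j - (\<Sum>i<p. scl (c i) (G i)) - k \<in> Mid n 2" if j: "j < n" for j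
  proof -
    obtain c where "xv j - (\<Sum>i<p. scl (c i) (G i)) \<in> idsum I (Mid n 2)"
      by (rule cotangent_spanning_expand[OF I span j])
    then obtain k q where "k \<in> I" "q \<in> Mid n 2" "xv j - (\<Sum>i<p. scl (c i) (G i)) = k + q"
      unfolding idsum_def by blast
    then show ?thesis by (intro exI[of _ c] exI[of _ k]) simp
  qed
  then obtain c k where k: "\<And>j. j < n \<Longrightarrow> k j \<in> I"
    and ck: "\<And>j. j < n \<Longrightarrow> xv j - (\<Sum>i<p. scl (c j i) (G i)) - k j \<in> Mid n 2"
    by metis
  define L where "L j = (\<Sum>i<p. scl (c j i) (xv i))" for j
  have GC: "G i \<in> C n" "ordge 1 (G i)" if "i < p" for i using G[OF that] by (auto simp: Mid_def)
  have L: "L j \<in> Mid p 1" for j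
    unfolding L_def Mid_def by (auto intro!: C_sum C_scl C_xv ordge_sum ordge_scl ordge_xv)
  have GL: "subst p G (L j) = (\<Sum>i<p. scl (c j i) (G i))" for j
    unfolding L_def subst_sum by (intro sum.cong refl) (simp add: subst_scl subst_xv GC)
  \<comment> \<open>The element \<open>k j\<close> of \<open>I\<close> corrects the combination of
    the \<open>G i\<close> so that \<open>t j\<close> is tangent to \<open>xv j\<close> and can be
    inverted.\<close>
  define t where "t j = subst p G (L j) + k j" for j
  have kC: "k j \<in> C n" if "j < n" for j using k[OF that] isid_subset[OF I] by blast
  have tC: "t j \<in> C n" if "j < n" for j
    using L[of j] GC kC[OF that] unfolding t_def Mid_def by (intro C_add C_subst) auto
  have t2: "ordge 2 (t j - xv j)" if "j < n" for j
  proof -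
    have "t j - xv j = - (xv j - (\<Sum>i<p. scl (c j i) (G i)) - k j)" unfolding t_def GL by simp
    then show ?thesis using ck[OF that] ordge_uminus by (metis (mono_tags, lifting) Mid_def mem_Collect_eq)
  qed
  obtain h where hC: "\<And>j. j < n \<Longrightarrow> h j \<in> C n" and h2: "\<And>j. j < n \<Longrightarrow> ordge 2 (h j - xv j)"
    and ht: "\<And>f. f \<in> C n \<Longrightarrow> subst n h (subst n t f) = f"
    and th: "\<And>f. f \<in> C n \<Longrightarrow> subst n t (subst n h f) = f"
    using unipotent_inverse[of n t] tC t2 by blast
  \<comment> \<open>The inverse of \<open>t\<close>, read in the linear forms \<open>L\<close>:
    substituting \<open>G\<close> turns \<open>L i\<close> into \<open>t i\<close> modulo
    \<open>I\<close>, so \<open>w j\<close> becomes \<open>xv j\<close>.\<close>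
  define w where "w j = subst n L (h j)" for j
  have h1: "ordge 1 (h j)" if "j < n" for j by (rule ordge_1_if_unipotent[OF h2[OF that]])
  have L1: "L i \<in> C p" "ordge 1 (L i)" for i using L[of i] by (auto simp: Mid_def)
  show ?thesis
  proof
    fix j assume j: "j < n"
    show "w j \<in> Mid p 1"
      unfolding w_def Mid_def using hC[OF j] h1[OF j] L1 by (auto intro!: C_subst subst_ordge)
    have "subst p G (w j) = subst n (\<lambda>i. subst p G (L i)) (h j)"
      unfolding w_def by (intro subst_comp L1 GC)
    moreover have "subst n (\<lambda>i. subst p G (L i)) (h j) - subst n t (h j) \<in> I"
    proof (rule isid_subst_diff[OF I hC[OF j]])
      fix i assume i: "i < n"
      show "subst p G (L i) \<in> C n" by (intro C_subst L1 GC)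
      show "ordge 1 (subst p G (L i))" by (intro subst_ordge L1 GC)
      show "t i \<in> C n" by (rule tC[OF i])
      show "ordge 1 (t i)" by (rule ordge_1_if_unipotent[OF t2[OF i]])
      show "subst p G (L i) - t i \<in> I" unfolding t_def using isid_uminus[OF I k[OF i]] by simp
    qed
    moreover have "subst n t (h j) = xv j"
      using th[OF C_xv[OF j]] subst_xv[of j n h] j h1[OF j] by simp
    ultimately show "subst p G (w j) - xv j \<in> I" by simp
  qed
qed

text \<open>In the extension of \<open>g\<close> by as few series as possible, a relation that involves an added variable
  linearly would allow this variable to be removed.\<close>

lemma minimal_extension:
  assumes I: "isid n I" and proper: "1 \<notin> I" and g: "\<And>i. i < m \<Longrightarrow> g i \<in> Mid n 1"
  obtains d G w where "\<And>i. i < m \<Longrightarrow> G i = g i" "\<And>i. i < m + d \<Longrightarrow> G i \<in> Mid n 1"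
    "\<And>f l. f \<in> C (m + d) \<Longrightarrow> subst (m + d) G f \<in> I \<Longrightarrow> l < d \<Longrightarrow> cf f (single1 (m + l)) = 0"
    "\<And>j. j < n \<Longrightarrow> w j \<in> Mid (m + d) 1" "\<And>j. j < n \<Longrightarrow> subst (m + d) G (w j) - xv j \<in> I"
proof -
  define P where "P d G \<longleftrightarrow> (\<forall>i<m. G i = g i) \<and> (\<forall>i<m+d. G i \<in> Mid n 1) \<and>
    cotangent_spanning n I (m + d) G" for d G
  \<comment> \<open>Adding all \<open>n\<close> variables always suffices, so a least number
    \<open>d\<close> exists.\<close>
  have "P n (\<lambda>i. if i < m then g i else xv (i - m))"
  proof -
    let ?G = "\<lambda>i. if i < m then g i else xv (i - m)"
    have "xv j \<in> ?G ` {..<m+n}" if "j < n" for j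
      using that by (intro rev_image_eqI[of "m + j"]) simp_all
    then have "xv ` {..<n} \<subseteq> ?G ` {..<m+n} \<union> I \<union> Mid n 2" by blast
    then have "cotangent_spanning n I (m + n) ?G"
      unfolding cotangent_spanning_def using pseries_vs.span_superset by (rule subset_trans)
    moreover have "?G i \<in> Mid n 1" if "i < m + n" for i
      using that g by (auto simp: Mid_def C_xv ordge_xv)
    ultimately show ?thesis by (simp add: P_def)
  qed
  then have ex: "\<exists>d G. P d G" by blast
  define d where "d = (LEAST d. \<exists>G. P d G)"
  obtain G where PG: "P d G" using LeastI_ex[OF ex] unfolding d_def by blast
  have min: "\<not> P d' G'" if "d' < d" for d' G' using not_less_Least that unfolding d_def by blast
  have G: "G i \<in> Mid n 1" if "i < m + d" for i using PG that unfolding P_def by blast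
  have GC: "G i \<in> C n" "ordge 1 (G i)" if "i < m + d" for i using G[OF that] by (auto simp: Mid_def)
  have ker: "cf f (single1 (m + l)) = 0"
    if f: "f \<in> C (m + d)" and fI: "subst (m + d) G f \<in> I" and l: "l < d" for f l
  proof (rule ccontr)
    assume nz: "cf f (single1 (m + l)) \<noteq> 0"
    define a where "a = cf f (single1 (m + l))"
    \<comment> \<open>Index \<open>m + l\<close> is freed by moving the last series into its
      place.\<close>
    define G' where "G' i = (if i = m + l then G (m + d - 1) else G i)" for i
    define W where "W = pseries_vs.span (G' ` {..<m + (d-1)} \<union> I \<union> Mid n 2)"
    have G'W: "G' i \<in> W" if "i < m + (d - 1)" for i
      unfolding W_def using that by (intro pseries_vs.span_base UnI1 imageI) simp
    have IW: "x \<in> W" if "x \<in> I \<union> Mid n 2" for x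
      unfolding W_def using that by (intro pseries_vs.span_base) blast
    have rest: "G i \<in> W" if "i < m + d" "i \<noteq> m + l" for i
    proof (cases "i = m + d - 1")
      case True
      then show ?thesis using G'W[of "m + l"] that l by (simp add: G'_def)
    next
      case False
      then show ?thesis using G'W[of i] that by (simp add: G'_def)
    qed
    have f0: "cf f 0 = 0"
    proof -
      have "lowdeg (m + d) 0 = {0}" by (auto simp: lowdeg_def mdeg_eq_0_iff)
      then have "cf (subst (m + d) G f) 0 = cf f 0" by (simp add: cf_subst cf_1)
      then show ?thesis using proper_ideal_cf_0[OF I proper fI] by simp
    qed
    \<comment> \<open>The linear terms of the relation give a linear dependence of the
      \<open>G i\<close> modulo \<open>I\<close> and order 2, which can be solved for
      \<open>G (m + l)\<close>.\<close>
    let ?s = "\<Sum>i<m+d. scl (cf f (single1 i)) (G i)"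
    have "subst (m + d) G f - ?s \<in> Mid n 2"
      using f f0 by (intro subst_linpart_approx G) (auto simp: Mid_def ordge_1_iff)
    then have "subst (m + d) G f \<in> W" "subst (m + d) G f - ?s \<in> W"
      using IW fI by blast+
    then have "subst (m + d) G f - (subst (m + d) G f - ?s) \<in> W"
      unfolding W_def by (rule pseries_vs.span_diff)
    then have "?s \<in> W" by simp
    moreover have "?s = scl a (G (m + l)) + (\<Sum>i\<in>{..<m+d} - {m+l}. scl (cf f (single1 i)) (G i))"
      using l unfolding a_def by (intro sum.remove) auto
    moreover have "(\<Sum>i\<in>{..<m+d} - {m+l}. scl (cf f (single1 i)) (G i)) \<in> W"
      unfolding W_def by (intro pseries_vs.span_sum pseries_vs.span_scale rest[unfolded W_def]) auto
    ultimately have "scl a (G (m + l)) \<in> W"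
      unfolding W_def by (simp add: pseries_vs.span_add_eq2)
    then have "scl (1 / a) (scl a (G (m + l))) \<in> W" unfolding W_def by (rule pseries_vs.span_scale)
    then have "G (m + l) \<in> W" using nz by (simp add: a_def)
    then have "G ` {..<m+d} \<subseteq> W" using rest by (metis image_subsetI lessThan_iff)
    then have "pseries_vs.span (G ` {..<m+d} \<union> I \<union> Mid n 2) \<subseteq> W"
      using IW unfolding W_def by (intro pseries_vs.span_minimal pseries_vs.subspace_span) blast
    then have "cotangent_spanning n I (m + (d - 1)) G'"
      using PG unfolding P_def cotangent_spanning_def W_def by (metis subset_trans)
    moreover have "G' i \<in> Mid n 1" if "i < m + (d - 1)" for i using that l by (auto intro: G simp: G'_def)
    moreover have "G' i = g i" if "i < m" for i using that PG by (simp add: P_def G'_def)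
    ultimately have "P (d - 1) G'" by (simp add: P_def)
    then show False using min[of "d - 1"] l by simp
  qed
  have span: "cotangent_spanning n I (m + d) G" using PG by (simp add: P_def)
  obtain w where "\<And>j. j < n \<Longrightarrow> w j \<in> Mid (m + d) 1" "\<And>j. j < n \<Longrightarrow> subst (m + d) G (w j) - xv j \<in> I"
    using cotangent_spanning_surj[OF I G span] by blast
  then show ?thesis using that[of G d w] ker G PG by (simp add: P_def)
qed

section \<open>Smooth algebras are relative power series algebras\<close>

lemma subst_isid_vimage:
  assumes K: "isid p K" and h: "\<And>i. i < n \<Longrightarrow> h i \<in> Mid p 1"
  shows "isid n {f \<in> C n. subst n h f \<in> K}"
proof (rule isidI)
  have o: "ordge 1 (h i)" "h i \<in> C p" if "i < n" for i using h[OF that] by (auto simp: Mid_def)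
  show "a * f \<in> {f \<in> C n. subst n h f \<in> K}" if "a \<in> C n" "f \<in> {f \<in> C n. subst n h f \<in> K}" for a f
    using that o by (auto simp: subst_mult intro!: C_mult isid_mult[OF K] C_subst)
qed (auto simp: subst_add isid_0[OF K] intro: C_add isid_add[OF K])

lemma subst_C_extend:
  assumes f: "f \<in> C m" and "m \<le> p" and h: "\<And>i. i < p \<Longrightarrow> ordge 1 (h i)"
  shows "subst p h f = subst m h f"
proof -
  have "subst p h (subst m xv f) = subst m (\<lambda>i. subst p h (xv i)) f"
    by (intro subst_comp ordge_xv h)
  also have "\<dots> = subst m h f"
    using \<open>m \<le> p\<close> by (intro subst_cong) (simp add: subst_xv h)
  finally show ?thesis by (simp add: subst_id[OF C_in_vars[OF f]])
qed

lemma cf_mult_lowest: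
  assumes f: "ordge k f" and \<alpha>: "mdeg \<alpha> = k"
  shows "cf (a * f) \<alpha> = cf a 0 * cf f \<alpha>"
proof -
  have "ordge 1 (a - scl (cf a 0) 1)" by (simp add: ordge_1_iff cf_1)
  then have "ordge (1 + k) ((a - scl (cf a 0) 1) * f)" using f by (rule ordge_mult)
  then have "cf ((a - scl (cf a 0) 1) * f) \<alpha> = 0" by (rule ordgeD) (simp add: \<alpha>)
  then show ?thesis by (simp add: left_diff_distrib scl_mult_left)
qed

text \<open>Multiplication scales the lowest coefficients by a constant term, so vanishing
  conditions on them define an ideal. The case \<open>k = 1\<close> controls linear terms in the
  added variables, the case \<open>k = 2\<close> the quadratic parts in the descent.\<close>

lemma isid_lowest_coeffs:
  "isid p {f \<in> Mid p k. \<forall>\<alpha>\<in>A. mdeg \<alpha> = k \<longrightarrow> cf f \<alpha> = 0}"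
proof (rule isidI)
  have M: "isid p (Mid p k)" by (rule isid_Mid)
  show "a * f \<in> {f \<in> Mid p k. \<forall>\<alpha>\<in>A. mdeg \<alpha> = k \<longrightarrow> cf f \<alpha> = 0}"
    if "a \<in> C p" "f \<in> {f \<in> Mid p k. \<forall>\<alpha>\<in>A. mdeg \<alpha> = k \<longrightarrow> cf f \<alpha> = 0}" for a f
  proof -
    have "ordge k f" using that by (simp add: Mid_def)
    then show ?thesis using that isid_mult[OF M] by (auto simp: cf_mult_lowest)
  qed
qed (auto simp: Mid_def intro: C_add ordge_add)

lemma Mid_antimono: "j \<le> k \<Longrightarrow> Mid p k \<subseteq> Mid p j"
  by (auto simp: Mid_def intro: ordge_mono)

lemma idsum_least: "isid n K \<Longrightarrow> I \<subseteq> K \<Longrightarrow> J \<subseteq> K \<Longrightarrow> idsum I J \<subseteq> K"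
  unfolding idsum_def by (blast intro: isid_add)

lemma xv_Mid: "i < n \<Longrightarrow> xv i \<in> Mid n 1"
  by (simp add: Mid_def C_xv ordge_xv)

lemma idgen_Mid_1:
  assumes "isid m J" "1 \<notin> J" "m \<le> p"
  shows "idgen p J \<subseteq> Mid p 1"
proof (rule idgen_least[OF isid_Mid], rule subsetI)
  fix f assume f: "f \<in> J"
  then have "cf f 0 = 0" by (rule proper_ideal_cf_0[OF assms(1,2)])
  then show "f \<in> Mid p 1"
    using isid_subset[OF assms(1) f] C_mono[OF assms(3)] by (auto simp: Mid_def ordge_1_iff)
qed

text \<open>Modulo the ideal of \<open>J\<close> and terms of high order, substituting \<open>v\<close> into \<open>G\<close> gives a unipotent
  automorphism that fixes the first \<open>m\<close> variables. It maps \<open>f\<close> to \<open>0\<close>, so \<open>f\<close> itself is \<open>0\<close>.\<close>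

lemma relation_approx:
  fixes m p J defines "Je \<equiv> idgen p J"
  assumes J: "isid m J" "1 \<notin> J" and mp: "m \<le> p" and I: "isid n I"
    and G: "\<And>i. i < p \<Longrightarrow> G i \<in> Mid n 1" and v: "\<And>j. j < n \<Longrightarrow> v j \<in> Mid p 1"
    and vI: "\<And>f. f \<in> I \<Longrightarrow> subst n v f \<in> idsum Je (Mid p k)"
    and vG: "\<And>i. i < m \<Longrightarrow> subst n v (G i) - xv i \<in> idsum Je (Mid p k)"
    and vG2: "\<And>i. i < p \<Longrightarrow> subst n v (G i) - xv i \<in> idsum Je (Mid p 2)"
    and f: "f \<in> C p" "subst p G f \<in> I"
  shows "f \<in> idsum Je (Mid p k)"
proof -
  let ?K = "idsum Je (Mid p k)"
  have JC: "J \<subseteq> C p" using isid_subset[OF J(1)] C_mono[OF mp] by blast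
  have Je: "isid p Je" unfolding Je_def by (rule isid_idgen[OF JC])
  have K: "isid p ?K" by (rule isid_idsum[OF Je isid_Mid])
  have GC: "G i \<in> C n" "ordge 1 (G i)" if "i < p" for i using G[OF that] by (auto simp: Mid_def)
  have vC: "v j \<in> C p" "ordge 1 (v j)" if "j < n" for j using v[OF that] by (auto simp: Mid_def)
  have "\<exists>q\<in>Mid p 2. subst n v (G i) - (xv i + q) \<in> Je" if i: "i < p" for i
  proof -
    obtain j q where jq: "j \<in> Je" "q \<in> Mid p 2" "subst n v (G i) - xv i = j + q"
      using vG2[OF i] unfolding idsum_def by blast
    then have "subst n v (G i) - (xv i + q) = j" by (simp add: algebra_simps)
    then show ?thesis using jq by (intro bexI[of _ q]) simp_all
  qed
  then obtain q where q: "\<And>i. i < p \<Longrightarrow> q i \<in> Mid p 2" "\<And>i. i < p \<Longrightarrow> subst n v (G i) - (xv i + q i) \<in> Je"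
    by metis
  define \<theta> where "\<theta> i = (if i < m then xv i else xv i + q i)" for i
  have \<theta>C: "\<theta> i \<in> C p" and \<theta>2: "ordge 2 (\<theta> i - xv i)" if "i < p" for i
    using q(1)[OF that] that by (auto simp: \<theta>_def Mid_def intro: C_xv C_add)
  have \<theta>1: "ordge 1 (\<theta> i)" if "i < p" for i by (rule ordge_1_if_unipotent[OF \<theta>2[OF that]])
  obtain h where hC: "\<And>i. i < p \<Longrightarrow> h i \<in> C p" and h2: "\<And>i. i < p \<Longrightarrow> ordge 2 (h i - xv i)"
    and h\<theta>: "\<And>f. f \<in> C p \<Longrightarrow> subst p h (subst p \<theta> f) = f"
    by (rule unipotent_inverse[OF \<theta>C \<theta>2]) blast+
  have h1: "ordge 1 (h i)" if "i < p" for i by (rule ordge_1_if_unipotent[OF h2[OF that]])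
  have hx: "h i = xv i" if "i < m" for i
  proof -
    have i: "i < p" using that mp by simp
    have "subst p h (subst p \<theta> (xv i)) = xv i" by (rule h\<theta>[OF C_xv[OF i]])
    moreover have "subst p \<theta> (xv i) = xv i" using subst_xv[of i p \<theta>, OF i \<theta>1[OF i]] that by (simp add: \<theta>_def)
    ultimately show ?thesis using subst_xv[of i p h, OF i h1[OF i]] by simp
  qed
  have "subst p \<theta> f \<in> ?K"
  proof -
    have "subst p (\<lambda>i. subst n v (G i)) f = subst n v (subst p G f)"
      by (rule subst_comp[symmetric]) (use GC vC in auto)
    then have "subst p (\<lambda>i. subst n v (G i)) f \<in> ?K" using vI[OF f(2)] by simp
    moreover have "subst p (\<lambda>i. subst n v (G i)) f - subst p \<theta> f \<in> ?K"
    proof (rule isid_subst_diff[OF K f(1)])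
      fix i assume i: "i < p"
      show "subst n v (G i) \<in> C p" by (intro C_subst GC vC i)
      show "ordge 1 (subst n v (G i))" by (intro subst_ordge GC vC i)
      show "subst n v (G i) - \<theta> i \<in> ?K"
        using vG[of i] idsum_left[OF isid_Mid q(2)[OF i]] by (simp add: \<theta>_def)
    qed (use \<theta>C \<theta>1 in auto)
    ultimately have "subst p (\<lambda>i. subst n v (G i)) f -
        (subst p (\<lambda>i. subst n v (G i)) f - subst p \<theta> f) \<in> ?K" by (rule isid_diff[OF K])
    then show ?thesis by simp
  qed
  \<comment> \<open>The inverse \<open>h\<close> fixes the generators of \<open>Je\<close> and
    preserves orders, so it maps \<open>?K\<close> into itself and \<theta> can be undone.\<close>
  moreover have "?K \<subseteq> {f \<in> C p. subst p h f \<in> ?K}"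
  proof (rule idsum_least)
    show iso: "isid p {f \<in> C p. subst p h f \<in> ?K}"
      by (rule subst_isid_vimage[OF K]) (use hC h1 in \<open>auto simp: Mid_def\<close>)
    show "Mid p k \<subseteq> {f \<in> C p. subst p h f \<in> ?K}"
      using hC h1 by (auto simp: Mid_def intro!: idsum_right[OF Je] C_subst subst_ordge)
    show "Je \<subseteq> {f \<in> C p. subst p h f \<in> ?K}"
      unfolding Je_def
    proof (rule idgen_least[OF iso[unfolded Je_def]], rule subsetI)
      fix f assume f: "f \<in> J"
      have "subst p h f = subst m h f" by (rule subst_C_extend[OF isid_subset[OF J(1) f] mp h1])
      also have "\<dots> = subst m xv f" by (rule subst_cong) (rule hx)
      also have "\<dots> = f" by (rule subst_id[OF C_in_vars[OF isid_subset[OF J(1) f]]])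
      finally show "f \<in> {f \<in> C p. subst p h f \<in> idsum (idgen p J) (Mid p k)}"
        using JC f idsum_left[OF isid_Mid] idgen_superset[of J p] by auto
    qed
  qed
  ultimately have "subst p h (subst p \<theta> f) \<in> ?K" by blast
  then show ?thesis by (simp add: h\<theta> f(1))
qed

text \<open>Each step passes from order \<open>k + 2\<close> to order \<open>k + 3\<close>; the
  maximal ideal supplies the one order by which the two test ideals differ. The structure map sends
  the old variables to themselves. The new lift agrees with the old one modulo the larger ideal, so
  the first-order condition on \<open>G\<close> survives.\<close>

lemma lifting_approximations:
  fixes m p J defines "Je \<equiv> idgen p J"
  assumes J: "isid m J" "1 \<notin> J" and mp: "m \<le> p" and I: "isid n I"
    and lifting: "lifting m J n I g"
    and G: "\<And>i. i < p \<Longrightarrow> G i \<in> Mid n 1"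
    and v: "\<And>j. j < n \<Longrightarrow> v j \<in> Mid p 1"
    and vI: "\<And>f. f \<in> I \<Longrightarrow> subst n v f \<in> idsum Je (Mid p 2)"
    and vg: "\<And>i. i < m \<Longrightarrow> subst n v (g i) - xv i \<in> idsum Je (Mid p 2)"
    and vG: "\<And>i. i < p \<Longrightarrow> subst n v (G i) - xv i \<in> idsum Je (Mid p 2)"
  shows "\<exists>v. (\<forall>j<n. v j \<in> Mid p 1) \<and> (\<forall>f\<in>I. subst n v f \<in> idsum Je (Mid p (k + 2))) \<and>
    (\<forall>i<m. subst n v (g i) - xv i \<in> idsum Je (Mid p (k + 2))) \<and>
    (\<forall>i<p. subst n v (G i) - xv i \<in> idsum Je (Mid p 2))"
proof (induction k)
  case 0
  then show ?case using v vI vg vG by (intro exI[of _ v]) (simp add: numeral_2_eq_2)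
next
  case (Suc k)
  define K where "K k = idsum Je (Mid p k)" for k
  have JC: "J \<subseteq> C p" using isid_subset[OF J(1)] C_mono[OF mp] by blast
  have Je: "isid p Je" unfolding Je_def by (rule isid_idgen[OF JC])
  have Je1: "Je \<subseteq> Mid p 1" unfolding Je_def by (rule idgen_Mid_1[OF J mp])
  have K: "isid p (K k)" for k unfolding K_def by (rule isid_idsum[OF Je isid_Mid])
  have JeK: "Je \<subseteq> K k" for k unfolding K_def using idsum_left[OF isid_Mid] by blast
  have MK: "Mid p k \<subseteq> K k" for k unfolding K_def using idsum_right[OF Je] by blast
  have K_mono: "K k \<subseteq> K j" if "j \<le> k" for j k
    using idsum_least[OF K JeK, of "Mid p k" j] Mid_antimono[OF that] MK[of j] unfolding K_def by blast
  obtain v where v: "\<forall>j<n. v j \<in> Mid p 1" "\<forall>f\<in>I. subst n v f \<in> K (k + 2)"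
    "\<forall>i<m. subst n v (g i) - xv i \<in> K (k + 2)" "\<forall>i<p. subst n v (G i) - xv i \<in> K 2"
    using Suc.IH unfolding K_def by blast
  have "isid p (K (k+2)) \<and> isid p (K (k+3)) \<and> K (k+3) \<subseteq> K (k+2) \<and> 1 \<notin> K (k+2) \<and> Mid p (k+3) \<subseteq> K (k+3) \<and>
       (\<forall>a\<in>Mid p 1. \<forall>x\<in>K (k+2). a * x \<in> K (k+3)) \<and>
       (\<forall>i<m. xv i \<in> Mid p 1) \<and> (\<forall>j<n. v j \<in> Mid p 1) \<and>
       (\<forall>f\<in>J. subst m xv f \<in> K (k+3)) \<and> (\<forall>f\<in>I. subst n v f \<in> K (k+2)) \<and>
       (\<forall>i<m. subst n v (g i) - xv i \<in> K (k+2))"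
  proof (intro conjI K MK ballI)
    show "K (k+3) \<subseteq> K (k+2)" by (rule K_mono) simp
    have "K (k+2) \<subseteq> Mid p 1"
      unfolding K_def by (rule idsum_least[OF isid_Mid Je1 Mid_antimono]) simp
    then show "1 \<notin> K (k+2)" by (auto simp: Mid_def ordge_1_iff cf_1)
    show "\<forall>i<m. xv i \<in> Mid p 1" using mp by (simp add: xv_Mid)
  next
    fix a x assume a: "a \<in> Mid p 1" and "x \<in> K (k+2)"
    then obtain y z where yz: "x = y + z" "y \<in> Je" "z \<in> Mid p (k+2)" unfolding K_def idsum_def by blast
    have "ordge (1 + (k+2)) (a * z)" using a yz(3) by (intro ordge_mult) (simp_all add: Mid_def)
    moreover have "1 + (k+2) = k + 3" by simp
    ultimately have "a * z \<in> Mid p (k+3)"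
      using a yz(3) unfolding Mid_def by (metis (lifting) C_mult mem_Collect_eq)
    moreover have "a * y \<in> Je" using a yz(2) by (intro isid_mult[OF Je]) (simp_all add: Mid_def)
    ultimately have "a * y \<in> K (k+3)" "a * z \<in> K (k+3)" using JeK MK by blast+
    then show "a * x \<in> K (k+3)" unfolding yz(1) distrib_left by (rule isid_add[OF K])
  next
    fix f assume f: "f \<in> J"
    then have "subst m xv f = f" by (intro subst_id C_in_vars isid_subset[OF J(1)])
    then show "subst m xv f \<in> K (k+3)" using f idgen_superset[of J p] JeK unfolding Je_def by auto
  qed (use v in auto)
  from lifting[unfolded lifting_def, rule_format, OF this]
  obtain v' where v': "\<forall>j<n. v' j \<in> Mid p 1 \<and> v' j - v j \<in> K (k+2)"
      "\<forall>f\<in>I. subst n v' f \<in> K (k+3)" "\<forall>i<m. subst n v' (g i) - xv i \<in> K (k+3)"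
    by blast
  have "subst n v' (G i) - xv i \<in> K 2" if i: "i < p" for i
  proof -
    have "v' j - v j \<in> K 2" if "j < n" for j using v'(1) that K_mono[of 2 "k+2"] by auto
    then have "subst n v' (G i) - subst n v (G i) \<in> K 2"
      using v v' G[OF i] by (intro isid_subst_diff[OF K]) (auto simp: Mid_def)
    from isid_add[OF K this v(4)[rule_format, OF i]] show ?thesis by simp
  qed
  moreover have eq: "Suc k + 2 = k + 3" by simp
  ultimately show ?case using v' unfolding K_def eq by blast
qed

lemma subst_roundtrip:
  assumes I: "isid n I" and G: "\<And>i. i < p \<Longrightarrow> G i \<in> Mid n 1" and w: "\<And>j. j < n \<Longrightarrow> w j \<in> Mid p 1"
    and Gw: "\<And>j. j < n \<Longrightarrow> subst p G (w j) - xv j \<in> I" and h: "h \<in> C n"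
  shows "subst p G (subst n w h) - h \<in> I"
proof -
  have GC: "G i \<in> C n" "ordge 1 (G i)" if "i < p" for i using G that by (auto simp: Mid_def)
  have wC: "w j \<in> C p" "ordge 1 (w j)" if "j < n" for j using w[OF that] by (auto simp: Mid_def)
  have "subst p G (subst n w h) = subst n (\<lambda>j. subst p G (w j)) h"
    by (rule subst_comp) (use wC GC in auto)
  moreover have "subst n (\<lambda>j. subst p G (w j)) h - subst n xv h \<in> I"
    using Gw by (intro isid_subst_diff[OF I h] C_subst subst_ordge wC GC C_xv ordge_xv) auto
  ultimately show ?thesis by (simp add: subst_id[OF C_in_vars[OF h]])
qed

theorem lifting_relative_power_series:
  assumes J: "isid m J" "1 \<notin> J" and I: "isid n I" "1 \<notin> I"
    and g: "\<And>i. i < m \<Longrightarrow> g i \<in> Mid n 1" and gJ: "\<And>f. f \<in> J \<Longrightarrow> subst m g f \<in> I"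
    and lifting: "lifting m J n I g"
  obtains d G w where "\<And>i. i < m + d \<Longrightarrow> G i \<in> Mid n 1"
    "\<And>f. f \<in> C (m + d) \<Longrightarrow> subst (m + d) G f \<in> I \<longleftrightarrow> f \<in> idgen (m + d) J"
    "\<And>j. j < n \<Longrightarrow> w j \<in> Mid (m + d) 1" "\<And>j. j < n \<Longrightarrow> subst (m + d) G (w j) - xv j \<in> I"
proof -
  obtain d G0 w where G0g: "\<And>i. i < m \<Longrightarrow> G0 i = g i" and G0: "\<And>i. i < m + d \<Longrightarrow> G0 i \<in> Mid n 1"
    and ker: "\<And>f l. f \<in> C (m + d) \<Longrightarrow> subst (m + d) G0 f \<in> I \<Longrightarrow> l < d \<Longrightarrow> cf f (single1 (m + l)) = 0"
    and w: "\<And>j. j < n \<Longrightarrow> w j \<in> Mid (m + d) 1" and G0w: "\<And>j. j < n \<Longrightarrow> subst (m + d) G0 (w j) - xv j \<in> I"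
    by (rule minimal_extension[of n I m g, OF I g]) blast+
  define p where "p = m + d"
  have mp: "m \<le> p" by (simp add: p_def)
  have G0C: "G0 i \<in> C n" "ordge 1 (G0 i)" if "i < p" for i using G0 that by (auto simp: Mid_def p_def)
  have wC: "w j \<in> C p" "ordge 1 (w j)" if "j < n" for j using w[OF that] by (auto simp: Mid_def p_def)
  have gC: "g i \<in> C n" "ordge 1 (g i)" if "i < m" for i using g[OF that] by (auto simp: Mid_def)
  define Je where "Je = idgen p J"
  define K where "K k = idsum Je (Mid p k)" for k
  have JC: "J \<subseteq> C p" using isid_subset[OF J(1)] C_mono[OF mp] by blast
  have Je: "isid p Je" unfolding Je_def by (rule isid_idgen[OF JC])
  have K: "isid p (K k)" for k unfolding K_def by (rule isid_idsum[OF Je isid_Mid])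
  have JJe: "J \<subseteq> Je" unfolding Je_def by (rule idgen_superset)
  have JeK: "Je \<subseteq> K k" for k unfolding K_def using idsum_left[OF isid_Mid] by blast
  have MK: "Mid p k \<subseteq> K k" for k unfolding K_def using idsum_right[OF Je] by blast
  \<comment> \<open>The first test ideal. By minimality it contains all relations of
    \<open>G0\<close>, so \<open>w\<close>, which inverts \<open>G0\<close> only up to relations,
    gives a homomorphism modulo \<open>K1\<close>.\<close>
  define K1 where "K1 = {f \<in> Mid p 1. \<forall>\<alpha>\<in>(\<lambda>l. single1 (m + l)) ` {..<d}. mdeg \<alpha> = 1 \<longrightarrow> cf f \<alpha> = 0}"
  have K1: "isid p K1" unfolding K1_def by (rule isid_lowest_coeffs)
  have K1_iff: "f \<in> K1 \<longleftrightarrow> f \<in> Mid p 1 \<and> (\<forall>l<d. cf f (single1 (m + l)) = 0)" for f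
    by (auto simp: K1_def)
  have kerK1: "f \<in> K1" if "f \<in> C p" "subst p G0 f \<in> I" for f
  proof -
    have "lowdeg p 0 = {0}" by (auto simp: lowdeg_def mdeg_eq_0_iff)
    then have "cf (subst p G0 f) 0 = cf f 0" by (simp add: cf_subst cf_1)
    then have "cf f 0 = 0" using proper_ideal_cf_0[OF I that(2)] by simp
    then show ?thesis using that ker by (auto simp: K1_iff Mid_def p_def ordge_1_iff)
  qed
  have JK1: "J \<subseteq> K1"
  proof
    fix f assume f: "f \<in> J"
    then have "f \<in> C m" by (rule isid_subset[OF J(1)])
    then have "cf f (single1 (m + l)) = 0" for l by (rule cf_single1_beyond) (rule le_add1)
    then show "f \<in> K1" using f JC proper_ideal_cf_0[OF J f] by (auto simp: K1_iff Mid_def ordge_1_iff)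
  qed
  have K21: "K 2 \<subseteq> K1"
    unfolding K_def
  proof (rule idsum_least[OF K1])
    show "Je \<subseteq> K1" unfolding Je_def by (rule idgen_least[OF K1 JK1])
    show "Mid p 2 \<subseteq> K1" by (auto simp: K1_iff Mid_def ordge_2_iff ordge_1_iff)
  qed
  have G0_w: "subst p G0 (subst n w h) - h \<in> I" if h: "h \<in> C n" for h
    unfolding p_def by (rule subst_roundtrip[OF I(1) G0 w G0w h])
  have wG0: "subst n w (G0 i) - xv i \<in> K1" if i: "i < p" for i
  proof (rule kerK1)
    show "subst n w (G0 i) - xv i \<in> C p" by (intro C_diff C_subst G0C wC C_xv i)
    show "subst p G0 (subst n w (G0 i) - xv i) \<in> I"
      using G0_w[OF G0C(1)[OF i]] i by (simp add: subst_diff subst_xv G0C)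
  qed
  \<comment> \<open>The first lift goes from \<open>K1\<close> to \<open>K 2\<close>, which is
    permitted because \<open>K1\<close> times the maximal ideal consists of series of order
    2.\<close>
  have "isid p K1 \<and> isid p (K 2) \<and> K 2 \<subseteq> K1 \<and> 1 \<notin> K1 \<and> Mid p 2 \<subseteq> K 2 \<and>
       (\<forall>a\<in>Mid p 1. \<forall>x\<in>K1. a * x \<in> K 2) \<and>
       (\<forall>i<m. xv i \<in> Mid p 1) \<and> (\<forall>j<n. w j \<in> Mid p 1) \<and>
       (\<forall>f\<in>J. subst m xv f \<in> K 2) \<and> (\<forall>f\<in>I. subst n w f \<in> K1) \<and>
       (\<forall>i<m. subst n w (g i) - xv i \<in> K1)"
  proof (intro conjI K K1 K21 MK ballI)
    show "1 \<notin> K1" by (simp add: K1_iff Mid_def ordge_1_iff cf_1)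
    show "\<forall>i<m. xv i \<in> Mid p 1" using mp by (simp add: xv_Mid)
    show "\<forall>j<n. w j \<in> Mid p 1" using w by (simp add: p_def)
    show "\<forall>i<m. subst n w (g i) - xv i \<in> K1"
    proof (intro allI impI)
      fix i assume "i < m"
      then show "subst n w (g i) - xv i \<in> K1" using wG0[of i] G0g[of i] mp by simp
    qed
  next
    fix a x assume "a \<in> Mid p 1" and "x \<in> K1"
    then have "a * x \<in> Mid p 2"
      using ordge_mult[of 1 a 1 x] by (simp add: K1_iff Mid_def C_mult numeral_2_eq_2)
    then show "a * x \<in> K 2" using MK by blast
  next
    fix f assume f: "f \<in> J"
    then have "subst m xv f = f" by (intro subst_id C_in_vars isid_subset[OF J(1)])
    then show "subst m xv f \<in> K 2" using f JJe JeK by auto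
  next
    fix f assume f: "f \<in> I"
    have fC: "f \<in> C n" by (rule isid_subset[OF I(1) f])
    show "subst n w f \<in> K1"
    proof (rule kerK1)
      show "subst n w f \<in> C p" by (intro C_subst fC wC)
      show "subst p G0 (subst n w f) \<in> I" using isid_add[OF I(1) G0_w[OF fC] f] by simp
    qed
  qed
  from lifting[unfolded lifting_def, rule_format, OF this]
  obtain v where v: "\<forall>j<n. v j \<in> Mid p 1 \<and> v j - w j \<in> K1"
      "\<forall>f\<in>I. subst n v f \<in> K 2" "\<forall>i<m. subst n v (g i) - xv i \<in> K 2"
    by blast
  define z where "z i = subst n v (G0 i) - xv i" for i
  have z: "z i \<in> K1" if i: "i < p" for i
  proof -
    have "subst n v (G0 i) - subst n w (G0 i) \<in> K1"
      using v wC by (intro isid_subst_diff[OF K1 G0C(1)[OF i]]) (auto simp: Mid_def)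
    from isid_add[OF K1 this wG0[OF i]] show ?thesis by (simp add: z_def)
  qed
  define c where "c i k = cf (z i) (single1 k)" for i k
  \<comment> \<open>Over \<open>C m / J\<close> the lift sends the added variables to themselves only up to linear terms in the
    old ones. Shearing them off makes it the identity to first order.\<close>
  define G where "G i = (if i < m then g i else G0 i - (\<Sum>k<m. scl (c i k) (g k)))" for i
  \<comment> \<open>The inverse shear: substituting \<open>G\<close> into \<open>s\<close> returns
    \<open>G0\<close>, so the surjectivity witnessed by \<open>w\<close> carries over to
    \<open>G\<close>.\<close>
  define s where "s i = (if i < m then xv i else xv i + (\<Sum>k<m. scl (c i k) (xv k)))" for i
  have G: "G i \<in> Mid n 1" if i: "i < p" for i
    using G0C[OF i] gC by (auto simp: G_def Mid_def intro!: C_diff C_sum C_scl ordge_diff ordge_sum ordge_scl)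
  have GC: "G i \<in> C n" "ordge 1 (G i)" if "i < p" for i using G[OF that] by (auto simp: Mid_def)
  have sC: "s i \<in> C p" "ordge 1 (s i)" if "i < p" for i
    using that mp by (auto simp: s_def intro!: C_add C_sum C_scl C_xv ordge_add ordge_sum ordge_scl ordge_xv)
  have Gx: "subst p G (xv i) = G i" if "i < p" for i using that by (intro subst_xv GC)
  have Gs: "subst p G (s i) = G0 i" if i: "i < p" for i
  proof (cases "i < m")
    case True
    then show ?thesis using Gx[OF i] by (simp add: s_def G_def G0g)
  next
    case False
    have "subst p G (\<Sum>k<m. scl (c i k) (xv k)) = (\<Sum>k<m. scl (c i k) (g k))"
      unfolding subst_sum subst_scl by (intro sum.cong refl) (use Gx mp in \<open>simp add: G_def\<close>)
    then show ?thesis using False Gx[OF i] by (simp add: s_def subst_add G_def)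
  qed
  have vG: "subst n v (G i) - xv i \<in> K 2" if i: "i < p" for i
  proof (cases "i < m")
    case True
    then show ?thesis using v(3) by (simp add: G_def)
  next
    case False
    \<comment> \<open>Since \<open>z i\<close> lies in \<open>K1\<close>, its linear part involves
      old variables only, and this is what the shear subtracts.\<close>
    have "linpart p (z i) = (\<Sum>k<m. scl (c i k) (xv k))"
      unfolding linpart_def c_def
    proof (rule sum.mono_neutral_right)
      show "\<forall>k\<in>{..<p} - {..<m}. scl (cf (z i) (single1 k)) (xv k) = 0"
      proof
        fix k assume "k \<in> {..<p} - {..<m}"
        then have "k - m < d" "m + (k - m) = k" by (auto simp: p_def)
        then have "cf (z i) (single1 k) = 0" using z[OF i] unfolding K1_iff by metis
        then show "scl (cf (z i) (single1 k)) (xv k) = 0" by simp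
      qed
    qed (use mp in auto)
    moreover have "z i \<in> Mid p 1" using z[OF i] by (simp add: K1_iff)
    ultimately have "z i - (\<Sum>k<m. scl (c i k) (xv k)) \<in> Mid p 2" using linpart_approx by metis
    then have "z i - (\<Sum>k<m. scl (c i k) (xv k)) \<in> K 2" using MK by blast
    moreover have "(\<Sum>k<m. scl (c i k) (subst n v (g k) - xv k)) \<in> K 2"
      using v(3) by (intro isid_sum[OF K] isid_scl[OF K]) auto
    ultimately have "z i - (\<Sum>k<m. scl (c i k) (xv k)) - (\<Sum>k<m. scl (c i k) (subst n v (g k) - xv k)) \<in> K 2"
      by (rule isid_diff[OF K])
    moreover have "subst n v (G i) - xv i = z i - (\<Sum>k<m. scl (c i k) (subst n v (g k)))"
      using False by (simp add: G_def subst_diff subst_sum subst_scl z_def)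
    ultimately show ?thesis
      by (simp add: pseries_vs.scale_right_diff_distrib sum_subtractf)
  qed
  \<comment> \<open>The lifts \<open>v'\<close> for different \<open>k\<close> may be unrelated.
    Each of them puts \<open>f\<close> into \<open>Je\<close> up to order \<open>k + 2\<close>, and
    \<open>krull\<close> needs no more.\<close>
  have ker_le: "f \<in> Je" if f: "f \<in> C p" "subst p G f \<in> I" for f
  proof (rule krull[OF Je f(1)])
    fix k
    have v1: "v j \<in> Mid p 1" if "j < n" for j using v(1) that by blast
    have "\<exists>v'. (\<forall>j<n. v' j \<in> Mid p 1) \<and> (\<forall>f\<in>I. subst n v' f \<in> K (k + 2)) \<and>
      (\<forall>i<m. subst n v' (g i) - xv i \<in> K (k + 2)) \<and> (\<forall>i<p. subst n v' (G i) - xv i \<in> K 2)"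
      unfolding K_def Je_def
      by (rule lifting_approximations[OF J mp I(1) lifting, where v = v])
        (use G v1 v(2,3) vG in \<open>auto simp: K_def Je_def\<close>)
    then obtain v' where v': "\<forall>j<n. v' j \<in> Mid p 1" "\<forall>f\<in>I. subst n v' f \<in> K (k + 2)"
      "\<forall>i<m. subst n v' (g i) - xv i \<in> K (k + 2)" "\<forall>i<p. subst n v' (G i) - xv i \<in> K 2"
      by blast
    have "f \<in> K (k + 2)"
      unfolding K_def Je_def
      by (rule relation_approx[OF J mp I(1), where G = G and v = v']) (use G v' f in \<open>auto simp: K_def Je_def G_def\<close>)
    then obtain a b where "a \<in> Je" "b \<in> Mid p (k + 2)" "f = a + b" unfolding K_def idsum_def by blast
    then show "\<exists>a\<in>Je. ordge k (f - a)"
      by (intro bexI[of _ a]) (auto simp: Mid_def intro: ordge_mono)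
  qed
  have ker_ge: "subst p G f \<in> I" if "f \<in> Je" for f
  proof -
    have "Je \<subseteq> {f \<in> C p. subst p G f \<in> I}"
      unfolding Je_def
    proof (rule idgen_least[OF subst_isid_vimage[OF I(1) G]], simp, rule subsetI)
      fix f assume f: "f \<in> J"
      have "subst p G f = subst m G f" by (rule subst_C_extend[OF isid_subset[OF J(1) f] mp GC(2)])
      also have "\<dots> = subst m g f" by (rule subst_cong) (simp add: G_def)
      finally show "f \<in> {f \<in> C p. subst p G f \<in> I}" using gJ[OF f] JC f by auto
    qed
    then show ?thesis using that by blast
  qed
  show ?thesis
  proof (rule that[of d G "\<lambda>j. subst p s (w j)", folded p_def])
    fix f assume "f \<in> C p"
    then show "subst p G f \<in> I \<longleftrightarrow> f \<in> idgen p J" using ker_le ker_ge by (auto simp: Je_def)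
  next
    fix j assume j: "j < n"
    show "subst p s (w j) \<in> Mid p 1" using wC[OF j] sC by (auto simp: Mid_def intro: C_subst subst_ordge)
    have "subst p G (subst p s (w j)) = subst p (\<lambda>i. subst p G (s i)) (w j)"
      by (intro subst_comp sC GC)
    also have "\<dots> = subst p G0 (w j)" by (rule subst_cong) (rule Gs)
    finally show "subst p G (subst p s (w j)) - xv j \<in> I" using G0w[OF j] by (simp add: p_def)
  qed (rule G)
qed

section \<open>Changing presentations\<close>

lemma presents_subst:
  assumes S: "presents n I S \<pi>" and G: "\<And>i. i < p \<Longrightarrow> G i \<in> Mid n 1"
    and w: "\<And>j. j < n \<Longrightarrow> w j \<in> Mid p 1" and Gw: "\<And>j. j < n \<Longrightarrow> subst p G (w j) - xv j \<in> I"
  shows "presents p {f \<in> C p. subst p G f \<in> I} S (\<lambda>f. \<pi> (subst p G f))"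
proof -
  interpret S: series_image n S \<pi> by (rule presents_image[OF S])
  have I: "isid n I" by (rule presents_isid[OF S])
  have GC: "subst p G f \<in> C n" if "f \<in> C p" for f
    using that G by (intro C_subst) (auto simp: Mid_def)
  have wC: "subst n w h \<in> C p" if "h \<in> C n" for h
    using that w by (intro C_subst) (auto simp: Mid_def)
  have "series_image p S (\<lambda>f. \<pi> (subst p G f))"
  proof
    show "complex_algebra S" by (rule S.alg)
    show "series_hom p S (\<lambda>f. \<pi> (subst p G f))" by (rule series_hom_subst[OF S.series_image_axioms G])
    show "(\<lambda>f. \<pi> (subst p G f)) ` C p = carrier S"
    proof
      show "(\<lambda>f. \<pi> (subst p G f)) ` C p \<subseteq> carrier S" using GC by auto
      show "carrier S \<subseteq> (\<lambda>f. \<pi> (subst p G f)) ` C p"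
      proof
        fix a assume "a \<in> carrier S"
        then obtain h where h: "h \<in> C n" "a = \<pi> h" by (rule S.obtain_series)
        have "subst p G (subst n w h) - h \<in> I" by (rule subst_roundtrip[OF I G w Gw h(1)])
        then have "\<pi> (subst p G (subst n w h)) = a"
          using presents_eq[OF S GC[OF wC[OF h(1)]] h(1)] h(2) by simp
        then show "a \<in> (\<lambda>f. \<pi> (subst p G f)) ` C p" using wC[OF h(1)] by blast
      qed
    qed
  qed
  then show ?thesis
    unfolding presents_def using presents_zero[OF S GC] presents_proper[OF S] by auto
qed

text \<open>\<open>minimal_extension\<close> with no series given in advance: in a minimal
  generating system of the maximal ideal every variable counts as added, so no relation has a linear
  term.\<close>

lemma minimal_presentation:
  assumes S: "presents n I S \<pi>"
  obtains p K \<pi>' where "presents p K S \<pi>'" "K \<subseteq> Mid p 2"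
proof -
  have I: "isid n I" "1 \<notin> I" by (rule presents_isid[OF S], rule presents_proper[OF S])
  have "\<exists>d G w. (\<forall>i<d. G i \<in> Mid n 1) \<and> (\<forall>f l. f \<in> C d \<longrightarrow> subst d G f \<in> I \<longrightarrow> l < d \<longrightarrow> cf f (single1 l) = 0) \<and>
     (\<forall>j<n. w j \<in> Mid d 1) \<and> (\<forall>j<n. subst d G (w j) - xv j \<in> I)"
    by (rule minimal_extension[of n I 0 xv, OF I]) (simp, simp, blast)
  then obtain p G w where G: "\<And>i. i < p \<Longrightarrow> G i \<in> Mid n 1"
    and ker: "\<And>f l. f \<in> C p \<Longrightarrow> subst p G f \<in> I \<Longrightarrow> l < p \<Longrightarrow> cf f (single1 l) = 0"
    and w: "\<And>j. j < n \<Longrightarrow> w j \<in> Mid p 1" "\<And>j. j < n \<Longrightarrow> subst p G (w j) - xv j \<in> I"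
    by blast
  let ?K = "{f \<in> C p. subst p G f \<in> I}"
  have K: "presents p ?K S (\<lambda>f. \<pi> (subst p G f))" by (rule presents_subst[OF S G w])
  have "?K \<subseteq> Mid p 2"
  proof
    fix f assume f: "f \<in> ?K"
    then have "cf f 0 = 0" by (rule proper_ideal_cf_0[OF presents_isid[OF K] presents_proper[OF K]])
    moreover have "cf f (single1 l) = 0" for l
      using f ker[of f l] cf_single1_beyond[of f p l] by (cases "l < p") auto
    ultimately show "f \<in> Mid p 2" using f by (simp add: Mid_def ordge_2_iff)
  qed
  then show ?thesis using K that by blast
qed

theorem formally_smooth_presents:
  assumes smooth: "formally_smooth R S \<psi>" and R: "presents m J R \<pi>R" and S: "presents n I S \<pi>S"
  obtains d \<pi> where "presents (m + d) (idgen (m + d) J) S \<pi>"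
proof -
  have "\<psi> \<in> algebra_hom R S" using smooth by (simp add: formally_smooth_def local_algebra_hom_def)
  then obtain g where g: "\<And>i. i < m \<Longrightarrow> g i \<in> Mid n 1"
    and \<psi>: "\<And>f. f \<in> C m \<Longrightarrow> \<psi> (\<pi>R f) = \<pi>S (subst m g f)"
    using presents_hom_subst[OF R S] by blast
  have J: "isid m J" "1 \<notin> J" by (rule presents_isid[OF R], rule presents_proper[OF R])
  have I: "isid n I" "1 \<notin> I" by (rule presents_isid[OF S], rule presents_proper[OF S])
  have gJ: "subst m g f \<in> I" if f: "f \<in> J" for f
  proof -
    have fC: "f \<in> C m" by (rule isid_subset[OF J(1) f])
    have "\<pi>R f = \<pi>R 0" using presents_eq[OF R fC C_0] f by simp
    then have "\<pi>S (subst m g f) = \<pi>S 0" using \<psi>[OF fC] \<psi>[OF C_0] by simp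
    moreover have "subst m g f \<in> C n" using g fC by (intro C_subst) (auto simp: Mid_def)
    ultimately show ?thesis using presents_eq[OF S _ C_0] by auto
  qed
  have L: "lifting m J n I g" by (rule formally_smooth_lifting[OF smooth R S g \<psi>])
  have "\<exists>d G w. (\<forall>i<m+d. G i \<in> Mid n 1) \<and>
      (\<forall>f\<in>C (m + d). subst (m + d) G f \<in> I \<longleftrightarrow> f \<in> idgen (m + d) J) \<and>
      (\<forall>j<n. w j \<in> Mid (m + d) 1) \<and> (\<forall>j<n. subst (m + d) G (w j) - xv j \<in> I)"
    by (rule lifting_relative_power_series[OF J I g gJ L]) blast+
  then obtain d G w where G: "\<And>i. i < m + d \<Longrightarrow> G i \<in> Mid n 1"
    and ker: "\<And>f. f \<in> C (m + d) \<Longrightarrow> subst (m + d) G f \<in> I \<longleftrightarrow> f \<in> idgen (m + d) J"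
    and w: "\<And>j. j < n \<Longrightarrow> w j \<in> Mid (m + d) 1" "\<And>j. j < n \<Longrightarrow> subst (m + d) G (w j) - xv j \<in> I"
    by blast
  have "J \<subseteq> C (m + d)" using isid_subset[OF J(1)] C_mono[of m "m + d"] by auto
  then have "idgen (m + d) J \<subseteq> C (m + d)" using isid_subset[OF isid_idgen] by blast
  then have "{f \<in> C (m + d). subst (m + d) G f \<in> I} = idgen (m + d) J" using ker by blast
  then show ?thesis using presents_subst[OF S G w] that by metis
qed

text \<open>Lets the quadrics of \<open>Y\<close> be reused as generators after variables have been
  added.\<close>

lemma idgen_idgen:
  assumes F: "F \<subseteq> C m" and mp: "m \<le> p"
  shows "idgen p (idgen m F) = idgen p F"
proof -
  have Fp: "F \<subseteq> C p" using F C_mono[OF mp] by blast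
  have P: "isid p (idgen p F)" by (rule isid_idgen[OF Fp])
  have "isid m (C m \<inter> idgen p F)"
    using C_mono[OF mp]
    by (intro isidI) (auto intro: C_add C_mult isid_0[OF P] isid_add[OF P] isid_mult[OF P])
  then have "idgen m F \<subseteq> idgen p F"
    using idgen_least[of m "C m \<inter> idgen p F" F] F idgen_superset[of F p] by blast
  then have 1: "idgen p (idgen m F) \<subseteq> idgen p F" by (rule idgen_least[OF P])
  have "idgen m F \<subseteq> C p" using isid_subset[OF isid_idgen[OF F]] C_mono[OF mp] by blast
  then have "isid p (idgen p (idgen m F))" by (rule isid_idgen)
  then have "idgen p F \<subseteq> idgen p (idgen m F)"
    by (rule idgen_least) (rule subset_trans[OF idgen_superset idgen_superset])
  with 1 show ?thesis by blast
qed

section \<open>Homogeneous series\<close>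

definition homog :: "nat \<Rightarrow> pseries \<Rightarrow> bool"
  where "homog k f \<longleftrightarrow> (\<forall>\<alpha>. cf f \<alpha> \<noteq> 0 \<longrightarrow> mdeg \<alpha> = k)"

lemma homog_mult:
  assumes "homog j f" "homog k g"
  shows "homog (j + k) (f * g)"
  unfolding homog_def
proof (intro allI impI)
  fix \<gamma> assume "cf (f * g) \<gamma> \<noteq> 0"
  then obtain x where "x \<in> {(\<alpha>, \<beta>). \<alpha> + \<beta> = \<gamma>}" "(case x of (\<alpha>, \<beta>) \<Rightarrow> cf f \<alpha> * cf g \<beta>) \<noteq> 0"
    unfolding cf_mult by (rule sum.not_neutral_contains_not_neutral)
  then show "mdeg \<gamma> = j + k" using assms by (auto simp: homog_def)
qed

lemma homog_1: "homog 0 1"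
  by (simp add: homog_def cf_1)

lemma homog_power: "homog k f \<Longrightarrow> homog (j * k) (f ^ j)"
  by (induction j) (auto simp: homog_1 homog_mult)

lemma homog_prod: "finite A \<Longrightarrow> (\<And>i. i \<in> A \<Longrightarrow> homog (k i) (f i)) \<Longrightarrow> homog (sum k A) (prod f A)"
  by (induction A rule: finite_induct) (auto simp: homog_1 homog_mult)

lemma homog_mpow: "(\<And>i. i \<in> keys \<alpha> \<Longrightarrow> homog 1 (g i)) \<Longrightarrow> homog (mdeg \<alpha>) (mpow g \<alpha>)"
  unfolding mdeg_def mpow_def by (intro homog_prod) (use homog_power[of 1] in auto)

lemma homog_subst:
  assumes f: "homog k f" and g: "\<And>i. i < n \<Longrightarrow> homog 1 (g i)"
  shows "homog k (subst n g f)"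
  unfolding homog_def
proof (intro allI impI)
  fix \<gamma> assume "cf (subst n g f) \<gamma> \<noteq> 0"
  then obtain \<alpha> where \<alpha>: "\<alpha> \<in> lowdeg n (mdeg \<gamma>)" "cf f \<alpha> * cf (mpow g \<alpha>) \<gamma> \<noteq> 0"
    unfolding cf_subst by (rule sum.not_neutral_contains_not_neutral)
  have "homog (mdeg \<alpha>) (mpow g \<alpha>)" by (intro homog_mpow g lowdegD[OF \<alpha>(1)])
  then show "mdeg \<gamma> = k" using \<alpha>(2) f by (auto simp: homog_def)
qed

lemma homog_diff: "homog k f \<Longrightarrow> homog k g \<Longrightarrow> homog k (f - g)"
  unfolding homog_def by (metis cf_diff diff_zero eq_iff_diff_eq_0)

lemma homog_xv: "homog 1 (xv i)"
  by (simp add: homog_def cf_xv)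

lemma homog_linpart: "homog 1 (linpart n f)"
  unfolding homog_def
proof (intro allI impI)
  fix \<alpha> assume "cf (linpart n f) \<alpha> \<noteq> 0"
  then obtain i where "i \<in> {..<n}" "cf (scl (cf f (single1 i)) (xv i)) \<alpha> \<noteq> 0"
    unfolding linpart_def cf_sum by (rule sum.not_neutral_contains_not_neutral)
  then have "cf (xv i) \<alpha> \<noteq> 0" by simp
  then show "mdeg \<alpha> = 1" using homog_xv by (simp add: homog_def)
qed

lemma homog_eq_0: "homog k f \<Longrightarrow> ordge (Suc k) f \<Longrightarrow> f = 0"
  by (rule pseries_eqI) (force simp: homog_def ordge_def)

lemma homog_ordge: "homog k f \<Longrightarrow> ordge k f"
  by (simp add: homog_def ordge_def)

lemma homogeneous_quadratic_iff: "homogeneous_quadratic n (cf f) \<longleftrightarrow> in_vars n (cf f) \<and> homog 2 f"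
  by (simp add: homogeneous_quadratic_def homog_def)

lemma linpart_Mid: "linpart n f \<in> Mid n 1"
  by (simp add: Mid_def C_linpart homog_ordge[OF homog_linpart])

text \<open>The linear part of a composite is the composite of the linear parts. The difference of
  the two sides is therefore linear and of order 2, hence 0. It is enough that the given maps are
  inverse to first order.\<close>

lemma linpart_inverse:
  assumes \<Phi>: "\<And>i. i < n \<Longrightarrow> \<Phi> i \<in> Mid p 1" and \<Psi>: "\<Psi> \<in> Mid n 1" and inv: "ordge 2 (subst n \<Phi> \<Psi> - xv i)"
  shows "subst n (\<lambda>i. linpart p (\<Phi> i)) (linpart n \<Psi>) = xv i"
proof -
  let ?L = "\<lambda>i. linpart p (\<Phi> i)"
  have L: "ordge 1 (?L i)" for i by (rule homog_ordge[OF homog_linpart])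
  have "ordge (1 + 1) (subst n \<Phi> \<Psi> - subst n ?L \<Psi>)"
  proof (rule subst_diff_ordge)
    show "ordge (Suc 1) (\<Phi> i - ?L i)" if "i < n" for i
      using linpart_approx[OF \<Phi>[OF that]] by (simp add: Mid_def numeral_2_eq_2)
  qed (use \<Phi> \<Psi> L in \<open>auto simp: Mid_def\<close>)
  then have "ordge 2 (subst n \<Phi> \<Psi> - subst n ?L \<Psi>)" by (simp add: numeral_2_eq_2)
  moreover have "ordge 2 (subst n ?L (\<Psi> - linpart n \<Psi>))"
    using linpart_approx[OF \<Psi>] by (intro subst_ordge L) (simp add: Mid_def)
  ultimately have "ordge 2 ((subst n \<Phi> \<Psi> - xv i) - (subst n \<Phi> \<Psi> - subst n ?L \<Psi>) - subst n ?L (\<Psi> - linpart n \<Psi>))"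
    by (rule ordge_diff[OF ordge_diff[OF inv]])
  then have "ordge 2 (subst n ?L (linpart n \<Psi>) - xv i)" by (simp add: subst_diff)
  moreover have "homog 1 (subst n ?L (linpart n \<Psi>) - xv i)"
    by (intro homog_diff homog_subst homog_linpart homog_xv)
  ultimately have "subst n ?L (linpart n \<Psi>) - xv i = 0"
    by (intro homog_eq_0[of 1]) (simp_all add: numeral_2_eq_2)
  then show ?thesis by simp
qed

text \<open>If \<open>g\<close> in \<open>I\<close> approximates \<open>f\<close> to order
  \<open>k\<close>, then the image of \<open>f - g\<close> lies in \<open>I\<close> and equals
  \<open>f - g\<close> up to one order more. Adding it to \<open>g\<close> improves the
  approximation, and \<open>krull\<close> concludes.\<close>

lemma unipotent_ideal_vimage:
  assumes I: "isid n I" and \<theta>: "\<And>i. i < n \<Longrightarrow> \<theta> i \<in> C n" "\<And>i. i < n \<Longrightarrow> ordge 2 (\<theta> i - xv i)"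
    and \<theta>I: "\<And>f. f \<in> I \<Longrightarrow> subst n \<theta> f \<in> I" and f: "f \<in> C n" "subst n \<theta> f \<in> I"
  shows "f \<in> I"
proof (rule krull[OF I f(1)])
  fix k show "\<exists>g\<in>I. ordge k (f - g)"
  proof (induction k)
    case 0
    then show ?case using isid_0[OF I] by (intro bexI[of _ 0]) auto
  next
    case (Suc k)
    then obtain g where g: "g \<in> I" "ordge k (f - g)" by blast
    have "subst n \<theta> (f - g) \<in> I"
      unfolding subst_diff by (intro isid_diff[OF I] f \<theta>I g)
    moreover have "ordge (Suc k) (subst n \<theta> (f - g) - (f - g))"
      using f(1) isid_subset[OF I g(1)] by (intro subst_unipotent \<theta> g C_in_vars C_diff)
    then have "ordge (Suc k) (f - (g + subst n \<theta> (f - g)))"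
      using ordge_uminus by (fastforce simp: algebra_simps)
    ultimately show ?case using isid_add[OF I g(1)] by blast
  qed
qed

lemma id_algebra_hom: "id \<in> algebra_hom S S"
  by (simp add: algebra_hom_def ring_hom_def)

lemma presents_change:
  assumes 1: "presents n I S \<pi>" and 2: "presents p K S \<pi>'"
  obtains \<Phi> where "\<And>i. i < n \<Longrightarrow> \<Phi> i \<in> Mid p 1" "\<And>f. f \<in> C n \<Longrightarrow> \<pi> f = \<pi>' (subst n \<Phi> f)"
proof -
  obtain \<Phi> where "\<And>i. i < n \<Longrightarrow> \<Phi> i \<in> Mid p 1" "\<And>f. f \<in> C n \<Longrightarrow> id (\<pi> f) = \<pi>' (subst n \<Phi> f)"
    using presents_hom_subst[OF 1 2 id_algebra_hom] by blast
  then show ?thesis by (intro that[of \<Phi>]) auto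
qed

lemma presents_change_ideal:
  assumes 1: "presents n I S \<pi>" and 2: "presents p K S \<pi>'"
    and \<Phi>: "\<And>i. i < n \<Longrightarrow> \<Phi> i \<in> Mid p 1" "\<And>f. f \<in> C n \<Longrightarrow> \<pi> f = \<pi>' (subst n \<Phi> f)" and f: "f \<in> I"
  shows "subst n \<Phi> f \<in> K"
proof -
  have fC: "f \<in> C n" by (rule isid_subset[OF presents_isid[OF 1] f])
  then have "subst n \<Phi> f \<in> C p" using \<Phi>(1) by (intro C_subst) (auto simp: Mid_def)
  moreover have "\<pi>' (subst n \<Phi> f) = \<pi>' 0"
    using presents_eq[OF 1 fC C_0] f \<Phi>(2)[OF fC] \<Phi>(2)[OF C_0] by simp
  ultimately show ?thesis using presents_eq[OF 2 _ C_0] by auto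
qed

lemma presents_change_inverse:
  assumes 1: "presents n I S \<pi>" and 2: "presents p K S \<pi>'"
    and \<Phi>: "\<And>i. i < n \<Longrightarrow> \<Phi> i \<in> Mid p 1" "\<And>f. f \<in> C n \<Longrightarrow> \<pi> f = \<pi>' (subst n \<Phi> f)"
    and \<Psi>: "\<And>i. i < p \<Longrightarrow> \<Psi> i \<in> Mid n 1" "\<And>f. f \<in> C p \<Longrightarrow> \<pi>' f = \<pi> (subst p \<Psi> f)"
    and i: "i < p"
  shows "subst n \<Phi> (\<Psi> i) - xv i \<in> K"
proof -
  have \<Psi>C: "\<Psi> i \<in> C n" "ordge 1 (\<Psi> i)" using \<Psi>(1)[OF i] by (auto simp: Mid_def)
  have "subst n \<Phi> (\<Psi> i) \<in> C p" using \<Phi>(1) \<Psi>C by (intro C_subst) (auto simp: Mid_def)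
  moreover have "\<pi>' (subst n \<Phi> (\<Psi> i)) = \<pi>' (xv i)"
    using \<Phi>(2)[OF \<Psi>C(1)] \<Psi>(2)[OF C_xv[OF i]] subst_xv[of i p \<Psi>, OF i \<Psi>C(2)] by simp
  ultimately show ?thesis using presents_eq[OF 2 _ C_xv[OF i]] by blast
qed

section \<open>Descent of quadratic equations\<close>

text \<open>The quadratic part of an element of the ideal of \<open>J\<close> only involves the variables of \<open>J\<close>. Hence,
  in linearly changed coordinates, so do the quadrics \<open>F\<close>. Setting the other variables to \<open>0\<close> in the
  two changes of presentation gives unipotent automorphisms of \<open>C m\<close> between the ideals of \<open>J\<close> and of
  the transformed quadrics.\<close>

theorem quadratic_descent:
  assumes R: "presents m J R \<pi>R" and J2: "J \<subseteq> Mid m 2"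
    and S: "presents (m + d) (idgen (m + d) J) S \<pi>" and Q: "presents n (idgen n F) S \<pi>'"
    and F: "finite F" "\<And>f. f \<in> F \<Longrightarrow> homogeneous_quadratic n (cf f)"
  shows "\<exists>F' \<pi>. finite F' \<and> (\<forall>f\<in>F'. homogeneous_quadratic m (cf f)) \<and> presents m (idgen m F') R \<pi>"
proof -
  define p where "p = m + d"
  have mp: "m \<le> p" by (simp add: p_def)
  define Je where "Je = idgen p J"
  define I where "I = idgen n F"
  note S = S[folded p_def, folded Je_def] and Q = Q[folded I_def]
  have J: "isid m J" by (rule presents_isid[OF R])
  have JC: "J \<subseteq> C p" using isid_subset[OF J] C_mono[OF mp] by blast
  have Je: "isid p Je" and I: "isid n I" by (rule presents_isid[OF S], rule presents_isid[OF Q])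
  have FM: "f \<in> Mid n 2" if "f \<in> F" for f by (rule homogeneous_quadratic_Mid[OF F(2)[OF that]])
  have FC: "F \<subseteq> C n" using FM by (auto simp: Mid_def)
  have FI: "F \<subseteq> I" unfolding I_def by (rule idgen_superset)
  have I2: "I \<subseteq> Mid n 2" unfolding I_def using FM by (intro idgen_least isid_Mid) blast
  \<comment> \<open>Elements of \<open>J\<close> have order 2, so passing to multiples only scales
    their quadratic parts; no added variable enters there.\<close>
  have Je2: "Je \<subseteq> {f \<in> Mid p 2. \<forall>\<alpha>\<in>{\<alpha>. \<not> keys \<alpha> \<subseteq> {..<m}}. mdeg \<alpha> = 2 \<longrightarrow> cf f \<alpha> = 0}" (is "_ \<subseteq> ?L")
    unfolding Je_def
  proof (rule idgen_least[OF isid_lowest_coeffs], rule subsetI)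
    fix f assume "f \<in> J"
    then have "f \<in> C m" "ordge 2 f" "f \<in> C p" using J2 JC by (auto simp: Mid_def)
    then show "f \<in> ?L" using C_in_vars[of f m] by (auto simp: in_vars_def Mid_def)
  qed
  obtain \<Phi> where \<Phi>: "\<And>i. i < n \<Longrightarrow> \<Phi> i \<in> Mid p 1" "\<And>f. f \<in> C n \<Longrightarrow> \<pi>' f = \<pi> (subst n \<Phi> f)"
    by (rule presents_change[OF Q S]) blast
  obtain \<Psi> where \<Psi>: "\<And>i. i < p \<Longrightarrow> \<Psi> i \<in> Mid n 1" "\<And>f. f \<in> C p \<Longrightarrow> \<pi> f = \<pi>' (subst p \<Psi> f)"
    by (rule presents_change[OF S Q]) blast
  have \<Phi>C: "\<Phi> i \<in> C p" "ordge 1 (\<Phi> i)" if "i < n" for i using \<Phi>(1)[OF that] by (auto simp: Mid_def)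
  have \<Psi>C: "\<Psi> i \<in> C n" "ordge 1 (\<Psi> i)" if "i < p" for i using \<Psi>(1)[OF that] by (auto simp: Mid_def)
  define \<Lambda> where "\<Lambda> i = linpart p (\<Phi> i)" for i
  define \<Lambda>' where "\<Lambda>' i = linpart n (\<Psi> i)" for i
  have \<Lambda>C: "\<Lambda> i \<in> C p" "ordge 1 (\<Lambda> i)" "homog 1 (\<Lambda> i)" for i
    using linpart_Mid homog_linpart by (auto simp: \<Lambda>_def Mid_def)
  have \<Lambda>'C: "\<Lambda>' i \<in> C n" "ordge 1 (\<Lambda>' i)" "homog 1 (\<Lambda>' i)" for i
    using linpart_Mid homog_linpart by (auto simp: \<Lambda>'_def Mid_def)
  \<comment> \<open>The two changes of presentation are inverse only modulo the ideals, but these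
    have order 2, so the linear parts are inverse exactly.\<close>
  have \<Lambda>\<Lambda>': "subst n \<Lambda> (\<Lambda>' i) = xv i" if i: "i < p" for i
    unfolding \<Lambda>_def \<Lambda>'_def
  proof (rule linpart_inverse[OF \<Phi>(1) \<Psi>(1)[OF i]])
    show "ordge 2 (subst n \<Phi> (\<Psi> i) - xv i)"
      using presents_change_inverse[OF Q S \<Phi> \<Psi> i] Je2 by (auto simp: Mid_def)
  qed
  have \<Lambda>'\<Lambda>: "subst p \<Lambda>' (\<Lambda> i) = xv i" if i: "i < n" for i
    unfolding \<Lambda>_def \<Lambda>'_def
  proof (rule linpart_inverse[OF \<Psi>(1) \<Phi>(1)[OF i]])
    show "ordge 2 (subst p \<Psi> (\<Phi> i) - xv i)"
      using presents_change_inverse[OF S Q \<Psi> \<Phi> i] I2 by (auto simp: Mid_def)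
  qed
  have \<Phi>\<Lambda>: "ordge (Suc 1) (\<Phi> i - \<Lambda> i)" if "i < n" for i
    using linpart_approx[OF \<Phi>(1)[OF that]] by (simp add: \<Lambda>_def Mid_def numeral_2_eq_2)
  have \<Psi>\<Lambda>': "ordge 2 (\<Psi> i - \<Lambda>' i)" if "i < p" for i
    using linpart_approx[OF \<Psi>(1)[OF that]] by (simp add: \<Lambda>'_def Mid_def)

  define F' where "F' = subst n \<Lambda> ` F"
  define I' where "I' = idgen m F'"
  \<comment> \<open>\<open>subst n \<Lambda> f\<close> is the quadratic part of
    \<open>subst n \<Phi> f\<close>, an element of \<open>Je\<close>; by \<open>Je2\<close> only the
    variables of \<open>J\<close> occur in it.\<close>
  have F'C: "subst n \<Lambda> f \<in> C m" "homogeneous_quadratic m (cf (subst n \<Lambda> f))" if f: "f \<in> F" for f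
  proof -
    have fC: "f \<in> C n" "ordge 2 f" using FM[OF f] by (auto simp: Mid_def)
    have h: "homog 2 (subst n \<Lambda> f)"
      using F(2)[OF f] by (intro homog_subst \<Lambda>C) (simp add: homogeneous_quadratic_iff)
    have "subst n \<Phi> f \<in> Je" by (rule presents_change_ideal[OF Q S \<Phi>]) (use f FI in auto)
    then have q: "cf (subst n \<Phi> f) \<alpha> = 0" if "\<not> keys \<alpha> \<subseteq> {..<m}" "mdeg \<alpha> = 2" for \<alpha>
      using that Je2 by blast
    have "ordge (1 + 2) (subst n \<Phi> f - subst n \<Lambda> f)"
      by (rule subst_diff_ordge[OF \<Phi>C(2) \<Lambda>C(2) \<Phi>\<Lambda> fC(2)])
    then have "cf (subst n \<Lambda> f) \<alpha> = cf (subst n \<Phi> f) \<alpha>" if "mdeg \<alpha> = 2" for \<alpha>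
      using ordgeD[of "1 + 2" _ \<alpha>] that by fastforce
    then have iv: "in_vars m (cf (subst n \<Lambda> f))"
      using h q unfolding in_vars_def homog_def by metis
    moreover have "subst n \<Lambda> f \<in> C p" by (intro C_subst fC \<Lambda>C)
    ultimately show "subst n \<Lambda> f \<in> C m" by (simp add: C_def)
    show "homogeneous_quadratic m (cf (subst n \<Lambda> f))" using iv h by (simp add: homogeneous_quadratic_iff)
  qed
  have F'sub: "F' \<subseteq> C m" using F'C(1) by (auto simp: F'_def)
  have I': "isid m I'" unfolding I'_def by (rule isid_idgen[OF F'sub])
  have F'I': "F' \<subseteq> I'" unfolding I'_def by (rule idgen_superset)

  \<comment> \<open>Sets the added variables to 0. This retracts \<open>C p\<close> onto
    \<open>C m\<close> and maps \<open>Je\<close> into \<open>J\<close>.\<close>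
  define z where "z i = (if i < m then xv i else 0)" for i
  have z: "z i \<in> Mid m 1" for i by (auto simp: z_def Mid_def C_xv ordge_xv)
  have zC: "z i \<in> C m" "ordge 1 (z i)" for i using z[of i] by (auto simp: Mid_def)
  have zf: "subst p z f = f" if f: "f \<in> C m" for f
  proof -
    have "subst p z f = subst m z f" by (rule subst_C_extend[OF f mp zC(2)])
    also have "\<dots> = subst m xv f" by (rule subst_cong) (simp add: z_def)
    finally show ?thesis by (simp add: subst_id[OF C_in_vars[OF f]])
  qed
  have zx: "subst p z (xv i) = xv i" if "i < m" for i by (rule zf[OF C_xv[OF that]])
  have zJe: "subst p z f \<in> J" if "f \<in> Je" for f
  proof -
    have "Je \<subseteq> {f \<in> C p. subst p z f \<in> J}"
      unfolding Je_def
    proof (rule idgen_least[OF subst_isid_vimage[OF J z]], rule subsetI)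
      fix f assume "f \<in> J"
      then show "f \<in> {f \<in> C p. subst p z f \<in> J}" using zf[OF isid_subset[OF J]] JC by auto
    qed
    then show ?thesis using that by blast
  qed

  \<comment> \<open>\<open>\<Phi>\<close> and \<open>\<Psi>\<close>, each normalised by the opposite
    linear change so as to be tangent to the identity, and then restricted by
    \<open>z\<close>.\<close>
  define A where "A i = subst p z (subst n \<Phi> (\<Lambda>' i))" for i
  define B where "B i = subst p z (subst n \<Lambda> (\<Psi> i))" for i
  have AC: "A i \<in> C m" for i
    unfolding A_def by (intro C_subst zC \<Phi>C \<Lambda>'C)
  have BC: "B i \<in> C m" if "i < m" for i
    unfolding B_def using that mp by (intro C_subst zC \<Lambda>C \<Psi>C) auto
  have A2: "ordge 2 (A i - xv i)" if i: "i < m" for i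
  proof -
    have "ordge (1 + 1) (subst n \<Phi> (\<Lambda>' i) - subst n \<Lambda> (\<Lambda>' i))"
      by (rule subst_diff_ordge[OF \<Phi>C(2) \<Lambda>C(2) \<Phi>\<Lambda> \<Lambda>'C(2)])
    then have "ordge 2 (subst n \<Phi> (\<Lambda>' i) - xv i)" using \<Lambda>\<Lambda>' i mp by (simp add: numeral_2_eq_2)
    then have "ordge 2 (subst p z (subst n \<Phi> (\<Lambda>' i) - xv i))" by (intro subst_ordge zC)
    then show ?thesis using zx[OF i] by (simp add: A_def subst_diff)
  qed
  have B2: "ordge 2 (B i - xv i)" if i: "i < m" for i
  proof -
    have ip: "i < p" using i mp by simp
    have "ordge 2 (subst n \<Lambda> (\<Psi> i - \<Lambda>' i))" by (intro subst_ordge \<Lambda>C \<Psi>\<Lambda>' ip)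
    then have "ordge 2 (subst p z (subst n \<Lambda> (\<Psi> i) - xv i))"
      by (intro subst_ordge zC) (simp add: subst_diff \<Lambda>\<Lambda>'[OF ip])
    then show ?thesis using zx[OF i] by (simp add: B_def subst_diff)
  qed
  have A1: "ordge 1 (A i)" and B1: "ordge 1 (B i)" if "i < m" for i
    using ordge_1_if_unipotent A2[OF that] B2[OF that] by blast+

  have A_eq: "subst m A f = subst p z (subst n \<Phi> (subst p \<Lambda>' f))" if f: "f \<in> C m" for f
  proof -
    have "subst p \<Lambda>' f = subst m \<Lambda>' f" by (rule subst_C_extend[OF f mp \<Lambda>'C(2)])
    then have "subst p z (subst n \<Phi> (subst p \<Lambda>' f)) = subst p z (subst m (\<lambda>i. subst n \<Phi> (\<Lambda>' i)) f)"
      by (simp add: subst_comp[OF \<Lambda>'C(2) \<Phi>C(2)])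
    also have "\<dots> = subst m A f"
      unfolding A_def by (intro subst_comp subst_ordge zC \<Phi>C \<Lambda>'C)
    finally show ?thesis by simp
  qed
  have B_eq: "subst m B f = subst p z (subst n \<Lambda> (subst p \<Psi> f))" if f: "f \<in> C m" for f
  proof -
    have \<Psi>m: "ordge 1 (\<Psi> i)" if "i < m" for i using \<Psi>C that mp by simp
    have "subst p \<Psi> f = subst m \<Psi> f" by (rule subst_C_extend[OF f mp \<Psi>C(2)])
    then have "subst p z (subst n \<Lambda> (subst p \<Psi> f)) = subst p z (subst m (\<lambda>i. subst n \<Lambda> (\<Psi> i)) f)"
      by (simp add: subst_comp[OF \<Psi>m \<Lambda>C(2)])
    also have "\<dots> = subst m B f"
      unfolding B_def by (intro subst_comp subst_ordge zC \<Lambda>C \<Psi>m)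
    finally show ?thesis by simp
  qed

  have AI': "subst m A f \<in> J" if f: "f \<in> I'" for f
  proof -
    have "I' \<subseteq> {f \<in> C m. subst m A f \<in> J}"
      unfolding I'_def
    proof (rule idgen_least, rule subst_isid_vimage[OF J])
      show "A i \<in> Mid m 1" if "i < m" for i using AC A1[OF that] by (simp add: Mid_def)
      show "F' \<subseteq> {f \<in> C m. subst m A f \<in> J}"
      proof
        fix g assume "g \<in> F'"
        then obtain f where f: "f \<in> F" "g = subst n \<Lambda> f" by (auto simp: F'_def)
        have fC: "f \<in> C n" using f FC by blast
        \<comment> \<open>\<open>\<Lambda>'\<close> undoes the linear change, so \<open>A\<close>
          sends the transformed quadric to the restriction of \<open>subst n \<Phi> f\<close>, which
          lies in \<open>Je\<close>.\<close>
        have "subst p \<Lambda>' g = subst n (\<lambda>i. subst p \<Lambda>' (\<Lambda> i)) f"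
          unfolding f(2) by (intro subst_comp \<Lambda>C \<Lambda>'C)
        also have "\<dots> = subst n xv f" by (rule subst_cong) (rule \<Lambda>'\<Lambda>)
        also have "\<dots> = f" by (rule subst_id[OF C_in_vars[OF fC]])
        finally have "subst m A g = subst p z (subst n \<Phi> f)" using A_eq F'C(1)[OF f(1)] f(2) by simp
        moreover have "subst n \<Phi> f \<in> Je" by (rule presents_change_ideal[OF Q S \<Phi>]) (use f FI in auto)
        ultimately show "g \<in> {f \<in> C m. subst m A f \<in> J}" using zJe F'C(1)[OF f(1)] f(2) by simp
      qed
    qed
    then show ?thesis using f by blast
  qed
  have BJ: "subst m B f \<in> I'" if f: "f \<in> J" for f
  proof -
    \<comment> \<open>\<open>\<Psi>\<close> maps \<open>J\<close> into \<open>I\<close>, and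
      \<open>\<Lambda>\<close> followed by \<open>z\<close> maps the generators \<open>F\<close> of
      \<open>I\<close> to \<open>F'\<close>.\<close>
    have "I \<subseteq> {f \<in> C n. subst n (\<lambda>i. subst p z (\<Lambda> i)) f \<in> I'}"
      unfolding I_def
    proof (rule idgen_least, rule subst_isid_vimage[OF I'])
      show "subst p z (\<Lambda> i) \<in> Mid m 1" for i
        by (auto simp: Mid_def intro!: C_subst subst_ordge zC \<Lambda>C)
      show "F \<subseteq> {f \<in> C n. subst n (\<lambda>i. subst p z (\<Lambda> i)) f \<in> I'}"
      proof
        fix f assume f: "f \<in> F"
        have "subst n (\<lambda>i. subst p z (\<Lambda> i)) f = subst p z (subst n \<Lambda> f)"
          by (rule subst_comp[symmetric]) (auto intro: \<Lambda>C zC)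
        also have "\<dots> = subst n \<Lambda> f" by (rule zf[OF F'C(1)[OF f]])
        also have "\<dots> \<in> I'" using F'I' f by (auto simp: F'_def)
        finally show "f \<in> {f \<in> C n. subst n (\<lambda>i. subst p z (\<Lambda> i)) f \<in> I'}" using f FC by blast
      qed
    qed
    moreover have "f \<in> Je" using f idgen_superset[of J p] by (auto simp: Je_def)
    then have "subst p \<Psi> f \<in> I" by (intro presents_change_ideal[OF S Q \<Psi>]) auto
    moreover have "subst p z (subst n \<Lambda> (subst p \<Psi> f)) = subst n (\<lambda>i. subst p z (\<Lambda> i)) (subst p \<Psi> f)"
      by (intro subst_comp \<Lambda>C zC)
    ultimately show ?thesis using B_eq[OF isid_subset[OF J f]] by auto
  qed

  \<comment> \<open>If \<open>A\<close> sends \<open>f\<close> into \<open>J\<close>, then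
    \<open>B\<close> sends the result into \<open>I'\<close>. The composite is unipotent and
    preserves \<open>I'\<close>, so \<open>f\<close> itself lies in \<open>I'\<close>.\<close>
  have ker: "{f \<in> C m. subst m A f \<in> J} = I'"
  proof
    show "I' \<subseteq> {f \<in> C m. subst m A f \<in> J}" using AI' isid_subset[OF I'] by blast
    show "{f \<in> C m. subst m A f \<in> J} \<subseteq> I'"
    proof
      fix f assume f: "f \<in> {f \<in> C m. subst m A f \<in> J}"
      define \<theta> where "\<theta> i = subst m B (A i)" for i
      have BA: "subst m B (subst m A h) = subst m \<theta> h" for h
        unfolding \<theta>_def by (intro subst_comp A1 B1)
      show "f \<in> I'"
      proof (rule unipotent_ideal_vimage[OF I', of \<theta>])
        fix i assume i: "i < m"
        show "\<theta> i \<in> C m" unfolding \<theta>_def by (intro C_subst AC BC B1)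
        have "ordge 2 (subst m B (A i - xv i))" by (intro subst_ordge A2 B1 i)
        then have "ordge 2 (\<theta> i - B i)" using subst_xv[of i m B, OF i B1[OF i]] by (simp add: subst_diff \<theta>_def)
        from ordge_add[OF this B2[OF i]] show "ordge 2 (\<theta> i - xv i)" by simp
      next
        fix h assume "h \<in> I'"
        then show "subst m \<theta> h \<in> I'" using BJ[OF AI'] BA by simp
      next
        show "f \<in> C m" using f by simp
        show "subst m \<theta> f \<in> I'" using BJ f BA by (metis (mono_tags, lifting) mem_Collect_eq)
      qed
    qed
  qed
  \<comment> \<open>The inverse of \<open>A\<close> supplies preimages of the variables, so
    composing \<open>\<pi>R\<close> with \<open>A\<close> remains surjective.\<close>
  obtain h where h: "\<And>i. i < m \<Longrightarrow> h i \<in> C m" "\<And>i. i < m \<Longrightarrow> ordge 2 (h i - xv i)"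
    and Ah: "\<And>f. f \<in> C m \<Longrightarrow> subst m A (subst m h f) = f"
    by (rule unipotent_inverse[OF AC A2]) blast+
  have "presents m {f \<in> C m. subst m A f \<in> J} R (\<lambda>f. \<pi>R (subst m A f))"
  proof (rule presents_subst[OF R])
    show "A i \<in> Mid m 1" if "i < m" for i using AC A1[OF that] by (simp add: Mid_def)
    fix j assume j: "j < m"
    have h1: "ordge 1 (h j)" by (rule ordge_1_if_unipotent[OF h(2)[OF j]])
    then show "h j \<in> Mid m 1" using h(1)[OF j] by (simp add: Mid_def)
    have "subst m A (h j) = xv j"
      using Ah[OF C_xv[OF j]] subst_xv[of j m h, OF j h1] by simp
    then show "subst m A (h j) - xv j \<in> J" using isid_0[OF J] by simp
  qed
  then have "presents m (idgen m F') R (\<lambda>f. \<pi>R (subst m A f))" unfolding ker I'_def .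
  moreover have "finite F'" "\<forall>f\<in>F'. homogeneous_quadratic m (cf f)"
    using F(1) F'C(2) by (auto simp: F'_def)
  ultimately show ?thesis by blast
qed

theorem theorem2p16:
  fixes OX :: "(complex, 'a) module" and OY :: "(complex, 'b) module" and \<phi> :: "'b \<Rightarrow> 'a"
  assumes "analytic_algebra OX"
    and "analytic_algebra OY"
    and "smooth_morphism OX OY \<phi>"
  shows "quadratic_algebraic_singularities OX \<longleftrightarrow> quadratic_algebraic_singularities OY"
proof
  have X: "complex_algebra OX" and Y: "complex_algebra OY"
    using assms by (simp_all add: analytic_algebra_def)
  have smooth: "formally_smooth OY OX \<phi>" using assms(3) by (simp add: smooth_morphism_def)
  obtain n I \<pi>X where pX: "presents n I OX \<pi>X" by (rule analytic_algebra_presents[OF assms(1)])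
  {
    assume "quadratic_algebraic_singularities OY"
    then obtain m F \<pi>Y where F: "finite F" "\<forall>f\<in>F. homogeneous_quadratic m (cf f)"
      and pY: "presents m (idgen m F) OY \<pi>Y"
      unfolding quadratic_iff_presents[OF Y] by blast
    obtain d \<pi> where "presents (m + d) (idgen (m + d) (idgen m F)) OX \<pi>"
      by (rule formally_smooth_presents[OF smooth pY pX])
    moreover have "F \<subseteq> C m" using homogeneous_quadratic_Mid F(2) by (auto simp: Mid_def)
    ultimately have "presents (m + d) (idgen (m + d) F) OX \<pi>" by (simp add: idgen_idgen)
    moreover have "\<forall>f\<in>F. homogeneous_quadratic (m + d) (cf f)"
      using F(2) by (fastforce simp: homogeneous_quadratic_def in_vars_def)
    ultimately show "quadratic_algebraic_singularities OX"
      unfolding quadratic_iff_presents[OF X] using F(1) by blast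
  }
  {
    assume "quadratic_algebraic_singularities OX"
    then obtain k F \<pi>' where F: "finite F" "\<forall>f\<in>F. homogeneous_quadratic k (cf f)"
      and pX': "presents k (idgen k F) OX \<pi>'"
      unfolding quadratic_iff_presents[OF X] by blast
    \<comment> \<open>The descent requires relations of order 2, so redundant variables are first
      eliminated from an arbitrary presentation of \<open>OY\<close>.\<close>
    obtain m0 J0 \<pi>0 where "presents m0 J0 OY \<pi>0" by (rule analytic_algebra_presents[OF assms(2)])
    then obtain m J \<pi>Y where pY: "presents m J OY \<pi>Y" and J: "J \<subseteq> Mid m 2"
      by (rule minimal_presentation)
    obtain d \<pi> where "presents (m + d) (idgen (m + d) J) OX \<pi>"
      by (rule formally_smooth_presents[OF smooth pY pX])
    then show "quadratic_algebraic_singularities OY"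
      unfolding quadratic_iff_presents[OF Y] using F by (intro exI[of _ m] quadratic_descent[OF pY J _ pX']) auto
  }
qed

end
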